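(* Let $X$ be the geometric Brownian motion $dX_t=\mu X_t\,dt+\sigma X_t\,dW_t$ with constants $\mu\in\mathbb{R}$, $\sigma>0$, let $b>0$ be a constant (flat) lower barrier, let $\tau_b=\inf\{t\ge0:X_t\le b\}$, and let $G(t,x)=\mathbb{P}(\tau_b\le t)$ where $X_0=x>b$. Set $r=\mu-\sigma^2/2$. Then $G_x(t,b+)$, the right-hand derivative of $G(t,\cdot)$ at the barrier, satisfies the weakly singular Volterra integral equation of the second kind $$G_x(t,b+)=-\frac{2}{b\sigma\sqrt{2\pi t}}\exp\!\left(-\frac{r^2t}{2\sigma^2}\right)+\frac{r}{\sigma\sqrt{2\pi}}\int_0^t\frac{G_x(u,b+)}{\sqrt{t-u}}\exp\!\left(-\frac{r^2(t-u)}{2\sigma^2}\right)du,\qquad t>0.$$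
   Context: $W$ is a standard Brownian motion on a filtered probability space $(\Omega,\mathcal{F},\mathbb{P};(\mathcal{F}_t)_{t\ge0})$ satisfying the usual conditions. The notation $G_x(t,b+)$ denotes the right-hand spatial derivative (limit from $x>b$) of $G(t,\cdot)$ at $b$. *)

theory Defs
  imports "HOL-Probability.Probability"
begin

text \<open>
  Continuous time is the half-line \<open>t \<ge> 0\<close>, represented by type \<^typ>\<open>real\<close>; the values of
  filtrations and processes at negative times are unconstrained. For this reason the locale
  \<open>filtration\<close> of the library, which is indexed by a whole type, is not used.
\<close>

definition usual_conditions :: "'a measure \<Rightarrow> (real \<Rightarrow> 'a measure) \<Rightarrow> bool" where
  "usual_conditions M F \<longleftrightarrow>
     prob_space M \<and> complete_measure M \<and>
     (\<forall>t\<ge>0. subalgebra M (F t)) \<and>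
     (\<forall>s t. 0 \<le> s \<and> s \<le> t \<longrightarrow> sets (F s) \<subseteq> sets (F t)) \<and>
     (\<forall>t\<ge>0. sets (F t) = (\<Inter>s\<in>{t<..}. sets (F s))) \<and>
     null_sets M \<subseteq> sets (F 0)"

definition continuous_adapted ::
    "'a measure \<Rightarrow> (real \<Rightarrow> 'a measure) \<Rightarrow> (real \<Rightarrow> 'a \<Rightarrow> real) \<Rightarrow> bool" where
  "continuous_adapted M F X \<longleftrightarrow>
     (\<forall>t\<ge>0. X t \<in> borel_measurable (F t)) \<and>
     (\<forall>\<omega>\<in>space M. continuous_on {0..} (\<lambda>t. X t \<omega>))"

definition standard_brownian_motion ::
    "'a measure \<Rightarrow> (real \<Rightarrow> 'a measure) \<Rightarrow> (real \<Rightarrow> 'a \<Rightarrow> real) \<Rightarrow> bool" where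
  "standard_brownian_motion M F W \<longleftrightarrow>
     continuous_adapted M F W \<and>
     (AE \<omega> in M. W 0 \<omega> = 0) \<and>
     (\<forall>s t. 0 \<le> s \<and> s < t \<longrightarrow>
        distributed M lborel (\<lambda>\<omega>. W t \<omega> - W s \<omega>) (normal_density 0 (sqrt (t - s))) \<and>
        prob_space.indep_set M (sets (F s))
          (sets (vimage_algebra (space M) (\<lambda>\<omega>. W t \<omega> - W s \<omega>) borel)))"

definition tendsto_in_probability ::
    "'a measure \<Rightarrow> (nat \<Rightarrow> 'a \<Rightarrow> real) \<Rightarrow> ('a \<Rightarrow> real) \<Rightarrow> bool" where
  "tendsto_in_probability M Y Z \<longleftrightarrow>
     (\<forall>\<epsilon>>0. (\<lambda>n. measure M {\<omega>\<in>space M. \<bar>Y n \<omega> - Z \<omega>\<bar> > \<epsilon>}) \<longlonglongrightarrow> 0)"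

text \<open>
  The data \<open>k\<close>, \<open>p\<close>, \<open>\<xi>\<close> encode the simple process
  \<open>\<Sum>i<k. \<xi> i \<cdot> 1\<^bsub>(p i, p (i+1)]\<^esub>\<close> with bounded coefficients \<open>\<xi> i\<close>
  known at time \<open>p i\<close>.
\<close>

definition simple_process_data ::
    "'a measure \<Rightarrow> (real \<Rightarrow> 'a measure) \<Rightarrow> nat \<Rightarrow> (nat \<Rightarrow> real) \<Rightarrow> (nat \<Rightarrow> 'a \<Rightarrow> real) \<Rightarrow> bool" where
  "simple_process_data M F k p \<xi> \<longleftrightarrow>
     0 \<le> p 0 \<and> (\<forall>i<k. p i \<le> p (Suc i)) \<and>
     (\<forall>i<k. \<xi> i \<in> borel_measurable (F (p i)) \<and> (\<exists>C. \<forall>\<omega>\<in>space M. \<bar>\<xi> i \<omega>\<bar> \<le> C))"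

definition simple_process ::
    "nat \<Rightarrow> (nat \<Rightarrow> real) \<Rightarrow> (nat \<Rightarrow> 'a \<Rightarrow> real) \<Rightarrow> real \<Rightarrow> 'a \<Rightarrow> real" where
  "simple_process k p \<xi> s \<omega> = (\<Sum>i<k. \<xi> i \<omega> * indicator {p i<..p (Suc i)} s)"

definition simple_integral ::
    "(real \<Rightarrow> 'a \<Rightarrow> real) \<Rightarrow> nat \<Rightarrow> (nat \<Rightarrow> real) \<Rightarrow> (nat \<Rightarrow> 'a \<Rightarrow> real) \<Rightarrow> real \<Rightarrow> 'a \<Rightarrow> real" where
  "simple_integral W k p \<xi> t \<omega> =
     (\<Sum>i<k. \<xi> i \<omega> * (W (min t (p (Suc i))) \<omega> - W (min t (p i)) \<omega>))"

text \<open>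
  \<open>I\<close> is (a version of) the Ito integral process \<open>I t = \<integral>\<^sub>0\<^sup>t H dW\<close>. Only continuous adapted
  integrands \<open>H\<close> are admitted, so the pathwise integral of \<open>(H\<^sub>n - H)\<^sup>2\<close> below always exists. As usual,
  \<open>I\<close> is the limit in probability of the integrals of simple processes \<open>H\<^sub>n\<close> that
  approximate \<open>H\<close> in the sense that \<open>\<integral>\<^sub>0\<^sup>t (H\<^sub>n - H)\<^sup>2 ds\<close> tends to 0 in probability; by the
  Ito isometry and localisation \<open>I t\<close> is then unique up to null sets.
\<close>

definition is_ito_integral ::
    "'a measure \<Rightarrow> (real \<Rightarrow> 'a measure) \<Rightarrow> (real \<Rightarrow> 'a \<Rightarrow> real) \<Rightarrow> (real \<Rightarrow> 'a \<Rightarrow> real)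
       \<Rightarrow> (real \<Rightarrow> 'a \<Rightarrow> real) \<Rightarrow> bool" where
  "is_ito_integral M F W H I \<longleftrightarrow>
     continuous_adapted M F H \<and>
     (\<forall>t\<ge>0. I t \<in> borel_measurable (F t)) \<and>
     (\<exists>k p \<xi>.
        (\<forall>n. simple_process_data M F (k n) (p n) (\<xi> n)) \<and>
        (\<forall>t\<ge>0.
           tendsto_in_probability M
             (\<lambda>n \<omega>. LBINT s:{0..t}. (simple_process (k n) (p n) (\<xi> n) s \<omega> - H s \<omega>)\<^sup>2) (\<lambda>_. 0) \<and>
           tendsto_in_probability M
             (\<lambda>n. simple_integral W (k n) (p n) (\<xi> n) t) (I t)))"

text \<open>\<open>dX\<^sub>t = \<mu> X\<^sub>t dt + \<sigma> X\<^sub>t dW\<^sub>t\<close>, \<open>X\<^sub>0 = x\<close>, in integral form.\<close>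

definition geometric_brownian_motion ::
    "'a measure \<Rightarrow> (real \<Rightarrow> 'a measure) \<Rightarrow> (real \<Rightarrow> 'a \<Rightarrow> real) \<Rightarrow> real \<Rightarrow> real \<Rightarrow> real
       \<Rightarrow> (real \<Rightarrow> 'a \<Rightarrow> real) \<Rightarrow> bool" where
  "geometric_brownian_motion M F W \<mu> \<sigma> x X \<longleftrightarrow>
     continuous_adapted M F X \<and>
     (AE \<omega> in M. X 0 \<omega> = x) \<and>
     (\<exists>I. is_ito_integral M F W (\<lambda>s \<omega>. \<sigma> * X s \<omega>) I \<and>
        (\<forall>t\<ge>0. AE \<omega> in M. X t \<omega> = X 0 \<omega> + (LBINT s:{0..t}. \<mu> * X s \<omega>) + I t \<omega>))"

text \<open>The infimum is taken in the extended reals, so that it is \<open>\<infinity>\<close> if the barrier is never reached.\<close>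

definition hitting_time :: "(real \<Rightarrow> 'a \<Rightarrow> real) \<Rightarrow> real \<Rightarrow> 'a \<Rightarrow> ereal" where
  "hitting_time X b \<omega> = Inf (ereal ` {t. 0 \<le> t \<and> X t \<omega> \<le> b})"

definition hitting_prob :: "'a measure \<Rightarrow> (real \<Rightarrow> 'a \<Rightarrow> real) \<Rightarrow> real \<Rightarrow> real \<Rightarrow> real" where
  "hitting_prob M X b t = measure M {\<omega>\<in>space M. hitting_time X b \<omega> \<le> ereal t}"

text \<open>
  The right-hand derivative at \<open>b\<close>; it is only meaningful together with
  \<open>f differentiable (at_right b)\<close>.
\<close>

abbreviation right_derivative :: "(real \<Rightarrow> real) \<Rightarrow> real \<Rightarrow> real" where
  "right_derivative f b \<equiv> vector_derivative f (at_right b)"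

end

theory Submission
  imports Defs
begin

text \<open>
  \<^bold>\<open>Why the equation holds.\<close> Put \<open>r = \<mu> - \<sigma>\<^sup>2 / 2\<close> and \<open>a = r / \<sigma>\<close>. The geometric Brownian motion is
  \<open>X\<^sub>t = x exp (r t + \<sigma> W\<^sub>t)\<close>, so \<open>G t x\<close> is the probability that the drifted Brownian motion
  \<open>ln (x / b) + r s + \<sigma> W\<^sub>s\<close> is non-positive at some \<open>s \<le> t\<close>. This probability is known in closed form
  in terms of the normal distribution function \<open>\<Phi>\<close>; differentiating it at the barrier gives
  \<open>G\<^sub>x(t, b+) = - 2 / (b \<sigma>) \<cdot> (g t + a \<Phi> (a \<surd>t))\<close> with the Gaussian kernel
  \<open>g t = exp (- a\<^sup>2 t / 2) / \<surd>(2 \<pi> t)\<close>. The Volterra equation then says that \<open>h t = g t + a \<Phi> (a \<surd>t)\<close>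
  solves \<open>h = g + a (h * g)\<close>, where \<open>*\<close> is the convolution on \<open>(0, t)\<close>.

  \<^bold>\<open>The convolution equation\<close> (\<open>volterra_gauss_kernel\<close>). Since \<open>\<Phi> (a \<surd>t) = 1/2 + a/2 \<integral>\<^sub>0\<^sup>t g\<close>, everything
  reduces to \<open>(g * g) t = exp (- a\<^sup>2 t / 2) / 2\<close>, which is the beta integral \<open>B(1/2, 1/2) = \<pi>\<close>, and to
  one application of Tonelli's theorem.

  \<^bold>\<open>The explicit solution\<close> (\<open>gbm_explicit\<close>). The stochastic differential equation is only given through the
  definition of the Ito integral as a limit in probability. Instead of developing the Ito calculus, the
  proof shows directly that \<open>Z\<^sub>t X\<^sub>t\<close> with \<open>Z\<^sub>t = exp (- r t - \<sigma> W\<^sub>t)\<close> is constant: its increments over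
  a uniform grid are summed exactly (\<open>discrete_product_rule\<close>), and the three resulting sums
  vanish in probability as the mesh tends to 0. The tool is a discrete Lenglart inequality
  (\<open>discrete_lenglart\<close>): a sum of martingale differences is small, uniformly in time, outside the event
  that its conditional variance is large. Its proof by truncation copes with the possible lack of
  moments of \<open>X\<close>. It serves twice: to approximate the Ito integral at all grid points simultaneously by the
  Riemann sums over the grid (\<open>riemann_error_null\<close>), and to estimate the second-order terms
  (\<open>array_null_in_prob\<close>).

  \<^bold>\<open>The hitting probability\<close> (\<open>drifted_hitting_probability\<close>). The reflection principle and the
  change of drift are combined into one pay-off \<open>f z = 1 + exp (- 2 r z / \<sigma>\<^sup>2)\<close> for \<open>z \<le> 0\<close> and
  \<open>f z = 0\<close> for \<open>z > 0\<close>, whose expectation at any positive time after a start at the barrier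
  is exactly 1. By the Markov property at the hitting time, rounded up to a grid, \<open>P (\<tau> \<le> T)\<close> equals the
  expected pay-off at time \<open>T\<close>, a Gaussian integral.
\<close>

section \<open>The standard normal distribution function\<close>

definition Phi :: "real \<Rightarrow> real" where
  "Phi x = (\<integral>z. indicator {..x} z * std_normal_density z \<partial>lborel)"

lemma integrable_indicator_normal:
  assumes "\<sigma> > 0" "A \<in> sets borel"
  shows "integrable lborel (\<lambda>z. indicator A z * normal_density m \<sigma> z)"
  using integrable_real_mult_indicator[of A lborel "normal_density m \<sigma>"] assms by (simp add: mult.commute)

lemma Phi_has_real_derivative: "(Phi has_real_derivative std_normal_density x) (at x)"
proof -
  have si: "set_integrable lborel A std_normal_density" if "A \<in> sets borel" for A
    using integrable_indicator_normal[of 1 A 0] that by (simp add: set_integrable_def)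
  have split: "Phi y = Phi (x - 1) + (LBINT z=x-1..y. std_normal_density z)" if "x - 1 \<le> y" for y
  proof -
    have "Phi y = (LBINT z:{..x-1} \<union> {x-1<..y}. std_normal_density z)"
      using that by (simp add: Phi_def set_lebesgue_integral_def ivl_disj_un_one)
    also have "\<dots> = (LBINT z:{..x-1}. std_normal_density z) + (LBINT z:{x-1<..y}. std_normal_density z)"
      by (rule set_integral_Un) (auto intro!: si)
    finally show ?thesis
      using that by (simp add: Phi_def set_lebesgue_integral_def interval_integral_Ioc[unfolded set_lebesgue_integral_def])
  qed
  have cont: "continuous_on {x-1..x+1} std_normal_density"
    unfolding std_normal_density_def by (intro continuous_intros) auto
  have "((\<lambda>y. LBINT z=x-1..y. std_normal_density z) has_vector_derivative std_normal_density x)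
      (at x within {x-1..x+1})"
    by (rule interval_integral_FTC2[OF _ _ cont]) auto
  then have "((\<lambda>y. LBINT z=x-1..y. std_normal_density z) has_real_derivative std_normal_density x) (at x)"
    by (simp add: at_within_Icc_at has_real_derivative_iff_has_vector_derivative)
  then have "((\<lambda>y. Phi (x - 1) + (LBINT z=x-1..y. std_normal_density z)) has_real_derivative std_normal_density x) (at x)"
    by (auto intro!: derivative_eq_intros)
  then show ?thesis
  proof (rule has_field_derivative_transform_within_open)
    show "open {x-1<..}" "x \<in> {x-1<..}" by auto
    show "Phi (x - 1) + (LBINT z=x-1..y. std_normal_density z) = Phi y" if "y \<in> {x-1<..}" for y
      using split[of y] that by simp
  qed
qed

lemma isCont_Phi: "isCont Phi x"
  using Phi_has_real_derivative DERIV_isCont by blast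

lemma continuous_on_Phi: "continuous_on A Phi"
  by (simp add: continuous_at_imp_continuous_on isCont_Phi)

lemma DERIV_Phi [derivative_intros]:
  "(f has_real_derivative f') (at x within S) \<Longrightarrow>
    ((\<lambda>x. Phi (f x)) has_real_derivative std_normal_density (f x) * f') (at x within S)"
  using DERIV_chain2[OF Phi_has_real_derivative] by blast

lemma borel_measurable_Phi [measurable]: "Phi \<in> borel_measurable borel"
  by (rule borel_measurable_continuous_onI[OF continuous_on_Phi])

lemma integral_normal_density_atMost:
  assumes "\<sigma> > 0"
  shows "(\<integral>z. indicator {..c} z * normal_density m \<sigma> z \<partial>lborel) = Phi ((c - m) / \<sigma>)"
proof -
  have "(\<integral>z. indicator {..c} z * normal_density m \<sigma> z \<partial>lborel)
      = \<sigma> * (\<integral>z. indicator {..c} (m + \<sigma> * z) * normal_density m \<sigma> (m + \<sigma> * z) \<partial>lborel)"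
    using lborel_integral_real_affine[of \<sigma> "\<lambda>z. indicator {..c} z * normal_density m \<sigma> z" m] assms by simp
  also have "\<dots> = (\<integral>z. \<sigma> * (indicator {..c} (m + \<sigma> * z) * normal_density m \<sigma> (m + \<sigma> * z)) \<partial>lborel)"
    by simp
  also have "\<dots> = Phi ((c - m) / \<sigma>)"
    unfolding Phi_def
    using assms by (intro Bochner_Integration.integral_cong)
      (auto simp: normal_density_def indicator_def field_simps power2_eq_square real_sqrt_mult)
  finally show ?thesis .
qed

lemma Phi_minus: "Phi (- x) + Phi x = 1"
proof -
  have "Phi (- x) = (\<integral>z. indicator {..-x} (- z) * std_normal_density (- z) \<partial>lborel)"
    unfolding Phi_def using lborel_integral_real_affine[of "-1" "\<lambda>z. indicator {..-x} z * std_normal_density z" 0] by simp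
  also have "\<dots> = (\<integral>z. indicator {x..} z * std_normal_density z \<partial>lborel)"
    by (intro Bochner_Integration.integral_cong) (auto simp: std_normal_density_def indicator_def)
  also have "\<dots> = (\<integral>z. indicator {x<..} z * std_normal_density z \<partial>lborel)"
    by (intro integral_cong_AE) (use AE_lborel_singleton[of x] in \<open>auto simp: indicator_def elim!: eventually_mono\<close>)
  finally have "Phi (- x) + Phi x = (\<integral>z. indicator {x<..} z * std_normal_density z + indicator {..x} z * std_normal_density z \<partial>lborel)"
    unfolding Phi_def[of x] by (simp add: integrable_indicator_normal)
  also have "\<dots> = (\<integral>z. std_normal_density z \<partial>lborel)"
    by (intro Bochner_Integration.integral_cong) (auto simp: indicator_def)
  finally show ?thesis by simp
qed

lemma Phi_0: "Phi 0 = 1 / 2"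
  using Phi_minus[of 0] by simp

lemma Phi_bounds: "0 \<le> Phi x" "Phi x \<le> 1"
proof -
  show *: "0 \<le> Phi x" for x unfolding Phi_def by (intro integral_nonneg_AE) auto
  show "Phi x \<le> 1" using Phi_minus[of x] *[of "-x"] by simp
qed

section \<open>The Volterra equation of the Gaussian kernel\<close>

text \<open>
  Up to constants, this is both the inhomogeneity and the kernel of the Volterra equation, with
  \<open>a = r / \<sigma>\<close>.
\<close>

definition gauss_kernel :: "real \<Rightarrow> real \<Rightarrow> real" where
  "gauss_kernel a u = exp (- (a\<^sup>2 * u / 2)) / sqrt (2 * pi * u)"

text \<open>
  The primitive of the kernel that vanishes at 0. The case distinction is needed because the
  expression by \<open>Phi\<close> degenerates for \<open>a = 0\<close>; the relation \<open>kernel_primitive_Phi\<close> holds in both cases.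
\<close>

definition kernel_primitive :: "real \<Rightarrow> real \<Rightarrow> real" where
  "kernel_primitive a u = (if a = 0 then 2 * sqrt u / sqrt (2 * pi) else 2 / a * (Phi (a * sqrt u) - 1 / 2))"

lemma gauss_kernel_nonneg: "0 \<le> u \<Longrightarrow> 0 \<le> gauss_kernel a u"
  by (simp add: gauss_kernel_def)

lemma borel_measurable_gauss_kernel [measurable]: "gauss_kernel a \<in> borel_measurable borel"
  unfolding gauss_kernel_def by measurable

lemma kernel_primitive_Phi: "1 / 2 + a / 2 * kernel_primitive a u = Phi (a * sqrt u)"
  by (simp add: kernel_primitive_def Phi_0 field_simps)

lemma kernel_primitive_has_derivative:
  assumes "u > 0"
  shows "(kernel_primitive a has_real_derivative gauss_kernel a u) (at u)"
proof (cases "a = 0")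
  case True
  show ?thesis unfolding kernel_primitive_def[abs_def] gauss_kernel_def
    using assms True by (auto intro!: derivative_eq_intros simp: field_simps real_sqrt_mult)
next
  case False
  have "((\<lambda>u. 2 / a * (Phi (a * sqrt u) - 1 / 2)) has_real_derivative
     2 / a * (std_normal_density (a * sqrt u) * (a * (inverse (sqrt u) / 2)))) (at u)"
    using assms by (auto intro!: derivative_eq_intros simp: field_simps)
  then show ?thesis
    using assms False
    by (simp add: kernel_primitive_def[abs_def] gauss_kernel_def std_normal_density_def field_simps real_sqrt_mult power_mult_distrib)
qed

lemma nn_integral_FTC_interior:
  fixes F f :: "real \<Rightarrow> real"
  assumes "a \<le> b" "continuous_on {a..b} F"
    and "\<And>x. a < x \<Longrightarrow> x < b \<Longrightarrow> (F has_real_derivative f x) (at x)"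
    and "\<And>x. a < x \<Longrightarrow> x < b \<Longrightarrow> 0 \<le> f x"
  shows "(\<integral>\<^sup>+x. ennreal (f x) * indicator {a<..<b} x \<partial>lborel) = ennreal (F b - F a)"
proof -
  have "(f has_integral (F b - F a)) {a..b}"
    using assms by (intro fundamental_theorem_of_calculus_interior)
      (auto simp: has_real_derivative_iff_has_vector_derivative)
  then have "(f has_integral (F b - F a)) {a<..<b}"
    by (subst has_integral_open_interval[of _ _ a b, unfolded box_real cbox_interval]) auto
  then show ?thesis
    using assms(4) by (intro nn_integral_has_integral_lebesgue') auto
qed

lemma nn_integral_gauss_kernel:
  assumes "t \<ge> 0"
  shows "(\<integral>\<^sup>+u. ennreal (gauss_kernel a u) * indicator {0<..<t} u \<partial>lborel) = ennreal (kernel_primitive a t)"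
proof -
  have "continuous_on {0..t} (kernel_primitive a)"
    unfolding kernel_primitive_def[abs_def]
    by (cases "a = 0") (auto intro!: continuous_intros continuous_on_compose2[OF continuous_on_Phi[of UNIV]])
  moreover have "kernel_primitive a 0 = 0" by (simp add: kernel_primitive_def Phi_0)
  ultimately show ?thesis
    using nn_integral_FTC_interior[of 0 t "kernel_primitive a" "gauss_kernel a"] kernel_primitive_has_derivative gauss_kernel_nonneg assms by simp
qed

lemma kernel_primitive_nonneg: assumes "t \<ge> 0" shows "0 \<le> kernel_primitive a t"
proof (cases "a = 0")
  case False
  have "mono_on UNIV Phi" 
    by (intro mono_onI DERIV_nonneg_imp_nondecreasing[where f=Phi]) (auto intro!: exI Phi_has_real_derivative)
  then have "x \<le> y \<Longrightarrow> Phi x \<le> Phi y" for x y by (simp add: mono_on_def)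
  from this[of 0 "a * sqrt t"] this[of "a * sqrt t" 0] show ?thesis
    using False assms by (cases "a > 0") (auto simp: kernel_primitive_def Phi_0 divide_simps mult_nonneg_nonneg mult_nonpos_nonneg)
qed (use assms in \<open>simp add: kernel_primitive_def\<close>)

text \<open>
  The exponential factors multiply to a constant, and \<open>1 / \<surd>(u (t - u))\<close> has the
  primitive \<open>arcsin (2 u / t - 1)\<close>, whose total increment is \<open>\<pi>\<close>: the beta integral \<open>B(1/2, 1/2)\<close>.
\<close>

lemma nn_integral_gauss_kernel_convolution:
  assumes "t > 0"
  shows "(\<integral>\<^sup>+u. ennreal (gauss_kernel a u * gauss_kernel a (t - u)) * indicator {0<..<t} u \<partial>lborel)
    = ennreal (exp (- (a\<^sup>2 * t / 2)) / 2)"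
proof -
  define F where "F u = exp (- (a\<^sup>2 * t / 2)) / (2 * pi) * arcsin ((2 * u - t) / t)" for u
  have "(\<integral>\<^sup>+u. ennreal (gauss_kernel a u * gauss_kernel a (t - u)) * indicator {0<..<t} u \<partial>lborel) = ennreal (F t - F 0)"
  proof (rule nn_integral_FTC_interior)
    show "continuous_on {0..t} F" unfolding F_def
      using assms by (intro continuous_intros) (auto simp: field_simps)
  next
    fix u assume u: "0 < u" "u < t"
    have e: "exp (- (a\<^sup>2 * u / 2)) * exp (- (a\<^sup>2 * (t - u) / 2)) = exp (- (a\<^sup>2 * t / 2))"
      by (simp flip: exp_add add: field_simps)
    have "1 - ((2 * u - t) / t)\<^sup>2 = 4 * (u * (t - u)) / t\<^sup>2"
      using assms by (simp add: field_simps power2_eq_square)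
    then have s: "sqrt (1 - ((2 * u - t) / t)\<^sup>2) = 2 * sqrt (u * (t - u)) / t"
      using assms by (simp add: real_sqrt_divide real_sqrt_mult)
    have "(F has_real_derivative exp (- (a\<^sup>2 * t / 2)) / (2 * pi) * (inverse (sqrt (1 - ((2 * u - t) / t)\<^sup>2)) * (2 / t))) (at u)"
      unfolding F_def using assms u
      by (auto intro!: derivative_eq_intros simp: field_simps)
    also have "exp (- (a\<^sup>2 * t / 2)) / (2 * pi) * (inverse (sqrt (1 - ((2 * u - t) / t)\<^sup>2)) * (2 / t))
       = exp (- (a\<^sup>2 * t / 2)) / (2 * pi * sqrt (u * (t - u)))"
      unfolding s using assms u by (simp add: field_simps)
    also have "\<dots> = gauss_kernel a u * gauss_kernel a (t - u)"
    proof -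
      have "sqrt (2 * pi * u) * sqrt (2 * pi * (t - u)) = sqrt ((2 * pi)\<^sup>2 * (u * (t - u)))"
        by (simp only: real_sqrt_mult[symmetric]) (simp add: power2_eq_square ac_simps)
      also have "\<dots> = 2 * pi * sqrt (u * (t - u))"
        by (simp only: real_sqrt_mult real_sqrt_abs) simp
      finally show ?thesis
        unfolding gauss_kernel_def e[symmetric] by simp
    qed
    finally show "(F has_real_derivative gauss_kernel a u * gauss_kernel a (t - u)) (at u)" .
  qed (use assms gauss_kernel_nonneg in auto)
  also have "F t - F 0 = exp (- (a\<^sup>2 * t / 2)) / 2"
    using assms by (simp add: F_def)
  finally show ?thesis .
qed

text \<open>
  The primitive of the convolution square of the kernel, again with the limiting value at \<open>a = 0\<close>.
\<close>

definition convolution_primitive :: "real \<Rightarrow> real \<Rightarrow> real" where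
  "convolution_primitive a t = (if a = 0 then t / 2 else (1 - exp (- (a\<^sup>2 * t / 2))) / a\<^sup>2)"

lemma nn_integral_convolution_primitive:
  assumes "t \<ge> 0"
  shows "(\<integral>\<^sup>+s. ennreal (exp (- (a\<^sup>2 * s / 2)) / 2) * indicator {0<..<t} s \<partial>lborel) = ennreal (convolution_primitive a t)"
proof -
  have "(\<integral>\<^sup>+s. ennreal (exp (- (a\<^sup>2 * s / 2)) / 2) * indicator {0<..<t} s \<partial>lborel) = ennreal (convolution_primitive a t - convolution_primitive a 0)"
  proof (rule nn_integral_FTC_interior)
    show "continuous_on {0..t} (convolution_primitive a)"
      unfolding convolution_primitive_def[abs_def] by (cases "a = 0") (auto intro!: continuous_intros)
    show "(convolution_primitive a has_real_derivative exp (- (a\<^sup>2 * x / 2)) / 2) (at x)" for x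
      unfolding convolution_primitive_def[abs_def] by (cases "a = 0") (auto intro!: derivative_eq_intros simp: field_simps)
  qed (use assms in auto)
  then show ?thesis by (simp add: convolution_primitive_def)
qed

lemma convolution_primitive_nonneg: "t \<ge> 0 \<Longrightarrow> 0 \<le> convolution_primitive a t"
  by (auto simp: convolution_primitive_def)

text \<open>
  Convolution commutes with taking primitives: exchange the integrations over
  \<open>0 < v < u < t\<close> and substitute \<open>s = v + t - u\<close>, which maps this triangle to \<open>0 < v < s < t\<close>.
\<close>

lemma nn_integral_kernel_primitive_gauss_kernel:
  assumes "t > 0"
  shows "(\<integral>\<^sup>+u. ennreal (kernel_primitive a u * gauss_kernel a (t - u)) * indicator {0<..<t} u \<partial>lborel) = ennreal (convolution_primitive a t)"
proof -
  let ?i = "\<lambda>v u. indicator {0<..<t} u * (if 0 < v \<and> v < u then 1 else 0) :: ennreal"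
  have "(\<integral>\<^sup>+u. ennreal (kernel_primitive a u * gauss_kernel a (t - u)) * indicator {0<..<t} u \<partial>lborel)
     = (\<integral>\<^sup>+u. (\<integral>\<^sup>+v. ennreal (gauss_kernel a v) * ennreal (gauss_kernel a (t - u)) * ?i v u \<partial>lborel) \<partial>lborel)"
  proof (intro nn_integral_cong)
    fix u :: real
    have "(\<integral>\<^sup>+v. ennreal (gauss_kernel a v) * ennreal (gauss_kernel a (t - u)) * ?i v u \<partial>lborel)
      = (\<integral>\<^sup>+v. (ennreal (gauss_kernel a v) * indicator {0<..<u} v) * (ennreal (gauss_kernel a (t - u)) * indicator {0<..<t} u) \<partial>lborel)"
      by (intro nn_integral_cong) (simp add: ac_simps indicator_def)
    also have "\<dots> = (\<integral>\<^sup>+v. (ennreal (gauss_kernel a v) * indicator {0<..<u} v) \<partial>lborel) * (ennreal (gauss_kernel a (t - u)) * indicator {0<..<t} u)"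
      by (rule nn_integral_multc) measurable
    finally show "ennreal (kernel_primitive a u * gauss_kernel a (t - u)) * indicator {0<..<t} u
       = (\<integral>\<^sup>+v. ennreal (gauss_kernel a v) * ennreal (gauss_kernel a (t - u)) * ?i v u \<partial>lborel)"
      using nn_integral_gauss_kernel[of u a] kernel_primitive_nonneg[of u a] gauss_kernel_nonneg[of "t - u" a]
      by (cases "u \<in> {0<..<t}") (auto simp: ennreal_mult)
  qed
  also have "\<dots> = (\<integral>\<^sup>+v. (\<integral>\<^sup>+u. ennreal (gauss_kernel a v) * ennreal (gauss_kernel a (t - u)) * ?i v u \<partial>lborel) \<partial>lborel)"
    by (rule lborel_pair.Fubini') measurable
  also have "\<dots> = (\<integral>\<^sup>+v. (\<integral>\<^sup>+s. ennreal (gauss_kernel a v) * ennreal (gauss_kernel a (s - v)) * ?i v s \<partial>lborel) \<partial>lborel)"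
  proof (rule nn_integral_cong)
    fix v :: real
    have "(\<integral>\<^sup>+u. ennreal (gauss_kernel a v) * ennreal (gauss_kernel a (t - u)) * ?i v u \<partial>lborel) =
       (\<integral>\<^sup>+s. ennreal (gauss_kernel a v) * ennreal (gauss_kernel a (t - (v + t + (-1) * s))) * ?i v (v + t + (-1) * s) \<partial>lborel)"
      by (subst nn_integral_real_affine[where c="-1" and t="v + t"]) auto
    also have "\<dots> = (\<integral>\<^sup>+s. ennreal (gauss_kernel a v) * ennreal (gauss_kernel a (s - v)) * ?i v s \<partial>lborel)"
      by (intro nn_integral_cong) (auto simp: indicator_def)
    finally show "(\<integral>\<^sup>+u. ennreal (gauss_kernel a v) * ennreal (gauss_kernel a (t - u)) * ?i v u \<partial>lborel)
       = (\<integral>\<^sup>+s. ennreal (gauss_kernel a v) * ennreal (gauss_kernel a (s - v)) * ?i v s \<partial>lborel)" .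
  qed
  also have "\<dots> = (\<integral>\<^sup>+s. (\<integral>\<^sup>+v. ennreal (gauss_kernel a v) * ennreal (gauss_kernel a (s - v)) * ?i v s \<partial>lborel) \<partial>lborel)"
    by (rule lborel_pair.Fubini') measurable
  also have "\<dots> = (\<integral>\<^sup>+s. ennreal (exp (- (a\<^sup>2 * s / 2)) / 2) * indicator {0<..<t} s \<partial>lborel)"
  proof (intro nn_integral_cong)
    fix s :: real
    have "(\<integral>\<^sup>+v. ennreal (gauss_kernel a v) * ennreal (gauss_kernel a (s - v)) * ?i v s \<partial>lborel)
       = (\<integral>\<^sup>+v. (ennreal (gauss_kernel a v * gauss_kernel a (s - v)) * indicator {0<..<s} v) * indicator {0<..<t} s \<partial>lborel)"
      by (intro nn_integral_cong) (auto simp: indicator_def gauss_kernel_nonneg ennreal_mult)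
    also have "\<dots> = (\<integral>\<^sup>+v. (ennreal (gauss_kernel a v * gauss_kernel a (s - v)) * indicator {0<..<s} v) \<partial>lborel) * indicator {0<..<t} s"
      by (rule nn_integral_multc) measurable
    also have "\<dots> = ennreal (exp (- (a\<^sup>2 * s / 2)) / 2) * indicator {0<..<t} s"
      using nn_integral_gauss_kernel_convolution[of s a] by (cases "s \<in> {0<..<t}") auto
    finally show "(\<integral>\<^sup>+v. ennreal (gauss_kernel a v) * ennreal (gauss_kernel a (s - v)) * ?i v s \<partial>lborel)
       = ennreal (exp (- (a\<^sup>2 * s / 2)) / 2) * indicator {0<..<t} s" .
  qed
  also have "\<dots> = ennreal (convolution_primitive a t)" using nn_integral_convolution_primitive assms by simp
  finally show ?thesis .
qed

lemma nn_integral_gauss_kernel_reflect: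
  "(\<integral>\<^sup>+u. ennreal (gauss_kernel a (t - u)) * indicator {0<..<t} u \<partial>lborel) = (\<integral>\<^sup>+u. ennreal (gauss_kernel a u) * indicator {0<..<t} u \<partial>lborel)"
proof -
  have "(\<integral>\<^sup>+u. ennreal (gauss_kernel a (t - u)) * indicator {0<..<t} u \<partial>lborel)
     = (\<integral>\<^sup>+u. ennreal (gauss_kernel a (t - (t + (-1) * u))) * indicator {0<..<t} (t + (-1) * u) \<partial>lborel)"
    by (subst nn_integral_real_affine[where c="-1" and t="t"]) auto
  also have "\<dots> = (\<integral>\<^sup>+u. ennreal (gauss_kernel a u) * indicator {0<..<t} u \<partial>lborel)"
    by (intro nn_integral_cong) (auto simp: indicator_def)
  finally show ?thesis .
qed

lemma set_integral_from_nn_integral: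
  fixes f :: "real \<Rightarrow> real"
  assumes "(\<integral>\<^sup>+u. ennreal (f u) * indicator S u \<partial>lborel) = ennreal c" "0 \<le> c" "\<And>u. u \<in> S \<Longrightarrow> 0 \<le> f u"
    "set_borel_measurable lborel S f"
  shows "set_integrable lborel S f" "(LBINT u:S. f u) = c"
proof -
  have "(\<integral>\<^sup>+u. ennreal (indicator S u * f u) \<partial>lborel) = ennreal c"
    unfolding assms(1)[symmetric] by (intro nn_integral_cong) (auto simp: indicator_def)
  then have "integrable lborel (\<lambda>u. indicator S u * f u) \<and> (\<integral>u. indicator S u * f u \<partial>lborel) = c"
    using assms by (subst (asm) nn_integral_eq_integrable) (auto simp: set_borel_measurable_def indicator_def)
  then show "set_integrable lborel S f" "(LBINT u:S. f u) = c"
    by (auto simp: set_integrable_def set_lebesgue_integral_def)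
qed

lemma volterra_gauss_kernel:
  fixes a t :: real
  assumes "t > 0"
  defines "h \<equiv> \<lambda>u. gauss_kernel a u + a * Phi (a * sqrt u)"
  shows "set_integrable lborel {0<..<t} (\<lambda>u. h u * gauss_kernel a (t - u))" (is ?A)
    and "h t = gauss_kernel a t + a * (LBINT u:{0<..<t}. h u * gauss_kernel a (t - u))" (is ?B)
proof -
  have m: "kernel_primitive a \<in> borel_measurable borel" unfolding kernel_primitive_def[abs_def] by (cases "a = 0") auto
  note [measurable] = m
  note A = set_integral_from_nn_integral[OF nn_integral_gauss_kernel_convolution[OF assms(1), of a]]
  note B = set_integral_from_nn_integral[OF nn_integral_gauss_kernel_reflect[of a t, unfolded nn_integral_gauss_kernel[OF less_imp_le[OF assms(1)], of a]]]
  note C = set_integral_from_nn_integral[OF nn_integral_kernel_primitive_gauss_kernel[OF assms(1), of a]]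
  have "set_integrable lborel {0<..<t} (\<lambda>u. gauss_kernel a u * gauss_kernel a (t - u))"
     "(LBINT u:{0<..<t}. gauss_kernel a u * gauss_kernel a (t - u)) = exp (- (a\<^sup>2 * t / 2)) / 2"
    by (rule A; auto simp: gauss_kernel_nonneg set_borel_measurable_def)+
  note A = this
  have "set_integrable lborel {0<..<t} (\<lambda>u. gauss_kernel a (t - u))"
     "(LBINT u:{0<..<t}. gauss_kernel a (t - u)) = kernel_primitive a t"
    by (rule B; use assms in \<open>auto simp: gauss_kernel_nonneg kernel_primitive_nonneg set_borel_measurable_def\<close>)+
  note B = this
  have "set_integrable lborel {0<..<t} (\<lambda>u. kernel_primitive a u * gauss_kernel a (t - u))"
     "(LBINT u:{0<..<t}. kernel_primitive a u * gauss_kernel a (t - u)) = convolution_primitive a t"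
    by (rule C; use assms in \<open>auto simp: gauss_kernel_nonneg kernel_primitive_nonneg convolution_primitive_nonneg set_borel_measurable_def\<close>)+
  note C = this
  have h: "h u * gauss_kernel a (t - u) = gauss_kernel a u * gauss_kernel a (t - u) + (a / 2 * gauss_kernel a (t - u) + a\<^sup>2 / 2 * (kernel_primitive a u * gauss_kernel a (t - u)))" for u
    unfolding h_def kernel_primitive_Phi[symmetric] by (simp add: algebra_simps power2_eq_square)
  show ?A unfolding h
    by (intro set_integral_add set_integrable_mult_right A B C)
  have "(LBINT u:{0<..<t}. h u * gauss_kernel a (t - u)) = exp (- (a\<^sup>2 * t / 2)) / 2 + (a / 2 * kernel_primitive a t + a\<^sup>2 / 2 * convolution_primitive a t)"
    unfolding h
    by (simp add: set_integral_add(2) set_integral_add(1) set_integrable_mult_right A B C)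
  also have "\<dots> = 1 / 2 + a / 2 * kernel_primitive a t"
    by (simp add: convolution_primitive_def field_simps)
  also have "\<dots> = Phi (a * sqrt t)" by (rule kernel_primitive_Phi)
  finally show ?B by (simp add: h_def)
qed

section \<open>A maximal inequality for sums of martingale differences\<close>

text \<open>
  The coefficients \<open>A j\<close> may have no moments, so the Doob--Kolmogorov argument is applied after truncation. Stop the sum as
  soon as the accumulated variance would exceed \<open>\<delta>\<close> or a partial sum has exceeded \<open>\<epsilon>\<close>. The
  stopped sum \<open>S'\<close> has bounded coefficients and second moment at most \<open>\<delta>\<close>. If the total variance stays
  below \<open>\<delta>\<close>, then \<open>S'\<close> is frozen at the first partial sum beyond \<open>\<epsilon>\<close>, so that Chebyshev's
  inequality for the terminal value \<open>S' m\<close> bounds the maximum of all partial sums.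
\<close>

lemma (in prob_space) discrete_lenglart:
  fixes Fs :: "nat \<Rightarrow> 'a measure" and A g :: "nat \<Rightarrow> 'a \<Rightarrow> real" and v :: "nat \<Rightarrow> real"
  assumes sub: "\<And>j. j \<le> m \<Longrightarrow> subalgebra M (Fs j)"
    and mono: "\<And>i j. i \<le> j \<Longrightarrow> j \<le> m \<Longrightarrow> sets (Fs i) \<subseteq> sets (Fs j)"
    and A: "\<And>j. j < m \<Longrightarrow> A j \<in> borel_measurable (Fs j)"
    and g: "\<And>j. j < m \<Longrightarrow> g j \<in> borel_measurable (Fs (Suc j))"
    and ind: "\<And>j Y. j < m \<Longrightarrow> Y \<in> borel_measurable (Fs j) \<Longrightarrow> indep_var borel Y borel (g j)"
    and int: "\<And>j. j < m \<Longrightarrow> integrable M (\<lambda>\<omega>. (g j \<omega>)\<^sup>2)"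
    and mean: "\<And>j. j < m \<Longrightarrow> expectation (g j) = 0"
    and var: "\<And>j. j < m \<Longrightarrow> expectation (\<lambda>\<omega>. (g j \<omega>)\<^sup>2) \<le> v j"
    and v: "\<And>j. j < m \<Longrightarrow> 0 < v j"
    and "0 < \<epsilon>" "0 \<le> \<delta>"
  shows "prob {\<omega>\<in>space M. \<exists>k\<le>m. \<bar>\<Sum>j<k. A j \<omega> * g j \<omega>\<bar> > \<epsilon>}
    \<le> prob {\<omega>\<in>space M. (\<Sum>j<m. (A j \<omega>)\<^sup>2 * v j) > \<delta>} + \<delta> / \<epsilon>\<^sup>2"
proof -
  define S where "S k \<omega> = (\<Sum>j<k. A j \<omega> * g j \<omega>)" for k \<omega>
  define good where "good j \<omega> \<longleftrightarrow> (\<Sum>i<Suc j. (A i \<omega>)\<^sup>2 * v i) \<le> \<delta> \<and> (\<forall>k\<le>j. \<bar>S k \<omega>\<bar> \<le> \<epsilon>)" for j \<omega>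
  define A' where "A' j \<omega> = (if good j \<omega> then A j \<omega> else 0)" for j \<omega>
  define S' where "S' k \<omega> = (\<Sum>j<k. A' j \<omega> * g j \<omega>)" for k \<omega>
  have lift: "f \<in> borel_measurable (Fs j)" if "f \<in> borel_measurable (Fs i)" "i \<le> j" "j \<le> m"
    for f :: "'a \<Rightarrow> real" and i j
    using that mono[of i j] sub[of i] sub[of j]
    by (intro borel_measurable_subalgebra[OF _ _ that(1)]) (auto simp: subalgebra_def)
  have liftM: "f \<in> borel_measurable M" if "f \<in> borel_measurable (Fs i)" "i \<le> m"
    for f :: "'a \<Rightarrow> real" and i
    using that sub[of i] by (intro borel_measurable_subalgebra[OF _ _ that(1)]) (auto simp: subalgebra_def)
  have S_meas: "S k \<in> borel_measurable (Fs j)" if "k \<le> j" "j \<le> m" for k j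
    unfolding S_def using that
    by (intro borel_measurable_sum borel_measurable_times lift[OF A] lift[OF g]) auto
  have good_meas: "{\<omega>\<in>space (Fs j). good j \<omega>} \<in> sets (Fs j)" if "j < m" for j
  proof -
    have [measurable]: "A i \<in> borel_measurable (Fs j)" if "i < Suc j" for i
      using that \<open>j < m\<close> by (intro lift[OF A]) auto
    have 1: "(\<lambda>\<omega>. \<Sum>i<Suc j. (A i \<omega>)\<^sup>2 * v i) \<in> borel_measurable (Fs j)"
      by (intro borel_measurable_sum) measurable
    have 2: "(\<lambda>\<omega>. \<bar>S k \<omega>\<bar>) \<in> borel_measurable (Fs j)" if "k \<le> j" for k
      using that \<open>j < m\<close> by (intro borel_measurable_abs S_meas) auto
    have "{\<omega>\<in>space (Fs j). good j \<omega>} = {\<omega>\<in>space (Fs j). (\<Sum>i<Suc j. (A i \<omega>)\<^sup>2 * v i) \<le> \<delta>} \<inter>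
       {\<omega>\<in>space (Fs j). \<forall>k\<in>{..j}. \<bar>S k \<omega>\<bar> \<le> \<epsilon>}"
      by (auto simp: good_def)
    also have "\<dots> \<in> sets (Fs j)"
      using 1 2 by (intro sets.Int sets.sets_Collect_finite_All) (auto simp del: sum.lessThan_Suc)
    finally show ?thesis .
  qed
  have A'_meas: "A' j \<in> borel_measurable (Fs j)" if "j < m" for j
    unfolding A'_def using A[OF that] good_meas[OF that]
    by (intro measurable_If) auto
  have S'_meas: "S' k \<in> borel_measurable (Fs j)" if "k \<le> j" "j \<le> m" for k j
    unfolding S'_def using that
    by (intro borel_measurable_sum borel_measurable_times lift[OF A'_meas] lift[OF g]) auto
  have good_antimono: "good i \<omega>" if "good j \<omega>" "i \<le> j" "j < m" for i j \<omega>
  proof -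
    have "(\<Sum>k<Suc i. (A k \<omega>)\<^sup>2 * v k) \<le> (\<Sum>k<Suc j. (A k \<omega>)\<^sup>2 * v k)"
      using that v by (intro sum_mono2) (auto simp: less_imp_le)
    with that show ?thesis unfolding good_def by auto
  qed
  have A'_sum: "(\<Sum>j<k. (A' j \<omega>)\<^sup>2 * v j) \<le> \<delta>" if "k \<le> m" for k \<omega>
    using that
  proof (induction k)
    case 0 then show ?case using \<open>0 \<le> \<delta>\<close> by simp
  next
    case (Suc k)
    show ?case
    proof (cases "good k \<omega>")
      case True
      then have "(\<Sum>j<Suc k. (A' j \<omega>)\<^sup>2 * v j) = (\<Sum>j<Suc k. (A j \<omega>)\<^sup>2 * v j)"
        using good_antimono[OF True] Suc.prems by (intro sum.cong) (auto simp: A'_def)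
      with True show ?thesis by (simp add: good_def)
    next
      case False with Suc show ?thesis by (simp add: A'_def)
    qed
  qed
  have A'_bound: "(A' j \<omega>)\<^sup>2 \<le> \<delta> / v j" if "j < m" for j \<omega>
  proof -
    have "(A' j \<omega>)\<^sup>2 * v j \<le> (\<Sum>j<Suc j. (A' j \<omega>)\<^sup>2 * v j)"
      using that v by (auto intro!: sum_nonneg simp: less_imp_le)
    also have "\<dots> \<le> \<delta>" using A'_sum[of "Suc j"] that by simp
    finally show ?thesis using v[OF that] by (simp add: field_simps)
  qed
  have A'_int: "integrable M (\<lambda>\<omega>. (A' j \<omega>)\<^sup>2)" if "j < m" for j
    using liftM[OF A'_meas[OF that]] that A'_bound[OF that]
    by (intro integrable_const_bound[where B="\<delta> / v j"]) auto
  have mono_int: "integrable M (\<lambda>\<omega>. X \<omega> * Y \<omega>)"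
    if "integrable M (\<lambda>\<omega>. (X \<omega>)\<^sup>2)" "integrable M (\<lambda>\<omega>. (Y \<omega>)\<^sup>2)" 
      "X \<in> borel_measurable M" "Y \<in> borel_measurable M" for X Y :: "'a \<Rightarrow> real"
  proof (rule Bochner_Integration.integrable_bound)
    show "integrable M (\<lambda>\<omega>. (X \<omega>)\<^sup>2 + (Y \<omega>)\<^sup>2)" using that by simp
    have "\<bar>x * y\<bar> \<le> x\<^sup>2 + y\<^sup>2" for x y :: real
    proof -
      have "0 \<le> (\<bar>x\<bar> - \<bar>y\<bar>)\<^sup>2" "0 \<le> \<bar>x\<bar> * \<bar>y\<bar>" by auto
      then show ?thesis unfolding abs_mult power2_diff power2_abs by linarith
    qed
    then show "AE x in M. norm (X x * Y x) \<le> norm ((X x)\<^sup>2 + (Y x)\<^sup>2)" by simp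
  qed (use that in auto)
  have main: "integrable M (\<lambda>\<omega>. (S' k \<omega>)\<^sup>2) \<and>
      expectation (\<lambda>\<omega>. (S' k \<omega>)\<^sup>2) \<le> (\<Sum>j<k. expectation (\<lambda>\<omega>. (A' j \<omega>)\<^sup>2) * v j)" if "k \<le> m" for k
    using that
  proof (induction k)
    case 0 then show ?case by (simp add: S'_def)
  next
    case (Suc k)
    then have k: "k < m" and IH1: "integrable M (\<lambda>\<omega>. (S' k \<omega>)\<^sup>2)"
      and IH2: "expectation (\<lambda>\<omega>. (S' k \<omega>)\<^sup>2) \<le> (\<Sum>j<k. expectation (\<lambda>\<omega>. (A' j \<omega>)\<^sup>2) * v j)" by auto
    have [measurable]: "A' k \<in> borel_measurable M" "g k \<in> borel_measurable M" "S' k \<in> borel_measurable M"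
      by (rule liftM[OF A'_meas[OF k]] liftM[OF g[OF k]] liftM[OF S'_meas[of k k]]; use k in simp)+
    have g_int: "integrable M (g k)"
      using int[OF k] by (rule square_integrable_imp_integrable[rotated]) simp
    have i1: "indep_var borel (\<lambda>\<omega>. (A' k \<omega>)\<^sup>2) borel (\<lambda>\<omega>. (g k \<omega>)\<^sup>2)"
      using indep_var_compose[OF ind[OF k A'_meas[OF k]], of "\<lambda>x. x\<^sup>2" borel "\<lambda>x. x\<^sup>2" borel]
      by (simp add: comp_def)
    have i2: "indep_var borel (\<lambda>\<omega>. S' k \<omega> * A' k \<omega>) borel (g k)"
      by (intro ind[OF k] borel_measurable_times S'_meas A'_meas) (use k in auto)
    have SA: "integrable M (\<lambda>\<omega>. S' k \<omega> * A' k \<omega>)"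
      using mono_int[OF IH1 A'_int[OF k]] by simp
    note J1 = indep_var_integrable[OF i1 A'_int[OF k] int[OF k]]
      indep_var_lebesgue_integral[OF i1 A'_int[OF k] int[OF k]]
    note J2 = indep_var_integrable[OF i2 SA g_int] indep_var_lebesgue_integral[OF i2 SA g_int]
    have e: "(S' (Suc k) \<omega>)\<^sup>2 = (S' k \<omega>)\<^sup>2 + 2 * (S' k \<omega> * A' k \<omega> * g k \<omega>) + (A' k \<omega>)\<^sup>2 * (g k \<omega>)\<^sup>2" for \<omega>
      by (simp add: S'_def power2_sum power_mult_distrib)
    have "expectation (\<lambda>\<omega>. (S' (Suc k) \<omega>)\<^sup>2) = expectation (\<lambda>\<omega>. (S' k \<omega>)\<^sup>2)
       + expectation (\<lambda>\<omega>. (A' k \<omega>)\<^sup>2) * expectation (\<lambda>\<omega>. (g k \<omega>)\<^sup>2)"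
      unfolding e using J1 J2 IH1 mean[OF k] by simp
    also have "\<dots> \<le> (\<Sum>j<Suc k. expectation (\<lambda>\<omega>. (A' j \<omega>)\<^sup>2) * v j)"
      using IH2 var[OF k] by (simp add: add_mono mult_left_mono)
    finally show ?case unfolding e using J1 J2 IH1 by (auto simp: e)
  qed
  have "expectation (\<lambda>\<omega>. (S' m \<omega>)\<^sup>2) \<le> (\<Sum>j<m. expectation (\<lambda>\<omega>. (A' j \<omega>)\<^sup>2) * v j)"
    using main[of m] by simp
  also have "\<dots> = expectation (\<lambda>\<omega>. \<Sum>j<m. (A' j \<omega>)\<^sup>2 * v j)"
    by (subst Bochner_Integration.integral_sum) (auto simp: A'_int)
  also have "\<dots> \<le> \<delta>"
    using A'_sum[of m] by (intro integral_le_const) (auto simp: A'_int)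
  finally have second: "expectation (\<lambda>\<omega>. (S' m \<omega>)\<^sup>2) \<le> \<delta>" .
  have [measurable]: "S' m \<in> borel_measurable M" "\<And>k. k \<le> m \<Longrightarrow> S k \<in> borel_measurable M"
      "\<And>j. j < m \<Longrightarrow> A j \<in> borel_measurable M"
    by (auto intro: liftM[OF S'_meas[of m m]] liftM[OF S_meas] liftM[OF A])
  have "{\<omega>\<in>space M. \<exists>k\<le>m. \<bar>S k \<omega>\<bar> > \<epsilon>} \<subseteq>
     {\<omega>\<in>space M. (\<Sum>j<m. (A j \<omega>)\<^sup>2 * v j) > \<delta>} \<union> {\<omega>\<in>space M. \<bar>S' m \<omega>\<bar> \<ge> \<epsilon>}"
  proof (safe, rule ccontr)
    fix \<omega> k assume k: "k \<le> m" "\<epsilon> < \<bar>S k \<omega>\<bar>"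
      and small: "\<not> \<delta> < (\<Sum>j<m. (A j \<omega>)\<^sup>2 * v j)" and n: "\<not> \<bar>S' m \<omega>\<bar> \<ge> \<epsilon>"
    define l where "l = (LEAST k. \<epsilon> < \<bar>S k \<omega>\<bar>)"
    have l: "\<epsilon> < \<bar>S l \<omega>\<bar>" "l \<le> k" "\<And>i. i < l \<Longrightarrow> \<bar>S i \<omega>\<bar> \<le> \<epsilon>"
      unfolding l_def using k LeastI[of "\<lambda>k. \<epsilon> < \<bar>S k \<omega>\<bar>" k]
      by (auto intro: Least_le dest: not_less_Least)
    have g1: "good j \<omega>" if "j < l" for j
    proof -
      have "(\<Sum>k<Suc j. (A k \<omega>)\<^sup>2 * v k) \<le> (\<Sum>k<m. (A k \<omega>)\<^sup>2 * v k)"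
        using that v l k by (intro sum_mono2) (auto simp: less_imp_le)
      then show ?thesis using that l small unfolding good_def by auto
    qed
    have g2: "\<not> good j \<omega>" if "l \<le> j" for j
      using that l(1) unfolding good_def by force
    have "S' m \<omega> = (\<Sum>j\<in>{..<l}. A' j \<omega> * g j \<omega>)"
      unfolding S'_def using l k g2 by (intro sum.mono_neutral_right) (auto simp: A'_def)
    also have "\<dots> = S l \<omega>"
      unfolding S_def using g1 by (intro sum.cong) (auto simp: A'_def)
    finally show False using l n by simp
  qed
  then have "prob {\<omega>\<in>space M. \<exists>k\<le>m. \<bar>S k \<omega>\<bar> > \<epsilon>} \<le>
     prob ({\<omega>\<in>space M. (\<Sum>j<m. (A j \<omega>)\<^sup>2 * v j) > \<delta>} \<union> {\<omega>\<in>space M. \<bar>S' m \<omega>\<bar> \<ge> \<epsilon>})"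
    by (intro finite_measure_mono) auto
  also have "\<dots> \<le> prob {\<omega>\<in>space M. (\<Sum>j<m. (A j \<omega>)\<^sup>2 * v j) > \<delta>} + prob {\<omega>\<in>space M. \<bar>S' m \<omega>\<bar> \<ge> \<epsilon>}"
    by (intro measure_Un_le) auto
  also have "prob {\<omega>\<in>space M. \<bar>S' m \<omega>\<bar> \<ge> \<epsilon>} \<le> expectation (\<lambda>\<omega>. (S' m \<omega>)\<^sup>2) / \<epsilon>\<^sup>2"
    using main[of m] \<open>0 < \<epsilon>\<close> by (intro second_moment_method) auto
  also have "\<dots> \<le> \<delta> / \<epsilon>\<^sup>2"
    using second by (intro divide_right_mono) auto
  finally show ?thesis by (simp add: S_def)
qed

section \<open>Convergence in probability\<close>

abbreviation (input) null_in_prob :: "'a measure \<Rightarrow> (nat \<Rightarrow> 'a \<Rightarrow> real) \<Rightarrow> bool" where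
  "null_in_prob M Y \<equiv> tendsto_in_probability M Y (\<lambda>_. 0)"

context prob_space
begin

lemma null_in_probI:
  assumes "\<And>\<epsilon> \<eta>. \<epsilon> > 0 \<Longrightarrow> \<eta> > 0 \<Longrightarrow> \<forall>\<^sub>F n in sequentially. prob {\<omega>\<in>space M. \<bar>Y n \<omega>\<bar> > \<epsilon>} \<le> \<eta>"
  shows "null_in_prob M Y"
  unfolding tendsto_in_probability_def
proof (intro allI impI)
  fix \<epsilon> :: real assume "\<epsilon> > 0"
  show "(\<lambda>n. prob {\<omega> \<in> space M. \<bar>Y n \<omega> - 0\<bar> > \<epsilon>}) \<longlonglongrightarrow> 0"
  proof (rule tendstoI)
    fix e :: real assume "e > 0"
    from assms[OF \<open>\<epsilon> > 0\<close>, of "e/2"] this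
    show "\<forall>\<^sub>F n in sequentially. dist (prob {\<omega> \<in> space M. \<bar>Y n \<omega> - 0\<bar> > \<epsilon>}) 0 < e"
      by (auto elim!: eventually_mono)
  qed
qed

lemma null_in_probD:
  assumes "null_in_prob M Y" "\<epsilon> > 0" "\<eta> > 0"
  shows "\<forall>\<^sub>F n in sequentially. prob {\<omega>\<in>space M. \<bar>Y n \<omega>\<bar> > \<epsilon>} < \<eta>"
  using tendstoD[of "\<lambda>n. prob {\<omega>\<in>space M. \<bar>Y n \<omega>\<bar> > \<epsilon>}" 0 sequentially \<eta>] assms
  by (auto simp: tendsto_in_probability_def)

lemma null_in_prob_dominated:
  assumes "null_in_prob M Y" "\<And>n. Y n \<in> borel_measurable M"
    and "\<forall>\<^sub>F n in sequentially. \<forall>\<omega>\<in>space M. \<bar>X n \<omega>\<bar> \<le> \<bar>Y n \<omega>\<bar>"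
  shows "null_in_prob M X"
proof (rule null_in_probI)
  fix \<epsilon> \<eta> :: real assume "\<epsilon> > 0" "\<eta> > 0"
  from null_in_probD[OF assms(1) this] assms(3)
  show "\<forall>\<^sub>F n in sequentially. prob {\<omega>\<in>space M. \<bar>X n \<omega>\<bar> > \<epsilon>} \<le> \<eta>"
  proof eventually_elim
    case (elim n)
    have [measurable]: "Y n \<in> borel_measurable M" by fact
    have "prob {\<omega>\<in>space M. \<bar>X n \<omega>\<bar> > \<epsilon>} \<le> prob {\<omega>\<in>space M. \<bar>Y n \<omega>\<bar> > \<epsilon>}"
      using elim by (intro finite_measure_mono) force+
    with elim show ?case by simp
  qed
qed

lemma null_in_prob_add:
  assumes "null_in_prob M X" "null_in_prob M Y"
    and [measurable]: "\<And>n. X n \<in> borel_measurable M" "\<And>n. Y n \<in> borel_measurable M"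
  shows "null_in_prob M (\<lambda>n \<omega>. X n \<omega> + Y n \<omega>)"
proof (rule null_in_probI)
  fix \<epsilon> \<eta> :: real assume "\<epsilon> > 0" "\<eta> > 0"
  then have "\<epsilon>/2 > 0" "\<eta>/2 > 0" by auto
  from null_in_probD[OF assms(1) this] null_in_probD[OF assms(2) this]
  show "\<forall>\<^sub>F n in sequentially. prob {\<omega>\<in>space M. \<bar>X n \<omega> + Y n \<omega>\<bar> > \<epsilon>} \<le> \<eta>"
  proof eventually_elim
    case (elim n)
    have "prob {\<omega>\<in>space M. \<bar>X n \<omega> + Y n \<omega>\<bar> > \<epsilon>} \<le>
      prob ({\<omega>\<in>space M. \<bar>X n \<omega>\<bar> > \<epsilon>/2} \<union> {\<omega>\<in>space M. \<bar>Y n \<omega>\<bar> > \<epsilon>/2})"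
      by (intro finite_measure_mono) auto
    also have "\<dots> \<le> prob {\<omega>\<in>space M. \<bar>X n \<omega>\<bar> > \<epsilon>/2} + prob {\<omega>\<in>space M. \<bar>Y n \<omega>\<bar> > \<epsilon>/2}"
      by (intro measure_Un_le) auto
    finally show ?case using elim by simp
  qed
qed

lemma tight_real:
  fixes B :: "'a \<Rightarrow> real"
  assumes [measurable]: "B \<in> borel_measurable M" and "\<eta> > 0"
  obtains K where "K > 0" "prob {\<omega>\<in>space M. \<bar>B \<omega>\<bar> > K} < \<eta>"
proof -
  have "(\<lambda>n::nat. prob {\<omega>\<in>space M. \<bar>B \<omega>\<bar> > real n}) \<longlonglongrightarrow> prob (\<Inter>n::nat. {\<omega>\<in>space M. \<bar>B \<omega>\<bar> > real n})"
    by (intro finite_Lim_measure_decseq) (auto simp: decseq_def)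
  also have "(\<Inter>n::nat. {\<omega>\<in>space M. \<bar>B \<omega>\<bar> > real n}) = {}"
  proof -
    have "\<exists>n::nat. \<not> \<bar>B \<omega>\<bar> > real n" for \<omega>
      using reals_Archimedean2[of "\<bar>B \<omega>\<bar>"] by (auto simp: not_less intro: less_imp_le)
    then show ?thesis by blast
  qed
  finally have "(\<lambda>n::nat. prob {\<omega>\<in>space M. \<bar>B \<omega>\<bar> > real n}) \<longlonglongrightarrow> 0" by simp
  from order_tendstoD(2)[OF this \<open>\<eta> > 0\<close>] obtain N where
    N: "\<And>n. n \<ge> N \<Longrightarrow> prob {\<omega>\<in>space M. \<bar>B \<omega>\<bar> > real n} < \<eta>"
    by (auto simp: eventually_sequentially)
  show ?thesis using N[of "Suc N"] by (intro that[of "real (Suc N)"]) auto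
qed

text \<open>
  A sequence that is bounded along every path is dominated by one random variable, its pathwise supremum,
  and a single random variable is tight.
\<close>

lemma null_in_prob_mult_bounded:
  assumes "null_in_prob M Y"
    and [measurable]: "\<And>n. Y n \<in> borel_measurable M" "\<And>n. B n \<in> borel_measurable M"
    and bdd: "\<And>\<omega>. \<omega> \<in> space M \<Longrightarrow> Bseq (\<lambda>n. B n \<omega>)"
  shows "null_in_prob M (\<lambda>n \<omega>. B n \<omega> * Y n \<omega>)"
proof (rule null_in_probI)
  fix \<epsilon> \<eta> :: real assume e: "\<epsilon> > 0" "\<eta> > 0"
  define C where "C \<omega> = (SUP n. \<bar>B n \<omega>\<bar>)" for \<omega>
  have bd: "bdd_above (range (\<lambda>n. \<bar>B n \<omega>\<bar>))" if "\<omega> \<in> space M" for \<omega>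
    using bdd[OF that] unfolding Bseq_def bdd_above_def by auto
  have [measurable]: "C \<in> borel_measurable M"
    unfolding C_def using bd by (intro borel_measurable_cSUP) auto
  obtain K where K: "K > 0" "prob {\<omega>\<in>space M. \<bar>C \<omega>\<bar> > K} < \<eta> / 2"
    using tight_real[of C "\<eta>/2"] e by auto
  have "\<epsilon> / K > 0" "\<eta>/2 > 0" using e K by auto
  from null_in_probD[OF assms(1) this]
  show "\<forall>\<^sub>F n in sequentially. prob {\<omega>\<in>space M. \<bar>B n \<omega> * Y n \<omega>\<bar> > \<epsilon>} \<le> \<eta>"
  proof eventually_elim
    case (elim n)
    have "{\<omega>\<in>space M. \<bar>B n \<omega> * Y n \<omega>\<bar> > \<epsilon>} \<subseteq>
      {\<omega>\<in>space M. \<bar>C \<omega>\<bar> > K} \<union> {\<omega>\<in>space M. \<bar>Y n \<omega>\<bar> > \<epsilon> / K}"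
    proof (safe, rule ccontr)
      fix \<omega> assume \<omega>: "\<omega> \<in> space M" "\<epsilon> < \<bar>B n \<omega> * Y n \<omega>\<bar>" "\<not> K < \<bar>C \<omega>\<bar>" "\<not> \<epsilon> / K < \<bar>Y n \<omega>\<bar>"
      have "\<bar>B n \<omega>\<bar> \<le> C \<omega>" unfolding C_def using bd[OF \<omega>(1)] by (intro cSUP_upper) auto
      then have "\<bar>B n \<omega>\<bar> \<le> K" using \<omega> by simp
      then have "\<bar>B n \<omega> * Y n \<omega>\<bar> \<le> K * (\<epsilon> / K)"
        unfolding abs_mult using \<omega> K by (intro mult_mono) auto
      then show False using \<omega> K by simp
    qed
    then have "prob {\<omega>\<in>space M. \<bar>B n \<omega> * Y n \<omega>\<bar> > \<epsilon>} \<le>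
      prob ({\<omega>\<in>space M. \<bar>C \<omega>\<bar> > K} \<union> {\<omega>\<in>space M. \<bar>Y n \<omega>\<bar> > \<epsilon>/K})"
      by (intro finite_measure_mono) auto
    also have "\<dots> \<le> prob {\<omega>\<in>space M. \<bar>C \<omega>\<bar> > K} + prob {\<omega>\<in>space M. \<bar>Y n \<omega>\<bar> > \<epsilon>/K}"
      by (intro measure_Un_le) auto
    finally show ?case using elim K by simp
  qed
qed

lemma null_in_prob_pointwise:
  assumes "\<And>\<omega>. \<omega> \<in> space M \<Longrightarrow> (\<lambda>n. Y n \<omega>) \<longlonglongrightarrow> 0"
    and [measurable]: "\<And>n. Y n \<in> borel_measurable M"
  shows "null_in_prob M Y"
  unfolding tendsto_in_probability_def
proof (intro allI impI)
  fix \<epsilon> :: real assume "\<epsilon> > 0"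
  have "(\<lambda>n. expectation (\<lambda>\<omega>. indicator {\<omega>\<in>space M. \<bar>Y n \<omega>\<bar> > \<epsilon>} \<omega>)) \<longlonglongrightarrow> expectation (\<lambda>\<omega>. 0::real)"
  proof (rule integral_dominated_convergence[where w="\<lambda>_. 1"])
    show "AE \<omega> in M. (\<lambda>n. indicator {\<omega>\<in>space M. \<bar>Y n \<omega>\<bar> > \<epsilon>} \<omega> :: real) \<longlonglongrightarrow> 0"
    proof (rule AE_I2)
      fix \<omega> assume "\<omega> \<in> space M"
      from tendstoD[OF assms(1)[OF this] \<open>\<epsilon> > 0\<close>]
      show "(\<lambda>n. indicator {\<omega>\<in>space M. \<bar>Y n \<omega>\<bar> > \<epsilon>} \<omega> :: real) \<longlonglongrightarrow> 0"
        by (intro tendsto_eventually) (auto elim!: eventually_mono)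
    qed
  qed (auto split: split_indicator)
  then show "(\<lambda>n. prob {\<omega> \<in> space M. \<bar>Y n \<omega> - 0\<bar> > \<epsilon>}) \<longlonglongrightarrow> 0"
    by simp
qed

lemma null_in_prob_const_AE:
  assumes "null_in_prob M (\<lambda>_. Y)" and [measurable]: "Y \<in> borel_measurable M"
  shows "AE \<omega> in M. Y \<omega> = 0"
proof -
  have "AE \<omega> in M. \<bar>Y \<omega>\<bar> \<le> 1 / real (Suc n)" for n
  proof -
    have "prob {\<omega>\<in>space M. \<bar>Y \<omega>\<bar> > 1 / real (Suc n)} = 0"
      using assms(1)[unfolded tendsto_in_probability_def, rule_format, of "1 / real (Suc n)"]
      by (simp add: LIMSEQ_const_iff)
    then have "emeasure M {\<omega>\<in>space M. \<bar>Y \<omega>\<bar> > 1 / real (Suc n)} = 0"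
      by (simp add: emeasure_eq_measure)
    then show ?thesis by (intro AE_I[where N="{\<omega>\<in>space M. \<bar>Y \<omega>\<bar> > 1 / real (Suc n)}"]) (auto simp: not_le)
  qed
  then have "AE \<omega> in M. \<forall>n. \<bar>Y \<omega>\<bar> \<le> 1 / real (Suc n)" by (simp add: AE_all_countable)
  then show ?thesis
  proof eventually_elim
    case (elim \<omega>)
    have "\<bar>Y \<omega>\<bar> \<le> 0"
      by (rule LIMSEQ_le_const[OF LIMSEQ_inverse_real_of_nat]) (use elim in \<open>auto simp: inverse_eq_divide\<close>)
    then show ?case by simp
  qed
qed

end

section \<open>Increments of Brownian motion and elementary stochastic integrals\<close>

lemma finite_set_enumeration:
  fixes S :: "real set"
  assumes "finite S" "S \<noteq> {}"
  obtains m and \<pi> :: "nat \<Rightarrow> real"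
  where "S = \<pi> ` {..m}" "\<forall>i j. i < j \<longrightarrow> j \<le> m \<longrightarrow> \<pi> i < \<pi> j"
proof -
  let ?L = "sorted_list_of_set S"
  have len: "length ?L = card S" "card S > 0" using assms by (auto simp: card_gt_0_iff)
  have "S = (!) ?L ` {..card S - 1}"
  proof -
    have "S = set ?L" using assms by simp
    also have "\<dots> = (!) ?L ` {..<card S}" unfolding set_conv_nth using len by auto
    also have "{..<card S} = {..card S - 1}" using len by auto
    finally show ?thesis .
  qed
  moreover have "?L ! i < ?L ! j" if "i < j" "j \<le> card S - 1" for i j
    using that len strict_sorted_list_of_set[of S] by (auto intro: sorted_wrt_nth_less)
  ultimately show ?thesis using that by blast
qed

text \<open>
  The part of the path below \<open>x\<close> telescopes because no point of the partition lies strictly between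
  two neighbours on different sides of \<open>x\<close>: \<open>x\<close> is itself a point of the partition, or beyond its end.
\<close>

lemma telescope_below:
  fixes \<pi> :: "nat \<Rightarrow> real" and f :: "real \<Rightarrow> real"
  assumes mono: "\<And>i j. i < j \<Longrightarrow> j \<le> m \<Longrightarrow> \<pi> i < \<pi> j" and "\<pi> 0 = 0" "0 \<le> x"
    and gap: "x \<in> \<pi> ` {..m} \<or> \<pi> m \<le> x" and "k \<le> m"
  shows "(\<Sum>j<k. if \<pi> j < x then f (\<pi> (Suc j)) - f (\<pi> j) else 0) = f (min (\<pi> k) x) - f 0"
  using \<open>k \<le> m\<close>
proof (induction k)
  case 0 then show ?case using assms by simp
next
  case (Suc k)
  have mono': "\<pi> i \<le> \<pi> j" if "i \<le> j" "j \<le> m" for i j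
    using mono[of i j] that by (cases "i = j") auto
  show ?case
  proof (cases "\<pi> k < x")
    case True
    have "\<pi> (Suc k) \<le> x"
    proof (cases "\<pi> m \<le> x")
      case True then show ?thesis using mono'[of "Suc k" m] Suc.prems by simp
    next
      case False
      then obtain i where i: "i \<le> m" "x = \<pi> i" using gap by auto
      have "\<not> i \<le> k" using True i mono'[of i k] Suc.prems by auto
      then show ?thesis using i mono'[of "Suc k" i] by simp
    qed
    with True Suc show ?thesis by (simp add: min_def)
  next
    case False
    with Suc mono[of k "Suc k"] show ?thesis by (simp add: min_def)
  qed
qed

locale brownian =
  fixes M :: "'a measure" and F :: "real \<Rightarrow> 'a measure" and W :: "real \<Rightarrow> 'a \<Rightarrow> real"
  assumes usual: "usual_conditions M F"
    and bm: "standard_brownian_motion M F W"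
begin

sublocale prob_space M
  using usual by (simp add: usual_conditions_def)

lemma subalgebra_F: "0 \<le> t \<Longrightarrow> subalgebra M (F t)"
  using usual by (simp add: usual_conditions_def)

lemma space_F: "0 \<le> t \<Longrightarrow> space (F t) = space M"
  using subalgebra_F by (simp add: subalgebra_def)

lemma sets_F: "0 \<le> t \<Longrightarrow> sets (F t) \<subseteq> sets M"
  using subalgebra_F by (simp add: subalgebra_def)

lemma sets_F_mono: "0 \<le> s \<Longrightarrow> s \<le> t \<Longrightarrow> sets (F s) \<subseteq> sets (F t)"
  using usual unfolding usual_conditions_def by blast

lemma measurable_F_mono: "f \<in> measurable (F s) N \<Longrightarrow> 0 \<le> s \<Longrightarrow> s \<le> t \<Longrightarrow> f \<in> measurable (F t) N"
  using sets_F_mono[of s t] space_F[of s] space_F[of t] by (auto simp: measurable_def)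

lemma measurable_F_M: "f \<in> measurable (F s) N \<Longrightarrow> 0 \<le> s \<Longrightarrow> f \<in> measurable M N"
  using sets_F[of s] space_F[of s] by (auto simp: measurable_def)

lemma adapted_F:
  assumes "continuous_adapted M F X" "0 \<le> s" "s \<le> t"
  shows "X s \<in> borel_measurable (F t)"
  using assms measurable_F_mono[of "X s" s borel t] by (auto simp: continuous_adapted_def)

lemma adapted_M:
  assumes "continuous_adapted M F X" "0 \<le> s"
  shows "X s \<in> borel_measurable M"
  using assms measurable_F_M[of "X s" s borel] by (auto simp: continuous_adapted_def)

lemma W_continuous_adapted: "continuous_adapted M F W"
  using bm by (simp add: standard_brownian_motion_def)

lemmas W_F = adapted_F[OF W_continuous_adapted]
lemmas W_M = adapted_M[OF W_continuous_adapted]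

lemma W_0: "AE \<omega> in M. W 0 \<omega> = 0"
  using bm by (simp add: standard_brownian_motion_def)

lemma W_increment_distributed:
  "0 \<le> s \<Longrightarrow> s < t \<Longrightarrow> distributed M lborel (\<lambda>\<omega>. W t \<omega> - W s \<omega>) (normal_density 0 (sqrt (t - s)))"
  using bm by (simp add: standard_brownian_motion_def)

lemma W_increment_indep:
  assumes "0 \<le> s" "s < t" "Y \<in> measurable (F s) N"
  shows "indep_var N Y borel (\<lambda>\<omega>. W t \<omega> - W s \<omega>)"
proof -
  let ?D = "\<lambda>\<omega>. W t \<omega> - W s \<omega>"
  have ind: "indep_set (sets (F s)) (sets (vimage_algebra (space M) ?D borel))"
    using bm assms by (simp add: standard_brownian_motion_def)
  have Y: "Y \<in> measurable M N" using assms measurable_F_M by blast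
  have D: "?D \<in> borel_measurable M" using W_M[of s] W_M[of t] assms by simp
  have "{Y -` A \<inter> space M |A. A \<in> sets N} \<subseteq> sets (F s)"
    using measurable_sets[OF assms(3)] space_F[of s] assms by auto
  then have "sigma_sets (space M) {Y -` A \<inter> space M |A. A \<in> sets N} \<subseteq> sets (F s)"
    using sets.sigma_sets_subset[of "{Y -` A \<inter> space M |A. A \<in> sets N}" "F s"] space_F[of s] assms by simp
  then show ?thesis
    unfolding indep_var_eq using ind Y D unfolding indep_sets2_eq sets_vimage_algebra
    by (meson subset_iff)
qed

lemma W_increment_moments:
  assumes "0 \<le> s" "s < t"
  shows "integrable M (\<lambda>\<omega>. (W t \<omega> - W s \<omega>)\<^sup>2)"
    and "expectation (\<lambda>\<omega>. W t \<omega> - W s \<omega>) = 0"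
    and "expectation (\<lambda>\<omega>. (W t \<omega> - W s \<omega>)\<^sup>2) = t - s"
proof -
  note D = W_increment_distributed[OF assms]
  have pos: "0 < sqrt (t - s)" using assms by simp
  have hb: "has_bochner_integral lborel (\<lambda>x. normal_density 0 (sqrt (t - s)) x * x ^ 2) (t - s)"
    using normal_moment_even[OF pos, of 0 1] assms by (simp add: diff_divide_distrib)
  show "integrable M (\<lambda>\<omega>. (W t \<omega> - W s \<omega>)\<^sup>2)"
    using distributed_integrable[OF D, of "\<lambda>x. x\<^sup>2"] hb by (auto simp: has_bochner_integral_iff)
  show "expectation (\<lambda>\<omega>. W t \<omega> - W s \<omega>) = 0"
    using normal_distributed_expectation[OF pos D] by simp
  show "expectation (\<lambda>\<omega>. (W t \<omega> - W s \<omega>)\<^sup>2) = t - s"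
    using distributed_integral[OF D, of "\<lambda>x. x\<^sup>2"] hb by (auto simp: has_bochner_integral_iff)
qed

text \<open>
  The intervals may overlap and the coefficients may be unbounded, so that this covers the difference of two simple
  processes with unrelated partitions. Refining all end points and the observation times \<open>Q\<close> to
  one partition \<open>\<pi>\<close> turns the integral into a sum of martingale differences, and its conditional
  variance into the time integral of the squared integrand.
\<close>

lemma elementary_lenglart:
  fixes I :: "'i set" and a b :: "'i \<Rightarrow> real" and \<xi> :: "'i \<Rightarrow> 'a \<Rightarrow> real"
  assumes "finite I" and ab: "\<And>i. i \<in> I \<Longrightarrow> 0 \<le> a i" "\<And>i. i \<in> I \<Longrightarrow> a i \<le> b i"
    and \<xi>: "\<And>i. i \<in> I \<Longrightarrow> \<xi> i \<in> borel_measurable (F (a i))"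
    and "0 < T" "finite Q" and Q: "Q \<subseteq> {0..T}" and "\<epsilon> > 0" "\<delta> \<ge> 0"
  shows "prob {\<omega>\<in>space M. \<exists>q\<in>Q. \<bar>\<Sum>i\<in>I. \<xi> i \<omega> * (W (min q (b i)) \<omega> - W (min q (a i)) \<omega>)\<bar> > \<epsilon>}
    \<le> prob {\<omega>\<in>space M. (LBINT s:{0..T}. (\<Sum>i\<in>I. \<xi> i \<omega> * indicator {a i<..b i} s)\<^sup>2) > \<delta>} + \<delta> / \<epsilon>\<^sup>2"
proof -
  define S where "S = {0, T} \<union> Q \<union> ((a ` I \<union> b ` I) \<inter> {0..T})"
  have S: "finite S" "S \<noteq> {}" "S \<subseteq> {0..T}" "0 \<in> S" "T \<in> S"
    using assms by (auto simp: S_def)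
  obtain m and \<pi> :: "nat \<Rightarrow> real" where \<pi>: "S = \<pi> ` {..m}" and mono0: "\<forall>i j. i < j \<longrightarrow> j \<le> m \<longrightarrow> \<pi> i < \<pi> j"
    using finite_set_enumeration[OF S(1,2)] by blast
  have mono: "\<pi> i < \<pi> j" if "i < j" "j \<le> m" for i j
    using mono0 that by blast
  have mono': "\<pi> i \<le> \<pi> j" if "i \<le> j" "j \<le> m" for i j
    using mono[of i j] that by (cases "i = j") auto
  have range: "0 \<le> \<pi> j" "\<pi> j \<le> T" if "j \<le> m" for j using S(3) \<pi> that by auto
  have \<pi>0: "\<pi> 0 = 0"
  proof -
    obtain i where "i \<le> m" "\<pi> i = 0" using S(4) \<pi> by auto
    then show ?thesis using mono'[of 0 i] range[of 0] by simp
  qed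
  have \<pi>m: "\<pi> m = T"
  proof -
    obtain i where "i \<le> m" "\<pi> i = T" using S(5) \<pi> by auto
    then show ?thesis using mono'[of i m] range[of m] by simp
  qed
  have gap: "x \<in> \<pi> ` {..m} \<or> \<pi> m \<le> x" if "x \<in> a ` I \<union> b ` I" for x
  proof -
    have "0 \<le> x" using that ab by force
    with that show ?thesis unfolding \<pi>m \<pi>[symmetric] S_def by auto
  qed
  have sep: "x \<le> \<pi> j \<or> \<pi> (Suc j) \<le> x" if "x \<in> a ` I \<union> b ` I" "j < m" for x j
  proof (cases "\<pi> m \<le> x")
    case True then show ?thesis using mono'[of "Suc j" m] that by auto
  next
    case False
    then have "x \<in> \<pi> ` {..m}" using gap[OF that(1)] by simp
    then obtain i where "i \<le> m" "x = \<pi> i" by auto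
    then show ?thesis using mono'[of i j] mono'[of "Suc j" i] that by (cases "i \<le> j") auto
  qed
  \<comment> \<open>\<open>c j\<close> is the value of the integrand on the \<open>j\<close>-th interval of the refined partition.\<close>
  define c where "c j \<omega> = (\<Sum>i\<in>I. if a i \<le> \<pi> j \<and> \<pi> j < b i then \<xi> i \<omega> else 0)" for j \<omega>
  define g where "g j \<omega> = W (\<pi> (Suc j)) \<omega> - W (\<pi> j) \<omega>" for j \<omega>
  have c_meas: "c j \<in> borel_measurable (F (\<pi> j))" if "j \<le> m" for j
    unfolding c_def
  proof (intro borel_measurable_sum)
    fix i assume "i \<in> I"
    then show "(\<lambda>\<omega>. if a i \<le> \<pi> j \<and> \<pi> j < b i then \<xi> i \<omega> else 0) \<in> borel_measurable (F (\<pi> j))"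
      using measurable_F_mono[OF \<xi>, of i "\<pi> j"] ab range[OF that]
      by (cases "a i \<le> \<pi> j"; cases "\<pi> j < b i") simp_all
  qed
  have lhs: "(\<Sum>i\<in>I. \<xi> i \<omega> * (W (min (\<pi> k) (b i)) \<omega> - W (min (\<pi> k) (a i)) \<omega>)) = (\<Sum>j<k. c j \<omega> * g j \<omega>)"
    if "k \<le> m" for k \<omega>
  proof -
    have "(\<Sum>i\<in>I. \<xi> i \<omega> * (W (min (\<pi> k) (b i)) \<omega> - W (min (\<pi> k) (a i)) \<omega>)) =
       (\<Sum>i\<in>I. \<Sum>j<k. (if a i \<le> \<pi> j \<and> \<pi> j < b i then \<xi> i \<omega> else 0) * g j \<omega>)"
    proof (rule sum.cong[OF refl])
      fix i assume i: "i \<in> I"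
      have tel: "(\<Sum>j<k. if \<pi> j < x then W (\<pi> (Suc j)) \<omega> - W (\<pi> j) \<omega> else 0) = W (min (\<pi> k) x) \<omega> - W 0 \<omega>"
        if "x = a i \<or> x = b i" for x
        using that i gap[of x] ab[OF i] \<open>k \<le> m\<close>
        by (intro telescope_below[where m=m and \<pi>=\<pi> and f="\<lambda>t. W t \<omega>"] mono \<pi>0) auto
      have "\<xi> i \<omega> * (W (min (\<pi> k) (b i)) \<omega> - W (min (\<pi> k) (a i)) \<omega>) =
        \<xi> i \<omega> * (\<Sum>j<k. (if \<pi> j < b i then W (\<pi> (Suc j)) \<omega> - W (\<pi> j) \<omega> else 0) -
               (if \<pi> j < a i then W (\<pi> (Suc j)) \<omega> - W (\<pi> j) \<omega> else 0))"
        unfolding sum_subtractf using tel[of "a i"] tel[of "b i"] by simp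
      also have "\<dots> = (\<Sum>j<k. (if a i \<le> \<pi> j \<and> \<pi> j < b i then \<xi> i \<omega> else 0) * g j \<omega>)"
        unfolding sum_distrib_left using ab(2)[OF i] by (intro sum.cong) (auto simp: g_def)
      finally show "\<xi> i \<omega> * (W (min (\<pi> k) (b i)) \<omega> - W (min (\<pi> k) (a i)) \<omega>) =
        (\<Sum>j<k. (if a i \<le> \<pi> j \<and> \<pi> j < b i then \<xi> i \<omega> else 0) * g j \<omega>)" .
    qed
    also have "\<dots> = (\<Sum>j<k. c j \<omega> * g j \<omega>)"
      unfolding c_def sum_distrib_right by (rule sum.swap)
    finally show ?thesis .
  qed
  have rhs: "(LBINT s:{0..T}. (\<Sum>i\<in>I. \<xi> i \<omega> * indicator {a i<..b i} s)\<^sup>2) =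
     (\<Sum>j<m. (c j \<omega>)\<^sup>2 * (\<pi> (Suc j) - \<pi> j))" for \<omega>
  proof -
    have "indicator {0..T} s * (\<Sum>i\<in>I. \<xi> i \<omega> * indicator {a i<..b i} s)\<^sup>2 =
       (\<Sum>j<m. (c j \<omega>)\<^sup>2 * indicator {\<pi> j<..\<pi> (Suc j)} s)" for s
    proof (cases "0 < s \<and> s \<le> T")
      case False
      have "(\<Sum>j<m. (c j \<omega>)\<^sup>2 * indicator {\<pi> j<..\<pi> (Suc j)} s) = 0"
      proof (intro sum.neutral ballI)
        fix j assume "j \<in> {..<m}"
        then show "(c j \<omega>)\<^sup>2 * indicator {\<pi> j<..\<pi> (Suc j)} s = 0"
          using False range[of j] range[of "Suc j"] by (auto simp: indicator_def)
      qed
      moreover have "(\<Sum>i\<in>I. \<xi> i \<omega> * indicator {a i<..b i} s) = 0" if "s = 0"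
        using that ab by (intro sum.neutral) (force simp: indicator_def)
      ultimately show ?thesis using False by (auto simp: indicator_def)
    next
      case True
      define k where "k = (LEAST k. s \<le> \<pi> k)"
      have k: "s \<le> \<pi> k" "k \<le> m" "\<And>i. i < k \<Longrightarrow> \<pi> i < s"
        unfolding k_def using True \<pi>m LeastI[of "\<lambda>k. s \<le> \<pi> k" m]
        by (auto intro: Least_le dest: not_less_Least)
      have "k \<noteq> 0" using k(1) True \<pi>0 by (intro notI) simp
      then obtain j where j: "k = Suc j" using not0_implies_Suc by blast
      have js: "\<pi> j < s" "s \<le> \<pi> (Suc j)" "j < m" using k j by auto
      have ind: "indicator {a i<..b i} s = (if a i \<le> \<pi> j \<and> \<pi> j < b i then 1 else 0::real)" if "i \<in> I" for i
        using sep[of "a i" j] sep[of "b i" j] js that by (auto simp: indicator_def)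
      have "(\<Sum>i\<in>I. \<xi> i \<omega> * indicator {a i<..b i} s) = c j \<omega>"
        unfolding c_def by (intro sum.cong) (auto simp: ind)
      moreover have "(\<Sum>l<m. (c l \<omega>)\<^sup>2 * indicator {\<pi> l<..\<pi> (Suc l)} s) = (\<Sum>l<m. if l = j then (c j \<omega>)\<^sup>2 else 0)"
      proof (intro sum.cong refl)
        fix l assume l: "l \<in> {..<m}"
        consider "l < j" | "l = j" | "l > j" by linarith
        then show "(c l \<omega>)\<^sup>2 * indicator {\<pi> l<..\<pi> (Suc l)} s = (if l = j then (c j \<omega>)\<^sup>2 else 0)"
          using js mono'[of "Suc l" j] mono'[of "Suc j" l] l by cases (auto simp: indicator_def)
      qed
      ultimately show ?thesis using True js by (simp add: indicator_def)
    qed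
    then have "(LBINT s:{0..T}. (\<Sum>i\<in>I. \<xi> i \<omega> * indicator {a i<..b i} s)\<^sup>2) =
       (LBINT s. (\<Sum>j<m. (c j \<omega>)\<^sup>2 * indicator {\<pi> j<..\<pi> (Suc j)} s))"
      by (simp add: set_lebesgue_integral_def)
    also have "\<dots> = (\<Sum>j<m. LBINT s. (c j \<omega>)\<^sup>2 * indicator {\<pi> j<..\<pi> (Suc j)} s)"
      using mono' by (intro Bochner_Integration.integral_sum integrable_mult_right integrable_real_indicator) auto
    also have "\<dots> = (\<Sum>j<m. (c j \<omega>)\<^sup>2 * (\<pi> (Suc j) - \<pi> j))"
      using mono' by (intro sum.cong) (auto simp: measure_def)
    finally show ?thesis .
  qed
  have "prob {\<omega>\<in>space M. \<exists>q\<in>Q. \<bar>\<Sum>i\<in>I. \<xi> i \<omega> * (W (min q (b i)) \<omega> - W (min q (a i)) \<omega>)\<bar> > \<epsilon>}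
     \<le> prob {\<omega>\<in>space M. \<exists>k\<le>m. \<bar>\<Sum>j<k. c j \<omega> * g j \<omega>\<bar> > \<epsilon>}"
  proof (rule finite_measure_mono)
    show "{\<omega>\<in>space M. \<exists>q\<in>Q. \<bar>\<Sum>i\<in>I. \<xi> i \<omega> * (W (min q (b i)) \<omega> - W (min q (a i)) \<omega>)\<bar> > \<epsilon>}
      \<subseteq> {\<omega>\<in>space M. \<exists>k\<le>m. \<bar>\<Sum>j<k. c j \<omega> * g j \<omega>\<bar> > \<epsilon>}"
    proof safe
      fix \<omega> q assume q: "q \<in> Q" "\<epsilon> < \<bar>\<Sum>i\<in>I. \<xi> i \<omega> * (W (min q (b i)) \<omega> - W (min q (a i)) \<omega>)\<bar>"
      then obtain k where "k \<le> m" "q = \<pi> k" using \<pi> S_def by auto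
      then show "\<exists>k\<le>m. \<bar>\<Sum>j<k. c j \<omega> * g j \<omega>\<bar> > \<epsilon>" using q lhs[of k \<omega>] by auto
    qed
    have cg: "c j \<in> borel_measurable M" "g j \<in> borel_measurable M" if "j < m" for j
    proof -
      show "c j \<in> borel_measurable M"
        using that by (intro measurable_F_M[OF c_meas] range) auto
      show "g j \<in> borel_measurable M"
        unfolding g_def using that by (intro borel_measurable_diff W_M range) auto
    qed
    have "(\<lambda>\<omega>. \<bar>\<Sum>j<k. c j \<omega> * g j \<omega>\<bar>) \<in> borel_measurable M" if "k \<le> m" for k
      using that by (intro borel_measurable_abs borel_measurable_sum borel_measurable_times cg) auto
    then have "{\<omega>\<in>space M. \<bar>\<Sum>j<k. c j \<omega> * g j \<omega>\<bar> > \<epsilon>} \<in> events" if "k \<in> {..m}" for k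
      using that by (intro borel_measurable_less borel_measurable_const) simp
    then have "{\<omega>\<in>space M. \<exists>k\<in>{..m}. \<bar>\<Sum>j<k. c j \<omega> * g j \<omega>\<bar> > \<epsilon>} \<in> events"
      by (rule sets.sets_Collect_finite_Ex[OF _ finite_atMost])
    then show "{\<omega>\<in>space M. \<exists>k\<le>m. \<bar>\<Sum>j<k. c j \<omega> * g j \<omega>\<bar> > \<epsilon>} \<in> events"
      by (simp only: Bex_def atMost_iff)
  qed
  also have "\<dots> \<le> prob {\<omega>\<in>space M. (\<Sum>j<m. (c j \<omega>)\<^sup>2 * (\<pi> (Suc j) - \<pi> j)) > \<delta>} + \<delta> / \<epsilon>\<^sup>2"
  proof (rule discrete_lenglart[where Fs="\<lambda>j. F (\<pi> j)"])
    show "subalgebra M (F (\<pi> j))" if "j \<le> m" for j using subalgebra_F range that by auto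
    show "sets (F (\<pi> i)) \<subseteq> sets (F (\<pi> j))" if "i \<le> j" "j \<le> m" for i j
      using that mono' range[of i] by (intro sets_F_mono) auto
    show "c j \<in> borel_measurable (F (\<pi> j))" if "j < m" for j using c_meas that by simp
    fix j assume j: "j < m"
    have r: "0 \<le> \<pi> j" "\<pi> j < \<pi> (Suc j)" using range mono[of j "Suc j"] j by auto
    show "g j \<in> borel_measurable (F (\<pi> (Suc j)))"
      unfolding g_def using r by (intro borel_measurable_diff W_F) auto
    show "indep_var borel Y borel (g j)" if "Y \<in> borel_measurable (F (\<pi> j))" for Y
      unfolding g_def[abs_def] using W_increment_indep[OF r that] .
    show "integrable M (\<lambda>\<omega>. (g j \<omega>)\<^sup>2)" "expectation (g j) = 0"
      "expectation (\<lambda>\<omega>. (g j \<omega>)\<^sup>2) \<le> \<pi> (Suc j) - \<pi> j" "0 < \<pi> (Suc j) - \<pi> j"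
      unfolding g_def[abs_def] using W_increment_moments[OF r] r by simp_all
  qed fact+
  finally show ?thesis unfolding rhs .
qed

end

section \<open>Riemann sums of an Ito integral\<close>

text \<open>
  Rounding the time down to a grid gives functions that are measurable as countable gluings; by
  continuity of the paths they converge to the process as the mesh tends to 0.
\<close>

lemma (in prob_space) measurable_continuous_process:
  fixes H :: "real \<Rightarrow> 'a \<Rightarrow> real"
  assumes H: "\<And>t. 0 \<le> t \<Longrightarrow> H t \<in> borel_measurable M"
    and cont: "\<And>\<omega>. \<omega> \<in> space M \<Longrightarrow> continuous_on {0..} (\<lambda>t. H t \<omega>)"
  shows "(\<lambda>(\<omega>, s). H (max 0 s) \<omega>) \<in> borel_measurable (M \<Otimes>\<^sub>M lborel)"
proof -
  define q where "q n s = real (nat \<lfloor>real (Suc n) * s\<rfloor>) / real (Suc n)" for n s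
  show ?thesis
  proof (rule borel_measurable_LIMSEQ_real[where u="\<lambda>n (\<omega>, s). H (q n s) \<omega>"])
  fix n
  have "(\<lambda>p. (\<lambda>k p. H (real k / real (Suc n)) (fst p)) (nat \<lfloor>real (Suc n) * snd p\<rfloor>) p)
      \<in> borel_measurable (M \<Otimes>\<^sub>M lborel)"
  proof (rule measurable_compose_countable[where f="\<lambda>k p. H (real k / real (Suc n)) (fst p)"])
    show "(\<lambda>p. H (real k / real (Suc n)) (fst p)) \<in> borel_measurable (M \<Otimes>\<^sub>M lborel)" for k
      using H[of "real k / real (Suc n)"] by simp
    show "(\<lambda>p. nat \<lfloor>real (Suc n) * snd p\<rfloor>) \<in> measurable (M \<Otimes>\<^sub>M lborel) (count_space UNIV)"
      by measurable
  qed
  then show "(\<lambda>(\<omega>, s). H (q n s) \<omega>) \<in> borel_measurable (M \<Otimes>\<^sub>M lborel)"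
    by (simp add: q_def case_prod_beta')
next
  fix p assume "p \<in> space (M \<Otimes>\<^sub>M (lborel :: real measure))"
  then obtain \<omega> s where p: "p = (\<omega>, s)" "\<omega> \<in> space M" by (auto simp: space_pair_measure)
  have "(\<lambda>n. q n s) \<longlonglongrightarrow> max 0 s"
  proof (rule LIM_zero_cancel, rule LIMSEQ_norm_0)
    fix n
    show "norm (q n s - max 0 s) < 1 / real (Suc n)"
    proof (cases "0 \<le> s")
      case True
      then have "real (nat \<lfloor>real (Suc n) * s\<rfloor>) = of_int \<lfloor>real (Suc n) * s\<rfloor>" by simp
      then have "q n s - s = (of_int \<lfloor>real (Suc n) * s\<rfloor> - real (Suc n) * s) / real (Suc n)"
        by (simp add: q_def field_simps)
      moreover have "\<bar>of_int \<lfloor>real (Suc n) * s\<rfloor> - real (Suc n) * s\<bar> < 1" by linarith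
      ultimately show ?thesis using True by (simp add: abs_divide divide_strict_right_mono)
    next
      case False
      then have "real (Suc n) * s < 0" by (simp add: mult_pos_neg)
      then have "nat \<lfloor>real (Suc n) * s\<rfloor> = 0" by linarith
      then show ?thesis using False by (simp add: q_def)
    qed
  qed
  moreover have "0 \<le> q n s" for n by (simp add: q_def)
  ultimately have "(\<lambda>n. H (q n s) \<omega>) \<longlonglongrightarrow> H (max 0 s) \<omega>"
    using cont[OF p(2)] by (auto intro: continuous_on_tendsto_compose[where s="{0..}" and f="\<lambda>t. H t \<omega>"])
  then show "(\<lambda>n. case p of (\<omega>, s) \<Rightarrow> H (q n s) \<omega>) \<longlonglongrightarrow> (case p of (\<omega>, s) \<Rightarrow> H (max 0 s) \<omega>)"
    by (simp add: p)
qed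
qed

definition grid :: "real \<Rightarrow> nat \<Rightarrow> nat \<Rightarrow> real" where
  "grid T N j = T * real j / real (Suc N)"

lemma grid_0: "grid T N 0 = 0" by (simp add: grid_def)
lemma grid_Suc: "grid T N (Suc N) = T" by (simp add: grid_def)
lemma grid_nonneg: "0 \<le> T \<Longrightarrow> 0 \<le> grid T N j" by (simp add: grid_def)
lemma grid_mono: "0 \<le> T \<Longrightarrow> i \<le> j \<Longrightarrow> grid T N i \<le> grid T N j"
  by (simp add: grid_def divide_right_mono mult_left_mono)
lemma grid_less: "0 < T \<Longrightarrow> i < j \<Longrightarrow> grid T N i < grid T N j"
  by (simp add: grid_def divide_strict_right_mono)
lemma grid_le: "0 \<le> T \<Longrightarrow> j \<le> Suc N \<Longrightarrow> grid T N j \<le> T"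
  using grid_mono[of T j "Suc N" N] by (simp add: grid_Suc)
lemma grid_step: "grid T N (Suc j) - grid T N j = T / real (Suc N)"
  by (simp add: grid_def diff_divide_distrib[symmetric] algebra_simps)

lemma grid_locate:
  assumes "0 < T" "0 < s" "s \<le> T"
  obtains j where "j < Suc N" "grid T N j < s" "s \<le> grid T N (Suc j)"
proof -
  define k where "k = (LEAST k. s \<le> grid T N k)"
  have k: "s \<le> grid T N k" "k \<le> Suc N" "\<And>i. i < k \<Longrightarrow> grid T N i < s"
    unfolding k_def using assms grid_Suc[of T N] LeastI[of "\<lambda>k. s \<le> grid T N k" "Suc N"]
    by (auto intro: Least_le dest: not_less_Least)
  have "k \<noteq> 0" using k(1) assms grid_0[of T N] by (intro notI) simp
  then obtain j where "k = Suc j" using not0_implies_Suc by blast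
  then show ?thesis using k by (intro that[of j]) auto
qed

lemma grid_sum_indicator:
  assumes "0 < T" "j < Suc N" "grid T N j < s" "s \<le> grid T N (Suc j)"
  shows "(\<Sum>l<Suc N. f l * indicator {grid T N l<..grid T N (Suc l)} s) = (f j :: real)"
proof -
  have "(\<Sum>l<Suc N. f l * indicator {grid T N l<..grid T N (Suc l)} s) = (\<Sum>l<Suc N. if l = j then f j else 0)"
  proof (intro sum.cong refl)
    fix l
    consider "l < j" | "l = j" | "l > j" by linarith
    then show "f l * indicator {grid T N l<..grid T N (Suc l)} s = (if l = j then f j else 0)"
      using assms grid_mono[of T "Suc l" j N] grid_mono[of T "Suc j" l N]
      by cases (auto simp: indicator_def)
  qed
  then show ?thesis using assms by simp
qed

lemma grid_oscillation:
  fixes h :: "real \<Rightarrow> real"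
  assumes "0 < T" "continuous_on {0..T} h" "e > 0"
  shows "\<forall>\<^sub>F N in sequentially. \<forall>j<Suc N. \<forall>s\<in>{grid T N j..grid T N (Suc j)}. \<bar>h s - h (grid T N j)\<bar> < e"
proof -
  have "uniformly_continuous_on {0..T} h"
    using assms by (intro compact_uniformly_continuous) auto
  then obtain d where d: "d > 0" "\<And>x y. x \<in> {0..T} \<Longrightarrow> y \<in> {0..T} \<Longrightarrow> dist y x < d \<Longrightarrow> dist (h y) (h x) < e"
    using \<open>e > 0\<close> unfolding uniformly_continuous_on_def by metis
  have "(\<lambda>N. T / real (Suc N)) \<longlonglongrightarrow> 0"
    using tendsto_mult[OF tendsto_const[of T] LIMSEQ_inverse_real_of_nat] by (simp add: divide_inverse)
  from order_tendstoD(2)[OF this d(1)] show ?thesis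
  proof eventually_elim
    case (elim N)
    show ?case
    proof (intro allI impI ballI)
      fix j s assume j: "j < Suc N" and s: "s \<in> {grid T N j..grid T N (Suc j)}"
      have "0 \<le> grid T N j" "grid T N (Suc j) \<le> T"
        using grid_nonneg[of T N j] grid_le[of T "Suc j" N] j assms by auto
      moreover have "s - grid T N j < d" using s elim grid_step[of T N j] by auto
      ultimately show "\<bar>h s - h (grid T N j)\<bar> < e"
        using d(2)[of "grid T N j" s] s by (auto simp: dist_real_def)
    qed
  qed
qed

context brownian
begin

lemma continuous_adaptedD:
  assumes "continuous_adapted M F H" "\<omega> \<in> space M"
  shows "continuous_on {0..} (\<lambda>t. H t \<omega>)"
  using assms by (simp add: continuous_adapted_def)

lemma continuous_adapted_bounded:
  assumes "continuous_adapted M F H" "\<omega> \<in> space M"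
  obtains B where "B > 0" "\<And>s. s \<in> {0..T} \<Longrightarrow> \<bar>H s \<omega>\<bar> \<le> B"
proof -
  have "compact ((\<lambda>t. H t \<omega>) ` {0..T})"
    using continuous_on_subset[OF continuous_adaptedD[OF assms], of "{0..T}"]
    by (intro compact_continuous_image) auto
  from bounded_pos[THEN iffD1, OF compact_imp_bounded[OF this]]
  show ?thesis using that by (auto simp: image_iff)
qed

lemma joint_measurable:
  "continuous_adapted M F H \<Longrightarrow> (\<lambda>(\<omega>, s). H (max 0 s) \<omega>) \<in> borel_measurable (M \<Otimes>\<^sub>M lborel)"
  by (intro measurable_continuous_process adapted_M continuous_adaptedD)

lemma measurable_time_integral:
  assumes H: "continuous_adapted M F H"
  shows "(\<lambda>\<omega>. LBINT s:{0..T}. c * H s \<omega>) \<in> borel_measurable M"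
proof -
  have "(\<lambda>\<omega>. LBINT s. indicator {0..T} (snd (\<omega>, s)) * (c * (case (\<omega>, s) of (\<omega>, s) \<Rightarrow> H (max 0 s) \<omega>))) \<in> borel_measurable M"
    using joint_measurable[OF H] by measurable
  also have "(\<lambda>\<omega>. LBINT s. indicator {0..T} (snd (\<omega>, s)) * (c * (case (\<omega>, s) of (\<omega>, s) \<Rightarrow> H (max 0 s) \<omega>)))
     = (\<lambda>\<omega>. LBINT s:{0..T}. c * H s \<omega>)"
    unfolding set_lebesgue_integral_def
    by (intro ext Bochner_Integration.integral_cong) (auto simp: indicator_def max_def)
  finally show ?thesis .
qed

lemma
  assumes H: "continuous_adapted M F H"
    and \<xi>: "\<And>i. i < k \<Longrightarrow> \<xi> i \<in> borel_measurable M"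
  shows measurable_square_error:
      "(\<lambda>\<omega>. LBINT s:{0..T}. (simple_process k p \<xi> s \<omega> - H s \<omega>)\<^sup>2) \<in> borel_measurable M"
    and integrable_square_error: "\<omega> \<in> space M \<Longrightarrow>
      set_integrable lborel {0..T} (\<lambda>s. (simple_process k p \<xi> s \<omega> - H s \<omega>)\<^sup>2)"
proof -
  let ?E = "\<lambda>\<omega> s. (\<Sum>i<k. \<xi> i \<omega> * indicator {p i<..p (Suc i)} s) - H (max 0 s) \<omega>"
  have "(\<lambda>x. \<Sum>i<k. \<xi> i (fst x) * indicator {p i<..p (Suc i)} (snd x)) \<in> borel_measurable (M \<Otimes>\<^sub>M lborel)"
  proof (intro borel_measurable_sum)
    fix i assume "i \<in> {..<k}"
    then have [measurable]: "\<xi> i \<in> borel_measurable M" using \<xi> by simp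
    show "(\<lambda>x. \<xi> i (fst x) * indicator {p i<..p (Suc i)} (snd x)) \<in> borel_measurable (M \<Otimes>\<^sub>M lborel)"
      by measurable
  qed
  then have [measurable]: "(\<lambda>(\<omega>, s). ?E \<omega> s) \<in> borel_measurable (M \<Otimes>\<^sub>M lborel)"
    using borel_measurable_diff[OF _ joint_measurable[OF H]] by (simp add: case_prod_beta')
  have eq: "(\<lambda>s. indicator {0..T} s *\<^sub>R (simple_process k p \<xi> s \<omega> - H s \<omega>)\<^sup>2) = (\<lambda>s. indicator {0..T} s *\<^sub>R (?E \<omega> s)\<^sup>2)" for \<omega>
    by (auto simp: fun_eq_iff indicator_def simple_process_def max_def)
  have "(\<lambda>\<omega>. LBINT s. indicator {0..T} s *\<^sub>R (?E \<omega> s)\<^sup>2) \<in> borel_measurable M"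
    by measurable
  then show "(\<lambda>\<omega>. LBINT s:{0..T}. (simple_process k p \<xi> s \<omega> - H s \<omega>)\<^sup>2) \<in> borel_measurable M"
    unfolding set_lebesgue_integral_def eq .
  assume \<omega>: "\<omega> \<in> space M"
  obtain B where B: "B > 0" "\<And>s. s \<in> {0..T} \<Longrightarrow> \<bar>H s \<omega>\<bar> \<le> B"
    using continuous_adapted_bounded[OF H \<omega>] by blast
  have "integrable lborel (\<lambda>s. indicator {0..T} s *\<^sub>R (?E \<omega> s)\<^sup>2)"
  proof (rule integrableI_bounded_set_indicator[where B="((\<Sum>i<k. \<bar>\<xi> i \<omega>\<bar>) + B)\<^sup>2"])
    show "AE s in lborel. s \<in> {0..T} \<longrightarrow> norm ((?E \<omega> s)\<^sup>2) \<le> ((\<Sum>i<k. \<bar>\<xi> i \<omega>\<bar>) + B)\<^sup>2"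
    proof (intro AE_I2 impI)
      fix s assume s: "s \<in> {0..T}"
      have "\<bar>\<Sum>i<k. \<xi> i \<omega> * indicator {p i<..p (Suc i)} s\<bar> \<le> (\<Sum>i<k. \<bar>\<xi> i \<omega>\<bar>)"
        by (rule order_trans[OF sum_abs]) (auto intro!: sum_mono simp: indicator_def)
      moreover have "\<bar>H (max 0 s) \<omega>\<bar> \<le> B" using B(2)[OF s] s by (simp add: max_def)
      ultimately have "\<bar>?E \<omega> s\<bar> \<le> (\<Sum>i<k. \<bar>\<xi> i \<omega>\<bar>) + B" by linarith
      then show "norm ((?E \<omega> s)\<^sup>2) \<le> ((\<Sum>i<k. \<bar>\<xi> i \<omega>\<bar>) + B)\<^sup>2"
        by (simp add: abs_le_square_iff[symmetric])
    qed
    show "(\<lambda>s. (?E \<omega> s)\<^sup>2) \<in> borel_measurable lborel"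
    proof -
      have "(\<lambda>s. (\<lambda>(\<omega>, s). ?E \<omega> s) (\<omega>, s)) \<in> borel_measurable lborel"
        using \<omega> by (intro measurable_Pair2) measurable
      then show ?thesis by (simp only: prod.case) (rule borel_measurable_power)
    qed
  qed (auto simp: emeasure_lborel_Icc_eq)
  then show "set_integrable lborel {0..T} (\<lambda>s. (simple_process k p \<xi> s \<omega> - H s \<omega>)\<^sup>2)"
    unfolding set_integrable_def eq .
qed

lemma grid_square_error_null:
  assumes H: "continuous_adapted M F H" and "T > 0"
  shows "null_in_prob M (\<lambda>N \<omega>. LBINT s:{0..T}. (simple_process (Suc N) (grid T N) (\<lambda>j. H (grid T N j)) s \<omega> - H s \<omega>)\<^sup>2)"
proof (rule null_in_prob_pointwise)
  show "(\<lambda>\<omega>. LBINT s:{0..T}. (simple_process (Suc N) (grid T N) (\<lambda>j. H (grid T N j)) s \<omega> - H s \<omega>)\<^sup>2) \<in> borel_measurable M" for N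
    using \<open>T > 0\<close> by (intro measurable_square_error H adapted_M[OF H] grid_nonneg) auto
  fix \<omega> assume \<omega>: "\<omega> \<in> space M"
  have cont: "continuous_on {0..T} (\<lambda>t. H t \<omega>)"
    using continuous_on_subset[OF continuous_adaptedD[OF H \<omega>]] by auto
  show "(\<lambda>N. LBINT s:{0..T}. (simple_process (Suc N) (grid T N) (\<lambda>j. H (grid T N j)) s \<omega> - H s \<omega>)\<^sup>2) \<longlonglongrightarrow> 0"
  proof (rule tendstoI)
    fix \<epsilon> :: real assume "\<epsilon> > 0"
    define e where "e = sqrt (\<epsilon> / (2 * T))"
    have e: "e > 0" "e\<^sup>2 * T < \<epsilon>" using \<open>\<epsilon> > 0\<close> \<open>T > 0\<close> by (auto simp: e_def)
    from grid_oscillation[OF \<open>T > 0\<close> cont e(1)]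
    show "\<forall>\<^sub>F N in sequentially. dist (LBINT s:{0..T}. (simple_process (Suc N) (grid T N) (\<lambda>j. H (grid T N j)) s \<omega> - H s \<omega>)\<^sup>2) 0 < \<epsilon>"
    proof eventually_elim
      case (elim N)
      let ?f = "\<lambda>s. (simple_process (Suc N) (grid T N) (\<lambda>j. H (grid T N j)) s \<omega> - H s \<omega>)\<^sup>2"
      have int: "set_integrable lborel {0..T} ?f"
        using \<open>T > 0\<close> by (intro integrable_square_error H adapted_M[OF H] grid_nonneg \<omega>) auto
      have "(LBINT s:{0..T}. ?f s) \<le> (LBINT s:{0..T}. e\<^sup>2)"
        unfolding set_lebesgue_integral_def
      proof (rule integral_mono_AE)
        show "integrable lborel (\<lambda>s. indicator {0..T} s *\<^sub>R ?f s)" using int by (simp add: set_integrable_def)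
        show "integrable lborel (\<lambda>s. indicator {0..T} s *\<^sub>R e\<^sup>2)" using \<open>T > 0\<close> by simp
        show "AE s in lborel. indicator {0..T} s *\<^sub>R ?f s \<le> indicator {0..T} s *\<^sub>R e\<^sup>2"
          using AE_lborel_singleton[of 0]
        proof eventually_elim
          case (elim s)
          show ?case
          proof (cases "s \<in> {0..T}")
            case True
            then obtain j where j: "j < Suc N" "grid T N j < s" "s \<le> grid T N (Suc j)"
              using grid_locate[of T s N] \<open>T > 0\<close> elim by force
            have "simple_process (Suc N) (grid T N) (\<lambda>j. H (grid T N j)) s \<omega> = H (grid T N j) \<omega>"
              unfolding simple_process_def by (rule grid_sum_indicator[OF \<open>T > 0\<close> j])
            moreover have "\<bar>H s \<omega> - H (grid T N j) \<omega>\<bar> < e"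
              using \<open>\<forall>j<Suc N. \<forall>s\<in>{grid T N j..grid T N (Suc j)}. \<bar>H s \<omega> - H (grid T N j) \<omega>\<bar> < e\<close> j by auto
            ultimately have "\<bar>simple_process (Suc N) (grid T N) (\<lambda>j. H (grid T N j)) s \<omega> - H s \<omega>\<bar> \<le> \<bar>e\<bar>"
              using e by simp
            then show ?thesis using True by (simp add: abs_le_square_iff)
          qed simp
        qed
      qed
      also have "\<dots> = e\<^sup>2 * T" using \<open>T > 0\<close> by (simp add: set_lebesgue_integral_def)
      finally have "(LBINT s:{0..T}. ?f s) < \<epsilon>" using e by simp
      moreover have "0 \<le> (LBINT s:{0..T}. ?f s)"
        unfolding set_lebesgue_integral_def by (intro integral_nonneg_AE) auto
      ultimately show ?case by simp
    qed
  qed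
qed

lemma grid_stochastic_sum:
  assumes "0 < T" "k \<le> Suc N"
  shows "(\<Sum>j<Suc N. h j * (w (min (grid T N k) (grid T N (Suc j))) - w (min (grid T N k) (grid T N j)))) =
    (\<Sum>j<k. h j * (w (grid T N (Suc j)) - w (grid T N j)) :: real)"
proof (rule sum.mono_neutral_cong_right)
  show "\<forall>j\<in>{..<Suc N} - {..<k}. h j * (w (min (grid T N k) (grid T N (Suc j))) - w (min (grid T N k) (grid T N j))) = 0"
    using grid_mono[of T k _ N] assms by (auto simp: min_def)
  show "h j * (w (min (grid T N k) (grid T N (Suc j))) - w (min (grid T N k) (grid T N j))) =
     h j * (w (grid T N (Suc j)) - w (grid T N j))" if "j \<in> {..<k}" for j
    using grid_mono[of T j k N] grid_mono[of T "Suc j" k N] assms that by (simp add: min_absorb2)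
qed (use assms in auto)

definition riemann_error :: "(real \<Rightarrow> 'a \<Rightarrow> real) \<Rightarrow> (real \<Rightarrow> 'a \<Rightarrow> real) \<Rightarrow> real \<Rightarrow> nat \<Rightarrow> nat \<Rightarrow> 'a \<Rightarrow> real" where
  "riemann_error H I T N k \<omega> =
    (\<Sum>j<k. H (grid T N j) \<omega> * (W (grid T N (Suc j)) \<omega> - W (grid T N j) \<omega>)) - I (grid T N k) \<omega>"

lemma measurable_riemann_error:
  assumes "is_ito_integral M F W H I" "T > 0"
  shows "riemann_error H I T N k \<in> borel_measurable M"
proof -
  have "I (grid T N k) \<in> borel_measurable M"
    using assms grid_nonneg[of T N k] measurable_F_M[of "I (grid T N k)" "grid T N k"] by (auto simp: is_ito_integral_def)
  moreover have "continuous_adapted M F H" using assms by (simp add: is_ito_integral_def)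
  ultimately show ?thesis
    unfolding riemann_error_def[abs_def] using assms(2)
    by (intro borel_measurable_diff borel_measurable_sum borel_measurable_times W_M adapted_M[of H] grid_nonneg) auto
qed

text \<open>
  The Riemann sum is compared with the integrals of the simple processes that define the Ito integral. For each
  of them the error is an elementary integral, controlled by \<open>elementary_lenglart\<close>; letting the simple
  processes tend to the integrand replaces them by the Ito integral, since only the
  finitely many grid points matter.
\<close>

lemma riemann_error_bound:
  assumes ito: "is_ito_integral M F W H I" and "T > 0" "\<epsilon> > 0" "\<delta> > 0"
  shows "prob {\<omega>\<in>space M. \<exists>k\<in>{..Suc N}. \<bar>riemann_error H I T N k \<omega>\<bar> > 2 * \<epsilon>}
    \<le> prob {\<omega>\<in>space M. (LBINT s:{0..T}. (simple_process (Suc N) (grid T N) (\<lambda>j. H (grid T N j)) s \<omega> - H s \<omega>)\<^sup>2) > \<delta>}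
      + 4 * \<delta> / \<epsilon>\<^sup>2" (is "?P \<le> prob ?D + _")
proof -
  have H: "continuous_adapted M F H" using ito by (simp add: is_ito_integral_def)
  have "\<exists>K p \<xi>.
        (\<forall>n. simple_process_data M F (K n) (p n) (\<xi> n)) \<and>
        (\<forall>t\<ge>0.
           null_in_prob M (\<lambda>n \<omega>. LBINT s:{0..t}. (simple_process (K n) (p n) (\<xi> n) s \<omega> - H s \<omega>)\<^sup>2) \<and>
           tendsto_in_probability M (\<lambda>n. simple_integral W (K n) (p n) (\<xi> n) t) (I t))"
    using ito unfolding is_ito_integral_def by (elim conjE)
  then obtain K p \<xi> where *: "(\<forall>n. simple_process_data M F (K n) (p n) (\<xi> n)) \<and>
        (\<forall>t\<ge>0.
           null_in_prob M (\<lambda>n \<omega>. LBINT s:{0..t}. (simple_process (K n) (p n) (\<xi> n) s \<omega> - H s \<omega>)\<^sup>2) \<and>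
           tendsto_in_probability M (\<lambda>n. simple_integral W (K n) (p n) (\<xi> n) t) (I t))"
    by (elim exE)
  have simple: "simple_process_data M F (K n) (p n) (\<xi> n)" for n
    using * by blast
  have conv: "null_in_prob M (\<lambda>n \<omega>. LBINT s:{0..t}. (simple_process (K n) (p n) (\<xi> n) s \<omega> - H s \<omega>)\<^sup>2)"
     "tendsto_in_probability M (\<lambda>n. simple_integral W (K n) (p n) (\<xi> n) t) (I t)" if "t \<ge> 0" for t
    using * that by blast+
  have p: "0 \<le> p n i" if "i \<le> K n" for n i
    using that
  proof (induction i)
    case 0 then show ?case using simple[of n] by (simp add: simple_process_data_def)
  next
    case (Suc i)
    then have "p n i \<le> p n (Suc i)" using simple[of n] by (simp add: simple_process_data_def)
    with Suc show ?case by simp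
  qed
  have p': "p n i \<le> p n (Suc i)" if "i < K n" for n i
    using that simple[of n] by (simp add: simple_process_data_def)
  have \<xi>: "\<xi> n i \<in> borel_measurable (F (p n i))" if "i < K n" for n i
    using that simple[of n] by (simp add: simple_process_data_def)
  have \<xi>M: "\<xi> n i \<in> borel_measurable M" if "i < K n" for n i
    using measurable_F_M[OF \<xi>[OF that]] p[of i n] that by simp
  have HM: "H (grid T N j) \<in> borel_measurable M" for j
    using adapted_M[OF H] grid_nonneg[of T N j] \<open>T > 0\<close> by simp
  have IM: "I t \<in> borel_measurable M" if "t \<ge> 0" for t
    using ito that measurable_F_M[of "I t" t] by (auto simp: is_ito_integral_def)
  define S where "S n t \<omega> = simple_integral W (K n) (p n) (\<xi> n) t \<omega>" for n t \<omega>
  have SM: "S n t \<in> borel_measurable M" if "t \<ge> 0" for n t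
    unfolding S_def simple_integral_def using that p
    by (intro borel_measurable_sum borel_measurable_times borel_measurable_diff \<xi>M W_M) auto
  define E where "E n \<omega> = (LBINT s:{0..T}. (simple_process (K n) (p n) (\<xi> n) s \<omega> - H s \<omega>)\<^sup>2)" for n \<omega>
  define D where "D \<omega> = (LBINT s:{0..T}. (simple_process (Suc N) (grid T N) (\<lambda>j. H (grid T N j)) s \<omega> - H s \<omega>)\<^sup>2)" for \<omega>
  have EM [measurable]: "E n \<in> borel_measurable M" for n
    unfolding E_def by (intro measurable_square_error H \<xi>M)
  have DM [measurable]: "D \<in> borel_measurable M"
    unfolding D_def by (intro measurable_square_error H HM)
  define R where "R k \<omega> = (\<Sum>j<k. H (grid T N j) \<omega> * (W (grid T N (Suc j)) \<omega> - W (grid T N j) \<omega>))" for k \<omega>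
  have RM: "R k \<in> borel_measurable M" for k
    unfolding R_def using \<open>T > 0\<close>
    by (intro borel_measurable_sum borel_measurable_times borel_measurable_diff HM W_M grid_nonneg) auto
  have step: "prob {\<omega>\<in>space M. \<exists>k\<in>{..Suc N}. \<bar>R k \<omega> - S n (grid T N k) \<omega>\<bar> > \<epsilon>}
     \<le> (prob {\<omega>\<in>space M. D \<omega> > \<delta>} + prob {\<omega>\<in>space M. \<bar>E n \<omega>\<bar> > \<delta>}) + 4 * \<delta> / \<epsilon>\<^sup>2" for n
  proof -
    \<comment> \<open>The Riemann sum minus the simple integral, as one elementary integral over a disjoint union of index sets.\<close>
    define J where "J = {..<K n} <+> {..<Suc N}"
    define a where "a = case_sum (p n) (grid T N)"
    define b where "b = case_sum (\<lambda>i. p n (Suc i)) (\<lambda>j. grid T N (Suc j))"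
    define c where "c = case_sum (\<lambda>i \<omega>. - \<xi> n i \<omega>) (\<lambda>j. H (grid T N j))"
    have sumJ: "(\<Sum>i\<in>J. f i) = (\<Sum>i<K n. f (Inl i)) + (\<Sum>j<Suc N. f (Inr j))" for f :: "nat + nat \<Rightarrow> real"
      unfolding J_def by (subst sum.Plus) auto
    have proc: "(\<Sum>i\<in>J. c i \<omega> * indicator {a i<..b i} s) =
       simple_process (Suc N) (grid T N) (\<lambda>j. H (grid T N j)) s \<omega> - simple_process (K n) (p n) (\<xi> n) s \<omega>" for \<omega> s
      unfolding sumJ a_def b_def c_def simple_process_def by (simp add: sum_negf del: sum.lessThan_Suc)
    have integ: "(\<Sum>i\<in>J. c i \<omega> * (W (min (grid T N k) (b i)) \<omega> - W (min (grid T N k) (a i)) \<omega>)) =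
       R k \<omega> - S n (grid T N k) \<omega>" if "k \<le> Suc N" for k \<omega>
    proof -
      have "(\<Sum>j<Suc N. H (grid T N j) \<omega> * (W (min (grid T N k) (grid T N (Suc j))) \<omega> - W (min (grid T N k) (grid T N j)) \<omega>)) = R k \<omega>"
        unfolding R_def by (rule grid_stochastic_sum[OF \<open>T > 0\<close> that])
      then show ?thesis
        unfolding sumJ a_def b_def c_def S_def simple_integral_def by (simp add: sum_negf del: sum.lessThan_Suc)
    qed
    have "prob {\<omega>\<in>space M. \<exists>q\<in>grid T N ` {..Suc N}. \<bar>\<Sum>i\<in>J. c i \<omega> * (W (min q (b i)) \<omega> - W (min q (a i)) \<omega>)\<bar> > \<epsilon>}
      \<le> prob {\<omega>\<in>space M. (LBINT s:{0..T}. (\<Sum>i\<in>J. c i \<omega> * indicator {a i<..b i} s)\<^sup>2) > 4 * \<delta>} + 4 * \<delta> / \<epsilon>\<^sup>2"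
    proof (rule elementary_lenglart)
      show "finite J" by (simp add: J_def)
      show "grid T N ` {..Suc N} \<subseteq> {0..T}"
        using grid_nonneg[of T N] grid_le[of T _ N] \<open>T > 0\<close> by auto
      fix i assume i: "i \<in> J"
      show "0 \<le> a i" "a i \<le> b i"
        using i p p' grid_nonneg[of T N] grid_mono[of T _ _ N] \<open>T > 0\<close> by (auto simp: J_def a_def b_def)
      show "c i \<in> borel_measurable (F (a i))"
        using i \<xi> adapted_F[OF H grid_nonneg[of T N] order_refl] \<open>T > 0\<close> by (auto simp: J_def a_def c_def)
    qed (use assms in auto)
    also have "prob {\<omega>\<in>space M. (LBINT s:{0..T}. (\<Sum>i\<in>J. c i \<omega> * indicator {a i<..b i} s)\<^sup>2) > 4 * \<delta>}
      \<le> prob ({\<omega>\<in>space M. D \<omega> > \<delta>} \<union> {\<omega>\<in>space M. \<bar>E n \<omega>\<bar> > \<delta>})"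
    proof (rule finite_measure_mono)
      show "{\<omega>\<in>space M. (LBINT s:{0..T}. (\<Sum>i\<in>J. c i \<omega> * indicator {a i<..b i} s)\<^sup>2) > 4 * \<delta>}
        \<subseteq> {\<omega>\<in>space M. D \<omega> > \<delta>} \<union> {\<omega>\<in>space M. \<bar>E n \<omega>\<bar> > \<delta>}"
      proof (safe, rule ccontr)
        fix \<omega> assume \<omega>: "\<omega> \<in> space M" and l: "4 * \<delta> < (LBINT s:{0..T}. (\<Sum>i\<in>J. c i \<omega> * indicator {a i<..b i} s)\<^sup>2)"
          and D: "\<not> \<bar>E n \<omega>\<bar> > \<delta>" "\<not> D \<omega> > \<delta>"
        let ?f = "\<lambda>s. (simple_process (Suc N) (grid T N) (\<lambda>j. H (grid T N j)) s \<omega> - H s \<omega>)\<^sup>2"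
        let ?g = "\<lambda>s. (simple_process (K n) (p n) (\<xi> n) s \<omega> - H s \<omega>)\<^sup>2"
        have i: "set_integrable lborel {0..T} ?f" "set_integrable lborel {0..T} ?g"
          by (intro integrable_square_error H HM \<xi>M \<omega>; assumption)+
        have "(LBINT s:{0..T}. (\<Sum>i\<in>J. c i \<omega> * indicator {a i<..b i} s)\<^sup>2) \<le> (LBINT s:{0..T}. 2 * ?f s + 2 * ?g s)"
          unfolding set_lebesgue_integral_def
        proof (rule Bochner_Integration.integral_mono')
          show "integrable lborel (\<lambda>s. indicator {0..T} s *\<^sub>R (2 * ?f s + 2 * ?g s))"
            using i by (fold set_integrable_def) (intro set_integral_add set_integrable_mult_right)
          show "indicator {0..T} s *\<^sub>R (\<Sum>i\<in>J. c i \<omega> * indicator {a i<..b i} s)\<^sup>2 \<le> indicator {0..T} s *\<^sub>R (2 * ?f s + 2 * ?g s)" for s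
          proof -
            have "(x - y)\<^sup>2 \<le> 2 * (x - z)\<^sup>2 + 2 * (y - z)\<^sup>2" for x y z :: real
            proof -
              have "2 * (x - z)\<^sup>2 + 2 * (y - z)\<^sup>2 - (x - y)\<^sup>2 = (x + y - 2 * z)\<^sup>2"
                by (simp add: power2_eq_square algebra_simps)
              then show ?thesis by (smt (verit) zero_le_power2)
            qed
            then show ?thesis unfolding proc by (intro scaleR_left_mono) auto
          qed
        qed auto
        also have "\<dots> = 2 * D \<omega> + 2 * E n \<omega>"
          using i by (simp add: D_def E_def set_integral_add(2) set_integrable_mult_right)
        finally show False using l D by linarith
      qed
    qed auto
    also have "\<dots> \<le> prob {\<omega>\<in>space M. D \<omega> > \<delta>} + prob {\<omega>\<in>space M. \<bar>E n \<omega>\<bar> > \<delta>}"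
      by (rule measure_Un_le) auto
    also have "{\<omega>\<in>space M. \<exists>q\<in>grid T N ` {..Suc N}. \<bar>\<Sum>i\<in>J. c i \<omega> * (W (min q (b i)) \<omega> - W (min q (a i)) \<omega>)\<bar> > \<epsilon>}
      = {\<omega>\<in>space M. \<exists>k\<in>{..Suc N}. \<bar>R k \<omega> - S n (grid T N k) \<omega>\<bar> > \<epsilon>}"
      by (auto simp: integ simp del: atMost_Suc)
    finally show ?thesis by simp
  qed
  have gn: "0 \<le> grid T N k" for k using \<open>T > 0\<close> by (simp add: grid_nonneg)
  have fin: "?P \<le> (prob {\<omega>\<in>space M. D \<omega> > \<delta>} + prob {\<omega>\<in>space M. \<bar>E n \<omega>\<bar> > \<delta>}) + 4 * \<delta> / \<epsilon>\<^sup>2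
     + (\<Sum>k\<in>{..Suc N}. prob {\<omega>\<in>space M. \<bar>S n (grid T N k) \<omega> - I (grid T N k) \<omega>\<bar> > \<epsilon>})" for n
  proof -
    let ?A = "{\<omega>\<in>space M. \<exists>k\<in>{..Suc N}. \<bar>R k \<omega> - S n (grid T N k) \<omega>\<bar> > \<epsilon>}"
    let ?B = "\<lambda>k. {\<omega>\<in>space M. \<bar>S n (grid T N k) \<omega> - I (grid T N k) \<omega>\<bar> > \<epsilon>}"
    have "{\<omega>\<in>space M. \<bar>R k \<omega> - S n (grid T N k) \<omega>\<bar> > \<epsilon>} \<in> events" for k
      using RM[of k] SM[OF gn[of k], of n] by measurable
    then have A: "?A \<in> events" by (rule sets.sets_Collect_finite_Ex[OF _ finite_atMost])
    have B: "?B k \<in> events" for k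
      using SM[OF gn[of k], of n] IM[OF gn[of k]] by measurable
    have "?P \<le> prob (?A \<union> (\<Union>k\<in>{..Suc N}. ?B k))"
    proof (rule finite_measure_mono)
      show "?A \<union> (\<Union>k\<in>{..Suc N}. ?B k) \<in> events" using A B by (intro sets.Un sets.finite_UN) auto
      show "{\<omega>\<in>space M. \<exists>k\<in>{..Suc N}. \<bar>riemann_error H I T N k \<omega>\<bar> > 2 * \<epsilon>} \<subseteq> ?A \<union> (\<Union>k\<in>{..Suc N}. ?B k)"
      proof
        fix \<omega> assume "\<omega> \<in> {\<omega>\<in>space M. \<exists>k\<in>{..Suc N}. \<bar>riemann_error H I T N k \<omega>\<bar> > 2 * \<epsilon>}"
        then obtain k where k: "\<omega> \<in> space M" "k \<in> {..Suc N}" "\<bar>R k \<omega> - I (grid T N k) \<omega>\<bar> > 2 * \<epsilon>"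
          unfolding riemann_error_def R_def by blast
        then have "\<bar>R k \<omega> - S n (grid T N k) \<omega>\<bar> > \<epsilon> \<or> \<bar>S n (grid T N k) \<omega> - I (grid T N k) \<omega>\<bar> > \<epsilon>" by linarith
        then show "\<omega> \<in> ?A \<union> (\<Union>k\<in>{..Suc N}. ?B k)" using k by blast
      qed
    qed
    also have "\<dots> \<le> prob ?A + prob (\<Union>k\<in>{..Suc N}. ?B k)"
      using A B by (intro measure_Un_le sets.finite_UN) auto
    also have "prob (\<Union>k\<in>{..Suc N}. ?B k) \<le> (\<Sum>k\<in>{..Suc N}. prob (?B k))"
      using B by (intro finite_measure_subadditive_finite) auto
    finally show ?thesis using step[of n] by linarith
  qed
  have "(\<lambda>n. (prob {\<omega>\<in>space M. D \<omega> > \<delta>} + prob {\<omega>\<in>space M. \<bar>E n \<omega>\<bar> > \<delta>}) + 4 * \<delta> / \<epsilon>\<^sup>2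
     + (\<Sum>k\<in>{..Suc N}. prob {\<omega>\<in>space M. \<bar>S n (grid T N k) \<omega> - I (grid T N k) \<omega>\<bar> > \<epsilon>}))
     \<longlonglongrightarrow> (prob {\<omega>\<in>space M. D \<omega> > \<delta>} + 0) + 4 * \<delta> / \<epsilon>\<^sup>2 + (\<Sum>k\<in>{..Suc N}. 0)"
  proof (intro tendsto_add tendsto_const tendsto_sum)
    show "(\<lambda>n. prob {\<omega>\<in>space M. \<bar>E n \<omega>\<bar> > \<delta>}) \<longlonglongrightarrow> 0"
      using conv(1)[of T] assms unfolding tendsto_in_probability_def E_def by simp
    show "(\<lambda>n. prob {\<omega>\<in>space M. \<bar>S n (grid T N k) \<omega> - I (grid T N k) \<omega>\<bar> > \<epsilon>}) \<longlonglongrightarrow> 0" for k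
      using conv(2)[OF gn[of k]] assms unfolding tendsto_in_probability_def S_def by simp
  qed
  from LIMSEQ_le_const[OF this, of ?P] fin show ?thesis by (auto simp: D_def)
qed

lemma riemann_error_null:
  assumes ito: "is_ito_integral M F W H I" and "T > 0"
  shows "null_in_prob M (\<lambda>N \<omega>. Max ((\<lambda>k. \<bar>riemann_error H I T N k \<omega>\<bar>) ` {..Suc N}))"
proof (rule null_in_probI)
  fix \<epsilon> \<eta> :: real assume e: "\<epsilon> > 0" "\<eta> > 0"
  have H: "continuous_adapted M F H" using ito by (simp add: is_ito_integral_def)
  \<comment> \<open>Chosen so that the second term of \<open>riemann_error_bound\<close> equals \<open>\<eta> / 2\<close>.\<close>
  define \<delta> where "\<delta> = (\<epsilon>/2)\<^sup>2 * \<eta> / 8"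
  have \<delta>: "\<delta> > 0" "4 * \<delta> / (\<epsilon>/2)\<^sup>2 = \<eta> / 2" using e by (auto simp: \<delta>_def)
  have "\<eta> / 2 > 0" using e by simp
  from null_in_probD[OF grid_square_error_null[OF H \<open>T > 0\<close>] \<delta>(1) this]
  show "\<forall>\<^sub>F N in sequentially. prob {\<omega>\<in>space M. \<bar>Max ((\<lambda>k. \<bar>riemann_error H I T N k \<omega>\<bar>) ` {..Suc N})\<bar> > \<epsilon>} \<le> \<eta>"
  proof eventually_elim
    case (elim N)
    have M: "\<bar>Max ((\<lambda>k. \<bar>riemann_error H I T N k \<omega>\<bar>) ` {..Suc N})\<bar> > \<epsilon> \<longleftrightarrow>
      (\<exists>k\<in>{..Suc N}. \<bar>riemann_error H I T N k \<omega>\<bar> > 2 * (\<epsilon>/2))" for \<omega>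
    proof -
      have "0 \<le> \<bar>riemann_error H I T N 0 \<omega>\<bar>" by simp
      also have "\<dots> \<le> Max ((\<lambda>k. \<bar>riemann_error H I T N k \<omega>\<bar>) ` {..Suc N})"
        by (intro Max_ge) auto
      finally have "\<bar>Max ((\<lambda>k. \<bar>riemann_error H I T N k \<omega>\<bar>) ` {..Suc N})\<bar> = Max ((\<lambda>k. \<bar>riemann_error H I T N k \<omega>\<bar>) ` {..Suc N})"
        by simp
      then show ?thesis by (simp add: Max_gr_iff del: atMost_Suc)
    qed
    have "prob {\<omega>\<in>space M. \<bar>Max ((\<lambda>k. \<bar>riemann_error H I T N k \<omega>\<bar>) ` {..Suc N})\<bar> > \<epsilon>} \<le>
      prob {\<omega>\<in>space M. (LBINT s:{0..T}. (simple_process (Suc N) (grid T N) (\<lambda>j. H (grid T N j)) s \<omega> - H s \<omega>)\<^sup>2) > \<delta>} + 4 * \<delta> / (\<epsilon>/2)\<^sup>2"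
      unfolding M using e \<delta> by (intro riemann_error_bound ito \<open>T > 0\<close>) auto
    also have "prob {\<omega>\<in>space M. (LBINT s:{0..T}. (simple_process (Suc N) (grid T N) (\<lambda>j. H (grid T N j)) s \<omega> - H s \<omega>)\<^sup>2) > \<delta>}
      \<le> prob {\<omega>\<in>space M. \<bar>LBINT s:{0..T}. (simple_process (Suc N) (grid T N) (\<lambda>j. H (grid T N j)) s \<omega> - H s \<omega>)\<^sup>2\<bar> > \<delta>}"
    proof (rule finite_measure_mono)
      have [measurable]: "(\<lambda>\<omega>. LBINT s:{0..T}. (simple_process (Suc N) (grid T N) (\<lambda>j. H (grid T N j)) s \<omega> - H s \<omega>)\<^sup>2) \<in> borel_measurable M"
        using \<open>T > 0\<close> by (intro measurable_square_error H adapted_M[OF H] grid_nonneg) auto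
      show "{\<omega>\<in>space M. \<bar>LBINT s:{0..T}. (simple_process (Suc N) (grid T N) (\<lambda>j. H (grid T N j)) s \<omega> - H s \<omega>)\<^sup>2\<bar> > \<delta>} \<in> events"
        by measurable
    qed auto
    finally show ?case using elim \<delta>(2) by linarith
  qed
qed

end

section \<open>Vanishing of triangular arrays of increments\<close>

lemma (in prob_space) null_in_prob_cong_AE:
  assumes "null_in_prob M Y" "\<And>n. AE \<omega> in M. X n \<omega> = Y n \<omega>"
    and [measurable]: "\<And>n. X n \<in> borel_measurable M" "\<And>n. Y n \<in> borel_measurable M"
  shows "null_in_prob M X"
proof -
  have "prob {\<omega>\<in>space M. \<bar>X n \<omega> - 0\<bar> > \<epsilon>} = prob {\<omega>\<in>space M. \<bar>Y n \<omega> - 0\<bar> > \<epsilon>}" for n \<epsilon>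
    using assms(2)[of n] by (intro finite_measure_eq_AE) (auto elim!: eventually_mono)
  then show ?thesis using assms(1) by (simp add: tendsto_in_probability_def)
qed

lemma (in prob_space) null_in_prob_power2:
  assumes "null_in_prob M Y"
  shows "null_in_prob M (\<lambda>n \<omega>. (Y n \<omega>)\<^sup>2)"
proof (rule null_in_probI)
  fix \<epsilon> \<eta> :: real assume e: "\<epsilon> > 0" "\<eta> > 0"
  have "\<bar>y\<^sup>2\<bar> > \<epsilon> \<longleftrightarrow> \<bar>y\<bar> > sqrt \<epsilon>" for y :: real
    using real_sqrt_less_iff[of \<epsilon> "y\<^sup>2"] by simp
  then show "\<forall>\<^sub>F n in sequentially. prob {\<omega>\<in>space M. \<bar>(Y n \<omega>)\<^sup>2\<bar> > \<epsilon>} \<le> \<eta>"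
    using null_in_probD[OF assms, of "sqrt \<epsilon>" \<eta>] e by (auto elim!: eventually_mono)
qed

lemma tendsto_scaled_derivative:
  fixes f :: "real \<Rightarrow> real"
  assumes "(f has_real_derivative L) (at 0)" "f 0 = 0" "T > 0"
  shows "(\<lambda>N. real (Suc N) * f (T / real (Suc N))) \<longlonglongrightarrow> T * L"
proof -
  have "((\<lambda>h. f h / h) \<longlongrightarrow> L) (at 0)"
    using assms by (simp add: DERIV_def)
  moreover have "filterlim (\<lambda>N. T / real (Suc N)) (at 0) sequentially"
  proof (rule filterlim_atI)
    show "(\<lambda>N. T / real (Suc N)) \<longlonglongrightarrow> 0"
      using tendsto_mult[OF tendsto_const[of T] LIMSEQ_inverse_real_of_nat] by (simp add: divide_inverse)
  qed (use assms in auto)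
  ultimately have "(\<lambda>N. f (T / real (Suc N)) / (T / real (Suc N))) \<longlonglongrightarrow> L"
    by (rule filterlim_compose)
  from tendsto_mult[OF tendsto_const[of T] this]
  have "(\<lambda>N. T * (f (T / real (Suc N)) / (T / real (Suc N)))) \<longlonglongrightarrow> T * L" .
  moreover have "T * (f (T / n) / (T / n)) = n * f (T / n)" for n
    using assms by simp
  ultimately show ?thesis by (simp only:)
qed

text \<open>
  Exponential tilting by \<open>exp (\<theta> w)\<close> shifts the mean of the normal density to \<open>\<theta> s\<^sup>2\<close>, up to the
  factor \<open>exp (\<theta>\<^sup>2 s\<^sup>2 / 2)\<close>.
\<close>

lemma gaussian_exp_moments:
  fixes s \<theta> :: real
  assumes "s > 0"
  shows "has_bochner_integral lborel (\<lambda>w. normal_density 0 s w * exp (\<theta> * w)) (exp (\<theta>\<^sup>2 * s\<^sup>2 / 2))" (is ?A)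
    and "has_bochner_integral lborel (\<lambda>w. normal_density 0 s w * (w * exp (\<theta> * w))) (\<theta> * s\<^sup>2 * exp (\<theta>\<^sup>2 * s\<^sup>2 / 2))" (is ?B)
    and "has_bochner_integral lborel (\<lambda>w. normal_density 0 s w * (w\<^sup>2 * exp (\<theta> * w)))
      ((s\<^sup>2 + \<theta>\<^sup>2 * s ^ 4) * exp (\<theta>\<^sup>2 * s\<^sup>2 / 2))" (is ?C)
proof -
  define m where "m = \<theta> * s\<^sup>2"
  define c where "c = exp (\<theta>\<^sup>2 * s\<^sup>2 / 2)"
  have shift: "normal_density 0 s w * exp (\<theta> * w) = c * normal_density m s w" for w
  proof -
    have "- (w - 0)\<^sup>2 / (2 * s\<^sup>2) + \<theta> * w = \<theta>\<^sup>2 * s\<^sup>2 / 2 + - (w - m)\<^sup>2 / (2 * s\<^sup>2)"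
      using assms by (simp add: m_def field_simps power2_eq_square)
    then have "exp (- (w - 0)\<^sup>2 / (2 * s\<^sup>2)) * exp (\<theta> * w) = c * exp (- (w - m)\<^sup>2 / (2 * s\<^sup>2))"
      unfolding c_def exp_add[symmetric] by simp
    then show ?thesis unfolding normal_density_def by (simp add: mult.assoc mult.left_commute)
  qed
  have tilt: "c * (normal_density m s w * f) = normal_density 0 s w * (f * exp (\<theta> * w))" for w f
    by (simp only: mult.assoc[symmetric] shift[symmetric]) (simp add: mult_ac)
  have h0: "has_bochner_integral lborel (normal_density m s) 1"
    using assms by (simp add: has_bochner_integral_iff)
  have h1: "has_bochner_integral lborel (\<lambda>w. normal_density m s w * w) m"
    by (rule normal_moment_nz_1[OF assms])
  have h2: "has_bochner_integral lborel (\<lambda>w. normal_density m s w * (w - m)\<^sup>2) (s\<^sup>2)"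
    using normal_moment_even[OF assms, of m 1] by simp
  have h2': "has_bochner_integral lborel (\<lambda>w. normal_density m s w * w\<^sup>2) (s\<^sup>2 + (2 * m * m - m\<^sup>2 * 1))"
  proof -
    have "has_bochner_integral lborel (\<lambda>w. normal_density m s w * (w - m)\<^sup>2 +
        (2 * m * (normal_density m s w * w) - m\<^sup>2 * normal_density m s w)) (s\<^sup>2 + (2 * m * m - m\<^sup>2 * 1))"
      by (intro has_bochner_integral_add has_bochner_integral_diff has_bochner_integral_mult_right h0 h1 h2)
    then show ?thesis
      by (rule has_bochner_integral_cong[THEN iffD1, rotated -1]) (auto simp: power2_eq_square algebra_simps)
  qed
  show ?A unfolding shift using has_bochner_integral_mult_right[of c, OF h0] by (simp add: c_def)
  have "has_bochner_integral lborel (\<lambda>w. c * (normal_density m s w * w)) (c * m)"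
    by (intro has_bochner_integral_mult_right h1)
  then show ?B
    unfolding tilt by (simp add: c_def m_def ac_simps)
  have "has_bochner_integral lborel (\<lambda>w. c * (normal_density m s w * w\<^sup>2)) (c * (s\<^sup>2 + (2 * m * m - m\<^sup>2 * 1)))"
    by (intro has_bochner_integral_mult_right h2')
  moreover have "c * (s\<^sup>2 + (2 * m * m - m\<^sup>2 * 1)) = (s\<^sup>2 + \<theta>\<^sup>2 * s ^ 4) * exp (\<theta>\<^sup>2 * s\<^sup>2 / 2)"
    by (simp add: c_def m_def algebra_simps power2_eq_square power4_eq_xxxx)
  ultimately show ?C
    unfolding tilt by simp
qed

text \<open>
  Both increments that occur in the product rule for \<open>Z X\<close> have this form \<open>\<gamma>\<close>.
\<close>

lemma gaussian_affine_exp_moments: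
  fixes s \<sigma> a0 a1 :: real
  assumes "s > 0"
  defines "\<gamma> \<equiv> \<lambda>w. exp (- \<sigma> * w) * (a0 + a1 * w) - 1"
  shows "has_bochner_integral lborel (\<lambda>w. normal_density 0 s w * \<gamma> w)
      ((a0 - a1 * \<sigma> * s\<^sup>2) * exp (\<sigma>\<^sup>2 * s\<^sup>2 / 2) - 1)" (is ?A)
    and "has_bochner_integral lborel (\<lambda>w. normal_density 0 s w * (\<gamma> w)\<^sup>2)
      ((a0\<^sup>2 - 4 * a0 * a1 * \<sigma> * s\<^sup>2 + a1\<^sup>2 * (s\<^sup>2 + 4 * \<sigma>\<^sup>2 * (s\<^sup>2)\<^sup>2)) * exp (2 * \<sigma>\<^sup>2 * s\<^sup>2)
        - 2 * (a0 - a1 * \<sigma> * s\<^sup>2) * exp (\<sigma>\<^sup>2 * s\<^sup>2 / 2) + 1)" (is ?B)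
proof -
  note M1 = gaussian_exp_moments[OF assms(1), of "- \<sigma>"]
  note M2 = gaussian_exp_moments[OF assms(1), of "- 2 * \<sigma>"]
  have h0: "has_bochner_integral lborel (normal_density 0 s) 1"
    using assms by (simp add: has_bochner_integral_iff)
  have "has_bochner_integral lborel (\<lambda>w. a0 * (normal_density 0 s w * exp (- \<sigma> * w)) +
      a1 * (normal_density 0 s w * (w * exp (- \<sigma> * w))) - normal_density 0 s w)
     (a0 * exp ((-\<sigma>)\<^sup>2 * s\<^sup>2 / 2) + a1 * (- \<sigma> * s\<^sup>2 * exp ((-\<sigma>)\<^sup>2 * s\<^sup>2 / 2)) - 1)"
    by (intro has_bochner_integral_add has_bochner_integral_diff has_bochner_integral_mult_right h0 M1)
  then show ?A
    by (rule has_bochner_integral_cong[THEN iffD1, rotated -1]) (auto simp: \<gamma>_def algebra_simps)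
  have "has_bochner_integral lborel (\<lambda>w. a0\<^sup>2 * (normal_density 0 s w * exp (- 2 * \<sigma> * w)) +
      2 * a0 * a1 * (normal_density 0 s w * (w * exp (- 2 * \<sigma> * w))) +
      a1\<^sup>2 * (normal_density 0 s w * (w\<^sup>2 * exp (- 2 * \<sigma> * w)))
      - 2 * a0 * (normal_density 0 s w * exp (- \<sigma> * w)) -
      2 * a1 * (normal_density 0 s w * (w * exp (- \<sigma> * w))) + normal_density 0 s w)
     (a0\<^sup>2 * exp ((-2*\<sigma>)\<^sup>2 * s\<^sup>2 / 2) + 2 * a0 * a1 * (- 2 * \<sigma> * s\<^sup>2 * exp ((-2*\<sigma>)\<^sup>2 * s\<^sup>2 / 2))
      + a1\<^sup>2 * ((s\<^sup>2 + (-2*\<sigma>)\<^sup>2 * s ^ 4) * exp ((-2*\<sigma>)\<^sup>2 * s\<^sup>2 / 2))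
      - 2 * a0 * exp ((-\<sigma>)\<^sup>2 * s\<^sup>2 / 2) - 2 * a1 * (- \<sigma> * s\<^sup>2 * exp ((-\<sigma>)\<^sup>2 * s\<^sup>2 / 2)) + 1)"
    by (intro has_bochner_integral_add has_bochner_integral_diff has_bochner_integral_mult_right h0 M1 M2)
  then show ?B
  proof (rule has_bochner_integral_cong[THEN iffD1, rotated -1])
    fix w :: real
    have e: "exp (- 2 * \<sigma> * w) = exp (- \<sigma> * w) * exp (- \<sigma> * w)"
      by (simp flip: exp_add)
    show "a0\<^sup>2 * (normal_density 0 s w * exp (- 2 * \<sigma> * w)) +
      2 * a0 * a1 * (normal_density 0 s w * (w * exp (- 2 * \<sigma> * w))) +
      a1\<^sup>2 * (normal_density 0 s w * (w\<^sup>2 * exp (- 2 * \<sigma> * w)))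
      - 2 * a0 * (normal_density 0 s w * exp (- \<sigma> * w)) -
      2 * a1 * (normal_density 0 s w * (w * exp (- \<sigma> * w))) + normal_density 0 s w
      = normal_density 0 s w * (\<gamma> w)\<^sup>2"
      unfolding e \<gamma>_def by (simp add: algebra_simps power2_eq_square)
    have f: "(-2*\<sigma>)\<^sup>2 * s\<^sup>2 / 2 = 2 * \<sigma>\<^sup>2 * s\<^sup>2" by (simp add: power2_eq_square)
    show "(a0\<^sup>2 * exp ((-2*\<sigma>)\<^sup>2 * s\<^sup>2 / 2) + 2 * a0 * a1 * (- 2 * \<sigma> * s\<^sup>2 * exp ((-2*\<sigma>)\<^sup>2 * s\<^sup>2 / 2))
      + a1\<^sup>2 * ((s\<^sup>2 + (-2*\<sigma>)\<^sup>2 * s ^ 4) * exp ((-2*\<sigma>)\<^sup>2 * s\<^sup>2 / 2))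
      - 2 * a0 * exp ((-\<sigma>)\<^sup>2 * s\<^sup>2 / 2) - 2 * a1 * (- \<sigma> * s\<^sup>2 * exp ((-\<sigma>)\<^sup>2 * s\<^sup>2 / 2)) + 1)
      = ((a0\<^sup>2 - 4 * a0 * a1 * \<sigma> * s\<^sup>2 + a1\<^sup>2 * (s\<^sup>2 + 4 * \<sigma>\<^sup>2 * (s\<^sup>2)\<^sup>2)) * exp (2 * \<sigma>\<^sup>2 * s\<^sup>2)
        - 2 * (a0 - a1 * \<sigma> * s\<^sup>2) * exp (\<sigma>\<^sup>2 * s\<^sup>2 / 2) + 1)"
      unfolding f by (simp add: algebra_simps power2_eq_square power4_eq_xxxx)
  qed auto
qed

context brownian
begin

text \<open>
  After centring, the sum is a martingale with conditional variance at most \<open>N v\<^sub>N Y\<^sub>N\<^sup>2\<close>, and the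
  compensator is at most \<open>N \<bar>m\<^sub>N\<bar> Y\<^sub>N\<close>. The term \<open>1 / N\<^sup>2\<close> only makes the variance bound strictly
  positive, as the maximal inequality requires.
\<close>

lemma array_null_in_prob:
  fixes A :: "nat \<Rightarrow> nat \<Rightarrow> 'a \<Rightarrow> real" and \<gamma> :: "nat \<Rightarrow> real \<Rightarrow> real" and Y :: "nat \<Rightarrow> 'a \<Rightarrow> real"
    and m v :: "nat \<Rightarrow> real"
  assumes "T > 0"
    and A: "\<And>N j. j < Suc N \<Longrightarrow> A N j \<in> borel_measurable (F (grid T N j))"
    and \<gamma> [measurable]: "\<And>N. \<gamma> N \<in> borel_measurable borel"
    and mom1: "\<And>N. has_bochner_integral lborel (\<lambda>w. normal_density 0 (sqrt (T / real (Suc N))) w * \<gamma> N w) (m N)"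
    and mom2: "\<And>N. has_bochner_integral lborel (\<lambda>w. normal_density 0 (sqrt (T / real (Suc N))) w * (\<gamma> N w)\<^sup>2) (v N)"
    and bound: "\<And>N j \<omega>. j < Suc N \<Longrightarrow> \<omega> \<in> space M \<Longrightarrow> \<bar>A N j \<omega>\<bar> \<le> Y N \<omega>"
    and Y [measurable]: "\<And>N. Y N \<in> borel_measurable M"
    and null1: "null_in_prob M (\<lambda>N \<omega>. (real (Suc N) * \<bar>m N\<bar>) * Y N \<omega>)"
    and null2: "null_in_prob M (\<lambda>N \<omega>. (real (Suc N) * (v N + 1 / (real (Suc N))\<^sup>2)) * (Y N \<omega>)\<^sup>2)"
  shows "null_in_prob M (\<lambda>N \<omega>. \<Sum>j<Suc N. A N j \<omega> * \<gamma> N (W (grid T N (Suc j)) \<omega> - W (grid T N j) \<omega>))"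
proof -
  define u where "u N = v N + 1 / (real (Suc N))\<^sup>2" for N
  have v0: "0 \<le> v N" for N
  proof -
    have "0 \<le> (LBINT w. normal_density 0 (sqrt (T / real (Suc N))) w * (\<gamma> N w)\<^sup>2)"
      by (intro integral_nonneg_AE AE_I2) simp
    then show ?thesis using mom2[of N] by (simp only: has_bochner_integral_iff)
  qed
  have u0: "0 < u N" for N unfolding u_def using v0[of N] by (intro add_nonneg_pos) auto
  have gn: "0 \<le> grid T N j" "grid T N j < grid T N (Suc j)" for N j
    using \<open>T > 0\<close> by (auto simp: grid_nonneg intro: grid_less)
  have AM [measurable]: "A N j \<in> borel_measurable M" if "j < Suc N" for N j
    using measurable_F_M[OF A[OF that] gn(1)] .
  define g where "g N j \<omega> = \<gamma> N (W (grid T N (Suc j)) \<omega> - W (grid T N j) \<omega>) - m N" for N j \<omega>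
  have gF: "g N j \<in> borel_measurable (F (grid T N (Suc j)))" for N j
  proof -
    have [measurable]: "W (grid T N (Suc j)) \<in> borel_measurable (F (grid T N (Suc j)))"
      "W (grid T N j) \<in> borel_measurable (F (grid T N (Suc j)))"
      using gn(1)[of N j] gn(1)[of N "Suc j"] less_imp_le[OF gn(2)[of N j]] by (auto intro!: W_F)
    show ?thesis unfolding g_def by measurable
  qed
  have gM [measurable]: "g N j \<in> borel_measurable M" for N j
    using measurable_F_M[OF gF gn(1)] .
  have martingale_part: "null_in_prob M (\<lambda>N \<omega>. \<Sum>j<Suc N. A N j \<omega> * g N j \<omega>)"
  proof (rule null_in_probI)
    fix \<epsilon> \<eta> :: real assume e: "\<epsilon> > 0" "\<eta> > 0"
    define \<delta> where "\<delta> = \<epsilon>\<^sup>2 * \<eta> / 2"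
    have \<delta>: "\<delta> > 0" "\<delta> / \<epsilon>\<^sup>2 = \<eta> / 2" using e by (auto simp: \<delta>_def)
    have "\<eta> / 2 > 0" using e by simp
    from null_in_probD[OF null2 \<delta>(1) this]
    show "\<forall>\<^sub>F N in sequentially. prob {\<omega>\<in>space M. \<bar>\<Sum>j<Suc N. A N j \<omega> * g N j \<omega>\<bar> > \<epsilon>} \<le> \<eta>"
    proof eventually_elim
      case (elim N)
      have "(\<lambda>\<omega>. \<bar>\<Sum>j<k. A N j \<omega> * g N j \<omega>\<bar>) \<in> borel_measurable M" if "k \<in> {..Suc N}" for k
        using that by (intro borel_measurable_abs borel_measurable_sum borel_measurable_times AM gM) auto
      then have "{\<omega>\<in>space M. \<bar>\<Sum>j<k. A N j \<omega> * g N j \<omega>\<bar> > \<epsilon>} \<in> events" if "k \<in> {..Suc N}" for k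
        using that by (intro borel_measurable_less borel_measurable_const) simp
      then have "{\<omega>\<in>space M. \<exists>k\<in>{..Suc N}. \<bar>\<Sum>j<k. A N j \<omega> * g N j \<omega>\<bar> > \<epsilon>} \<in> events"
        by (rule sets.sets_Collect_finite_Ex[OF _ finite_atMost])
      then have ev: "{\<omega>\<in>space M. \<exists>k\<le>Suc N. \<bar>\<Sum>j<k. A N j \<omega> * g N j \<omega>\<bar> > \<epsilon>} \<in> events"
        by (simp only: Bex_def atMost_iff)
      have "prob {\<omega>\<in>space M. \<bar>\<Sum>j<Suc N. A N j \<omega> * g N j \<omega>\<bar> > \<epsilon>}
        \<le> prob {\<omega>\<in>space M. \<exists>k\<le>Suc N. \<bar>\<Sum>j<k. A N j \<omega> * g N j \<omega>\<bar> > \<epsilon>}"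
        by (rule finite_measure_mono[OF _ ev]) blast
      also have "\<dots> \<le> prob {\<omega>\<in>space M. (\<Sum>j<Suc N. (A N j \<omega>)\<^sup>2 * u N) > \<delta>} + \<delta> / \<epsilon>\<^sup>2"
      proof (rule discrete_lenglart[where Fs="\<lambda>j. F (grid T N j)"])
        show "subalgebra M (F (grid T N j))" for j using subalgebra_F gn by auto
        show "sets (F (grid T N i)) \<subseteq> sets (F (grid T N j))" if "i \<le> j" for i j
          using that grid_mono[of T i j N] gn(1)[of N i] \<open>T > 0\<close> by (intro sets_F_mono) auto
        show "A N j \<in> borel_measurable (F (grid T N j))" if "j < Suc N" for j using A that by simp
        show "g N j \<in> borel_measurable (F (grid T N (Suc j)))" for j by (rule gF)
        show "indep_var borel V borel (g N j)" if "V \<in> borel_measurable (F (grid T N j))" for j V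
          using indep_var_compose[OF W_increment_indep[OF gn that], of "\<lambda>x. x" borel "\<lambda>w. \<gamma> N w - m N" borel]
          by (simp add: comp_def g_def[abs_def])
        fix j
        note dist = W_increment_distributed[OF gn[of N j], unfolded grid_step]
        have i1: "integrable M (\<lambda>\<omega>. \<gamma> N (W (grid T N (Suc j)) \<omega> - W (grid T N j) \<omega>))"
          using distributed_integrable[OF dist, of "\<gamma> N"] mom1[of N] by (auto simp: has_bochner_integral_iff)
        have e1: "expectation (\<lambda>\<omega>. \<gamma> N (W (grid T N (Suc j)) \<omega> - W (grid T N j) \<omega>)) = m N"
          using distributed_integral[OF dist, of "\<gamma> N"] mom1[of N] by (auto simp: has_bochner_integral_iff)
        have i2: "integrable M (\<lambda>\<omega>. (\<gamma> N (W (grid T N (Suc j)) \<omega> - W (grid T N j) \<omega>))\<^sup>2)"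
          using distributed_integrable[OF dist, of "\<lambda>w. (\<gamma> N w)\<^sup>2"] mom2[of N] by (auto simp: has_bochner_integral_iff)
        have e2: "expectation (\<lambda>\<omega>. (\<gamma> N (W (grid T N (Suc j)) \<omega> - W (grid T N j) \<omega>))\<^sup>2) = v N"
          using distributed_integral[OF dist, of "\<lambda>w. (\<gamma> N w)\<^sup>2"] mom2[of N] by (auto simp: has_bochner_integral_iff)
        have sq: "(g N j \<omega>)\<^sup>2 = (\<gamma> N (W (grid T N (Suc j)) \<omega> - W (grid T N j) \<omega>))\<^sup>2
            - 2 * m N * \<gamma> N (W (grid T N (Suc j)) \<omega> - W (grid T N j) \<omega>) + (m N)\<^sup>2" for \<omega>
          by (simp add: g_def power2_diff)
        show "integrable M (\<lambda>\<omega>. (g N j \<omega>)\<^sup>2)" unfolding sq using i1 i2 by simp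
        show "expectation (g N j) = 0" unfolding g_def[abs_def] using i1 e1 by (simp add: prob_space)
        have "expectation (\<lambda>\<omega>. (g N j \<omega>)\<^sup>2) = v N - (m N)\<^sup>2"
          unfolding sq using i1 i2 e1 e2 by (simp add: prob_space power2_eq_square)
        also have "\<dots> \<le> u N" unfolding u_def
          by (simp add: add_increasing2 order_trans[OF _ zero_le_power2] diff_le_eq)
        finally show "expectation (\<lambda>\<omega>. (g N j \<omega>)\<^sup>2) \<le> u N" .
        show "0 < u N" by (rule u0)
      qed (use e \<delta> in auto)
      also have "prob {\<omega>\<in>space M. (\<Sum>j<Suc N. (A N j \<omega>)\<^sup>2 * u N) > \<delta>}
        \<le> prob {\<omega>\<in>space M. \<bar>(real (Suc N) * u N) * (Y N \<omega>)\<^sup>2\<bar> > \<delta>}"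
      proof (rule finite_measure_mono)
        show "{\<omega>\<in>space M. (\<Sum>j<Suc N. (A N j \<omega>)\<^sup>2 * u N) > \<delta>} \<subseteq> {\<omega>\<in>space M. \<bar>(real (Suc N) * u N) * (Y N \<omega>)\<^sup>2\<bar> > \<delta>}"
        proof safe
          fix \<omega> assume \<omega>: "\<omega> \<in> space M" "\<delta> < (\<Sum>j<Suc N. (A N j \<omega>)\<^sup>2 * u N)"
          have "(\<Sum>j<Suc N. (A N j \<omega>)\<^sup>2 * u N) \<le> (\<Sum>j<Suc N. (Y N \<omega>)\<^sup>2 * u N)"
          proof (intro sum_mono mult_right_mono)
            fix j assume "j \<in> {..<Suc N}"
            then show "(A N j \<omega>)\<^sup>2 \<le> (Y N \<omega>)\<^sup>2"
              using bound[of j N \<omega>] \<omega> by (intro abs_le_square_iff[THEN iffD1]) auto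
          qed (use u0[of N] in auto)
          also have "\<dots> = (real (Suc N) * u N) * (Y N \<omega>)\<^sup>2" by simp
          finally show "\<delta> < \<bar>(real (Suc N) * u N) * (Y N \<omega>)\<^sup>2\<bar>" using \<omega>(2) by linarith
        qed
        show "{\<omega>\<in>space M. \<bar>(real (Suc N) * u N) * (Y N \<omega>)\<^sup>2\<bar> > \<delta>} \<in> events" by measurable
      qed
      finally show ?case using elim \<delta>(2) unfolding u_def by linarith
    qed
  qed
  have "null_in_prob M (\<lambda>N \<omega>. \<Sum>j<Suc N. A N j \<omega> * m N)"
  proof (rule null_in_prob_dominated[OF null1])
    show "\<forall>\<^sub>F N in sequentially. \<forall>\<omega>\<in>space M. \<bar>\<Sum>j<Suc N. A N j \<omega> * m N\<bar> \<le> \<bar>(real (Suc N) * \<bar>m N\<bar>) * Y N \<omega>\<bar>"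
    proof (intro always_eventually allI ballI)
      fix N \<omega> assume \<omega>: "\<omega> \<in> space M"
      have "\<bar>\<Sum>j<Suc N. A N j \<omega> * m N\<bar> \<le> (\<Sum>j<Suc N. \<bar>A N j \<omega> * m N\<bar>)" by (rule sum_abs)
      also have "\<dots> \<le> (\<Sum>j<Suc N. Y N \<omega> * \<bar>m N\<bar>)"
        unfolding abs_mult using bound \<omega> by (intro sum_mono mult_right_mono) auto
      also have "\<dots> = (real (Suc N) * \<bar>m N\<bar>) * Y N \<omega>" by simp
      finally show "\<bar>\<Sum>j<Suc N. A N j \<omega> * m N\<bar> \<le> \<bar>(real (Suc N) * \<bar>m N\<bar>) * Y N \<omega>\<bar>" by linarith
    qed
  qed measurable
  from null_in_prob_add[OF martingale_part this]
  have "null_in_prob M (\<lambda>N \<omega>. (\<Sum>j<Suc N. A N j \<omega> * g N j \<omega>) + (\<Sum>j<Suc N. A N j \<omega> * m N))"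
    by (auto intro!: borel_measurable_sum borel_measurable_times AM gM simp del: sum.lessThan_Suc)
  then show ?thesis
    by (simp add: g_def sum.distrib[symmetric] algebra_simps del: sum.lessThan_Suc)
qed

end

section \<open>The explicit geometric Brownian motion\<close>

context brownian
begin

lemma Bseq_grid_Max:
  fixes h :: "real \<Rightarrow> real"
  assumes "continuous_on {0..T} h" "T > 0"
  shows "Bseq (\<lambda>N. Max ((\<lambda>k. \<bar>h (grid T N k)\<bar>) ` {..Suc N}))"
proof -
  have "bounded (h ` {0..T})"
    using assms by (intro compact_imp_bounded compact_continuous_image) auto
  then obtain B where B: "B > 0" "\<And>t. t \<in> {0..T} \<Longrightarrow> \<bar>h t\<bar> \<le> B"
    by (auto simp: bounded_pos)
  show ?thesis
  proof (rule BseqI'[where K=B])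
    fix N
    have "\<bar>h (grid T N k)\<bar> \<le> B" if "k \<le> Suc N" for k
      using B(2)[of "grid T N k"] that grid_nonneg[of T N k] grid_le[of T k N] assms by auto
    then have "Max ((\<lambda>k. \<bar>h (grid T N k)\<bar>) ` {..Suc N}) \<le> B" by (subst Max_le_iff) auto
    moreover have "\<bar>h (grid T N 0)\<bar> \<le> Max ((\<lambda>k. \<bar>h (grid T N k)\<bar>) ` {..Suc N})"
      by (intro Max_ge) auto
    ultimately have "\<bar>Max ((\<lambda>k. \<bar>h (grid T N k)\<bar>) ` {..Suc N})\<bar> \<le> B" by linarith
    then show "norm (Max ((\<lambda>k. \<bar>h (grid T N k)\<bar>) ` {..Suc N})) \<le> B" by (simp only: real_norm_def)
  qed
qed

lemma drift_remainder_tendsto: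
  fixes z x :: "real \<Rightarrow> real"
  assumes z: "continuous_on {0..T} z" and x: "continuous_on {0..T} x" and "T > 0"
  shows "(\<lambda>N. \<Sum>j<Suc N. z (grid T N (Suc j)) *
      ((LBINT s:{0..grid T N (Suc j)}. x s) - (LBINT s:{0..grid T N j}. x s) - x (grid T N j) * (T / real (Suc N)))) \<longlonglongrightarrow> 0"
    (is "?S \<longlonglongrightarrow> 0")
proof (rule tendstoI)
  fix \<epsilon> :: real assume "\<epsilon> > 0"
  have "bounded (z ` {0..T})"
    using assms by (intro compact_imp_bounded compact_continuous_image) auto
  then obtain B where B: "B > 0" "\<And>t. t \<in> {0..T} \<Longrightarrow> \<bar>z t\<bar> \<le> B"
    by (auto simp: bounded_pos)
  define e where "e = \<epsilon> / (2 * B * T)"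
  have e: "e > 0" "B * e * T < \<epsilon>" using \<open>\<epsilon> > 0\<close> B \<open>T > 0\<close> by (auto simp: e_def field_simps)
  from grid_oscillation[OF \<open>T > 0\<close> x e(1)]
  show "\<forall>\<^sub>F N in sequentially. dist (?S N) 0 < \<epsilon>"
  proof eventually_elim
    case (elim N)
    have bound: "\<bar>(LBINT s:{0..grid T N (Suc j)}. x s) - (LBINT s:{0..grid T N j}. x s) - x (grid T N j) * (T / real (Suc N))\<bar>
      \<le> e * (T / real (Suc N))" if "j < Suc N" for j
    proof -
      let ?a = "grid T N j" and ?b = "grid T N (Suc j)"
      have ab: "0 \<le> ?a" "?a \<le> ?b" "?b \<le> T"
        using \<open>T > 0\<close> that grid_nonneg[of T N j] grid_mono[of T j "Suc j" N] grid_le[of T "Suc j" N] by auto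
      have cont: "continuous_on {c..d} x" if "0 \<le> c" "d \<le> T" for c d
        using continuous_on_subset[OF x] that by auto
      have eq: "(LBINT s:{0..c}. x s) = integral {0..c} x" if "c \<le> T" for c
        using that by (intro set_borel_integral_eq_integral borel_integrable_atLeastAtMost' cont) auto
      have "integral {0..?a} x + integral {?a..?b} x = integral {0..?b} x"
        using ab by (intro Henstock_Kurzweil_Integration.integral_combine integrable_continuous_interval cont) auto
      moreover have "integral {?a..?b} (\<lambda>s. x s - x ?a) = integral {?a..?b} x - (?b - ?a) * x ?a"
        using ab by (subst Henstock_Kurzweil_Integration.integral_diff) (auto intro!: integrable_continuous_interval cont)
      moreover have "norm (integral {?a..?b} (\<lambda>s. x s - x ?a)) \<le> e * (?b - ?a)"
      proof (rule integral_bound)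
        show "continuous_on {?a..?b} (\<lambda>s. x s - x ?a)"
          using ab by (intro continuous_intros cont) auto
        show "norm (x s - x ?a) \<le> e" if "s \<in> {?a..?b}" for s
          using elim \<open>j < Suc N\<close> that by force
      qed fact
      ultimately show ?thesis using eq[of ?a] eq[of ?b] ab grid_step[of T N j]
        by (simp add: mult.commute)
    qed
    have "\<bar>?S N\<bar> \<le> (\<Sum>j<Suc N. B * (e * (T / real (Suc N))))"
    proof (rule order_trans[OF sum_abs], rule sum_mono)
      fix j assume "j \<in> {..<Suc N}"
      then show "\<bar>z (grid T N (Suc j)) *
      ((LBINT s:{0..grid T N (Suc j)}. x s) - (LBINT s:{0..grid T N j}. x s) - x (grid T N j) * (T / real (Suc N)))\<bar> \<le> B * (e * (T / real (Suc N)))"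
        unfolding abs_mult
        using B bound[of j] grid_nonneg[of T N "Suc j"] grid_le[of T "Suc j" N] \<open>T > 0\<close>
        by (intro mult_mono) auto
    qed
    also have "\<dots> = B * e * T" by simp
    finally show ?case using e by simp
  qed
qed

text \<open>
  Exact summation by parts for \<open>z (x + \<delta>)\<close>, where \<open>x + \<delta>\<close> is the process whose stochastic
  integral \<open>i\<close> has been replaced by its Riemann sum. The first sum contains the factor whose mean and variance
  are of second order in the step \<open>h\<close> when \<open>r = \<mu> - \<sigma>\<^sup>2 / 2\<close>; the second is small because \<open>\<delta>\<close>
  is; the third is the error of the Riemann sum of the drift.
\<close>

lemma discrete_product_rule:
  fixes z x i \<delta> w a :: "nat \<Rightarrow> real" and h \<mu> \<sigma> r :: real
  defines "\<delta> \<equiv> \<lambda>k. (\<Sum>j<k. \<sigma> * x j * (w (Suc j) - w j)) - i k"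
  assumes x: "\<And>k. k \<le> n \<Longrightarrow> x k = x0 + a k + i k"
    and z: "\<And>k. k < n \<Longrightarrow> z (Suc k) = z k * exp (- r * h - \<sigma> * (w (Suc k) - w k))"
    and "k \<le> n"
  shows "z k * (x k + \<delta> k) - z 0 * (x 0 + \<delta> 0) =
    (\<Sum>j<k. z j * x j * (exp (- r * h - \<sigma> * (w (Suc j) - w j)) * (1 + \<mu> * h + \<sigma> * (w (Suc j) - w j)) - 1))
    + (\<Sum>j<k. z j * \<delta> j * (exp (- r * h - \<sigma> * (w (Suc j) - w j)) - 1))
    + (\<Sum>j<k. z (Suc j) * (a (Suc j) - a j - \<mu> * x j * h))"
  using \<open>k \<le> n\<close>
proof (induction k)
  case 0 then show ?case by simp
next
  case (Suc k)
  define E where "E = exp (- r * h - \<sigma> * (w (Suc k) - w k))"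
  define d where "d = w (Suc k) - w k"
  have xs: "x (Suc k) + \<delta> (Suc k) = x k + \<delta> k + (a (Suc k) - a k) + \<sigma> * x k * d"
    using Suc.prems x[of k] x[of "Suc k"] by (simp add: \<delta>_def d_def)
  have zs: "z (Suc k) = z k * E" using z[of k] Suc.prems by (simp add: E_def)
  have "z (Suc k) * (x (Suc k) + \<delta> (Suc k)) = z k * (x k + \<delta> k)
     + z k * x k * (E * (1 + \<mu> * h + \<sigma> * d) - 1) + z k * \<delta> k * (E - 1)
     + z (Suc k) * (a (Suc k) - a k - \<mu> * x k * h)"
    unfolding xs zs by (simp add: algebra_simps)
  with Suc show ?case by (simp add: E_def d_def)
qed

text \<open>
  It suffices that \<open>Z\<^sub>t X\<^sub>t\<close> with \<open>Z\<^sub>t = exp (- r t - \<sigma> W\<^sub>t)\<close> is almost surely constant. This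
  constancy is where \<open>r = \<mu> - \<sigma>\<^sup>2 / 2\<close> enters: exactly for this value the mean of
  \<open>exp (- r h - \<sigma> w) (1 + \<mu> h + \<sigma> w) - 1\<close> under the normal distribution with variance \<open>h\<close> has derivative 0
  at \<open>h = 0\<close>, so that \<open>N\<close> such terms with \<open>h = T / N\<close> are negligible.
\<close>

lemma gbm_explicit:
  assumes gbm: "geometric_brownian_motion M F W \<mu> \<sigma> x X" and "T \<ge> 0"
  shows "AE \<omega> in M. X T \<omega> = x * exp ((\<mu> - \<sigma>\<^sup>2 / 2) * T + \<sigma> * W T \<omega>)"
proof (cases "T = 0")
  case True
  from gbm have "AE \<omega> in M. X 0 \<omega> = x" by (simp add: geometric_brownian_motion_def)
  with W_0 show ?thesis by eventually_elim (simp add: True)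
next
  case False
  then have T: "T > 0" using \<open>T \<ge> 0\<close> by simp
  define r where "r = \<mu> - \<sigma>\<^sup>2 / 2"
  have X: "continuous_adapted M F X" and X0: "AE \<omega> in M. X 0 \<omega> = x"
    using gbm by (auto simp: geometric_brownian_motion_def)
  have "\<exists>I. is_ito_integral M F W (\<lambda>s \<omega>. \<sigma> * X s \<omega>) I \<and>
        (\<forall>t\<ge>0. AE \<omega> in M. X t \<omega> = X 0 \<omega> + (LBINT s:{0..t}. \<mu> * X s \<omega>) + I t \<omega>)"
    using gbm unfolding geometric_brownian_motion_def by (elim conjE)
  then obtain I where ito: "is_ito_integral M F W (\<lambda>s \<omega>. \<sigma> * X s \<omega>) I"
    and sde: "\<And>t. t \<ge> 0 \<Longrightarrow> AE \<omega> in M. X t \<omega> = X 0 \<omega> + (LBINT s:{0..t}. \<mu> * X s \<omega>) + I t \<omega>"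
    by blast
  define Z where "Z t \<omega> = exp (- (r * t + \<sigma> * W t \<omega>))" for t \<omega>
  have gn: "0 \<le> grid T N k" for N k using T by (simp add: grid_nonneg)
  have XM: "X t \<in> borel_measurable M" if "t \<ge> 0" for t by (rule adapted_M[OF X that])
  have ZF: "Z t \<in> borel_measurable (F t)" if "t \<ge> 0" for t
    unfolding Z_def using W_F[OF that order_refl] by measurable
  have ZM: "Z t \<in> borel_measurable M" if "t \<ge> 0" for t
    by (rule measurable_F_M[OF ZF[OF that] that])
  have contX: "continuous_on {0..T} (\<lambda>t. X t \<omega>)" if "\<omega> \<in> space M" for \<omega>
    using continuous_on_subset[OF continuous_adaptedD[OF X that]] by auto
  have contW: "continuous_on {0..T} (\<lambda>t. W t \<omega>)" if "\<omega> \<in> space M" for \<omega>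
    using continuous_on_subset[OF continuous_adaptedD[OF W_continuous_adapted that]] by auto
  have contZ: "continuous_on {0..T} (\<lambda>t. Z t \<omega>)" if "\<omega> \<in> space M" for \<omega>
    unfolding Z_def by (intro continuous_intros contW that)
  define D where "D = riemann_error (\<lambda>s \<omega>. \<sigma> * X s \<omega>) I T"
  have DM: "D N k \<in> borel_measurable M" for N k
    unfolding D_def by (rule measurable_riemann_error[OF ito T])
  have DF: "D N k \<in> borel_measurable (F (grid T N k))" for N k
  proof -
    have "I (grid T N k) \<in> borel_measurable (F (grid T N k))"
      using ito gn[of N k] by (auto simp: is_ito_integral_def)
    moreover have "X (grid T N j) \<in> borel_measurable (F (grid T N k))"
      "W (grid T N j) \<in> borel_measurable (F (grid T N k))" if "j \<le> k" for j
      using that gn grid_mono[of T j k N] T by (auto intro!: adapted_F[OF X] W_F)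
    ultimately show ?thesis
      unfolding D_def riemann_error_def[abs_def]
      by (intro borel_measurable_diff borel_measurable_sum borel_measurable_times borel_measurable_const) auto
  qed
  define Dmax where "Dmax N \<omega> = Max ((\<lambda>k. \<bar>D N k \<omega>\<bar>) ` {..Suc N})" for N \<omega>
  have Dmax_null: "null_in_prob M Dmax"
    using riemann_error_null[OF ito T] by (simp add: Dmax_def[abs_def] D_def)
  have DmaxM [measurable]: "Dmax N \<in> borel_measurable M" for N
    unfolding Dmax_def by (intro borel_measurable_Max borel_measurable_abs DM) auto
  have Dmax: "\<bar>D N k \<omega>\<bar> \<le> Dmax N \<omega>" if "k \<le> Suc N" for N k \<omega>
    unfolding Dmax_def using that by (intro Max_ge) auto
  define Zmax where "Zmax N \<omega> = Max ((\<lambda>k. \<bar>Z (grid T N k) \<omega>\<bar>) ` {..Suc N})" for N \<omega>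
  have ZmaxM [measurable]: "Zmax N \<in> borel_measurable M" for N
    unfolding Zmax_def by (intro borel_measurable_Max borel_measurable_abs ZM gn) auto
  have Zmax: "\<bar>Z (grid T N k) \<omega>\<bar> \<le> Zmax N \<omega>" if "k \<le> Suc N" for N k \<omega>
    unfolding Zmax_def using that by (intro Max_ge) auto
  have Zmax0: "0 \<le> Zmax N \<omega>" for N \<omega>
    using Zmax[of 0 N \<omega>] by simp
  have Zmax_B: "Bseq (\<lambda>N. Zmax N \<omega>)" if "\<omega> \<in> space M" for \<omega>
    unfolding Zmax_def by (rule Bseq_grid_Max[OF contZ[OF that] T])
  define Pmax where "Pmax N \<omega> = Max ((\<lambda>k. \<bar>Z (grid T N k) \<omega> * X (grid T N k) \<omega>\<bar>) ` {..Suc N})" for N \<omega>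
  have PmaxM [measurable]: "Pmax N \<in> borel_measurable M" for N
    unfolding Pmax_def by (intro borel_measurable_Max borel_measurable_abs borel_measurable_times ZM XM gn) auto
  have Pmax: "\<bar>Z (grid T N k) \<omega> * X (grid T N k) \<omega>\<bar> \<le> Pmax N \<omega>" if "k \<le> Suc N" for N k \<omega>
    unfolding Pmax_def using that by (intro Max_ge) auto
  have Pmax_B: "Bseq (\<lambda>N. Pmax N \<omega>)" if "\<omega> \<in> space M" for \<omega>
    unfolding Pmax_def
    by (rule Bseq_grid_Max[OF _ T]) (intro continuous_on_mult contZ contX that)

  define a0 where "a0 h = exp (- r * h) * (1 + \<mu> * h)" for h
  define a1 where "a1 h = exp (- r * h) * \<sigma>" for h
  define mom where "mom b0 b1 h = (b0 h - b1 h * \<sigma> * h) * exp (\<sigma>\<^sup>2 * h / 2) - 1"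
    for b0 b1 :: "real \<Rightarrow> real" and h
  define var where "var b0 b1 h = ((b0 h)\<^sup>2 - 4 * b0 h * b1 h * \<sigma> * h + (b1 h)\<^sup>2 * (h + 4 * \<sigma>\<^sup>2 * h\<^sup>2)) * exp (2 * \<sigma>\<^sup>2 * h)
        - 2 * (b0 h - b1 h * \<sigma> * h) * exp (\<sigma>\<^sup>2 * h / 2) + 1" for b0 b1 :: "real \<Rightarrow> real" and h
  define \<gamma> where "\<gamma> b0 b1 N w = exp (- \<sigma> * w) * (b0 (T / real (Suc N)) + b1 (T / real (Suc N)) * w) - 1"
    for b0 b1 :: "real \<Rightarrow> real" and N w
  have \<gamma>M: "\<gamma> b0 b1 N \<in> borel_measurable borel" for b0 b1 N
    unfolding \<gamma>_def by measurable
  have step_pos: "0 < sqrt (T / real (Suc N))" and step_sq: "(sqrt (T / real (Suc N)))\<^sup>2 = T / real (Suc N)" for N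
    using T by auto
  have mom1: "has_bochner_integral lborel (\<lambda>w. normal_density 0 (sqrt (T / real (Suc N))) w * \<gamma> b0 b1 N w)
      (mom b0 b1 (T / real (Suc N)))" for b0 b1 N
    using gaussian_affine_exp_moments(1)[OF step_pos, of N \<sigma> "b0 (T / real (Suc N))" "b1 (T / real (Suc N))"]
    unfolding step_sq \<gamma>_def mom_def .
  have mom2: "has_bochner_integral lborel (\<lambda>w. normal_density 0 (sqrt (T / real (Suc N))) w * (\<gamma> b0 b1 N w)\<^sup>2)
      (var b0 b1 (T / real (Suc N)))" for b0 b1 N
    using gaussian_affine_exp_moments(2)[OF step_pos, of N \<sigma> "b0 (T / real (Suc N))" "b1 (T / real (Suc N))"]
    unfolding step_sq \<gamma>_def var_def .
  \<comment> \<open>Only the values and first derivatives at step 0 of the mean and variance of one term matter, since there are \<open>Suc N\<close> terms with step \<open>T / Suc N\<close>.\<close>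
  have inv: "(\<lambda>N. real (Suc N) * (1 / (real (Suc N))\<^sup>2)) \<longlonglongrightarrow> 0"
    using LIMSEQ_inverse_real_of_nat by (simp add: power2_eq_square inverse_eq_divide)
  have "((mom a0 a1) has_real_derivative (- r + \<mu> - \<sigma>\<^sup>2 + \<sigma>\<^sup>2 / 2)) (at 0)"
    unfolding mom_def[abs_def] a0_def a1_def by (auto intro!: derivative_eq_intros simp: power2_eq_square)
  then have "((mom a0 a1) has_real_derivative 0) (at 0)" by (simp add: r_def)
  from tendsto_scaled_derivative[OF this _ T]
  have lim_m1: "(\<lambda>N. real (Suc N) * mom a0 a1 (T / real (Suc N))) \<longlonglongrightarrow> 0"
    by (simp add: mom_def a0_def a1_def)
  have "((var a0 a1) has_real_derivative (2 * (\<mu> - r) - 4 * \<sigma>\<^sup>2 + \<sigma>\<^sup>2 + 2 * \<sigma>\<^sup>2 - 2 * (\<mu> - r - \<sigma>\<^sup>2 + \<sigma>\<^sup>2 / 2))) (at 0)"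
    unfolding var_def[abs_def] a0_def a1_def by (auto intro!: derivative_eq_intros simp: power2_eq_square algebra_simps)
  then have "((var a0 a1) has_real_derivative 0) (at 0)" by (simp add: r_def)
  from tendsto_scaled_derivative[OF this _ T]
  have "(\<lambda>N. real (Suc N) * var a0 a1 (T / real (Suc N))) \<longlonglongrightarrow> 0"
    by (simp add: var_def a0_def a1_def)
  from tendsto_add[OF this inv]
  have lim_v1: "(\<lambda>N. real (Suc N) * (var a0 a1 (T / real (Suc N)) + 1 / (real (Suc N))\<^sup>2)) \<longlonglongrightarrow> 0"
    by (simp only: distrib_left add_0)
  \<comment> \<open>The factor \<open>exp (- r h - \<sigma> w) - 1\<close> has mean and variance of first order only; it is multiplied by the error of the Riemann sum.\<close>
  define c0 where "c0 h = exp (- r * h)" for h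
  define c1 where "c1 h = (0::real)" for h :: real
  have "((mom c0 c1) has_real_derivative (- r + \<sigma>\<^sup>2 / 2)) (at 0)"
    unfolding mom_def[abs_def] c0_def c1_def by (auto intro!: derivative_eq_intros simp: power2_eq_square)
  from tendsto_scaled_derivative[OF this _ T]
  have lim_m2: "(\<lambda>N. real (Suc N) * mom c0 c1 (T / real (Suc N))) \<longlonglongrightarrow> T * (- r + \<sigma>\<^sup>2 / 2)"
    by (simp add: mom_def c0_def c1_def)
  have "((var c0 c1) has_real_derivative (- 2 * r + 2 * \<sigma>\<^sup>2 - 2 * (- r + \<sigma>\<^sup>2 / 2))) (at 0)"
    unfolding var_def[abs_def] c0_def c1_def by (auto intro!: derivative_eq_intros simp: power2_eq_square algebra_simps)
  from tendsto_scaled_derivative[OF this _ T]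
  have "(\<lambda>N. real (Suc N) * var c0 c1 (T / real (Suc N))) \<longlonglongrightarrow> T * (- 2 * r + 2 * \<sigma>\<^sup>2 - 2 * (- r + \<sigma>\<^sup>2 / 2))"
    by (simp add: var_def c0_def c1_def)
  from tendsto_add[OF this inv]
  have lim_v2: "(\<lambda>N. real (Suc N) * (var c0 c1 (T / real (Suc N)) + 1 / (real (Suc N))\<^sup>2)) \<longlonglongrightarrow> T * (- 2 * r + 2 * \<sigma>\<^sup>2 - 2 * (- r + \<sigma>\<^sup>2 / 2))"
    by (simp only: distrib_left add_0_right)

  let ?dW = "\<lambda>N j \<omega>. W (grid T N (Suc j)) \<omega> - W (grid T N j) \<omega>"
  define T1 where "T1 N \<omega> = (\<Sum>j<Suc N. Z (grid T N j) \<omega> * X (grid T N j) \<omega> * \<gamma> a0 a1 N (?dW N j \<omega>))" for N \<omega>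
  define T2 where "T2 N \<omega> = (\<Sum>j<Suc N. Z (grid T N j) \<omega> * D N j \<omega> * \<gamma> c0 c1 N (?dW N j \<omega>))" for N \<omega>
  define T3 where "T3 N \<omega> = (\<Sum>j<Suc N. Z (grid T N (Suc j)) \<omega> *
      ((LBINT s:{0..grid T N (Suc j)}. \<mu> * X s \<omega>) - (LBINT s:{0..grid T N j}. \<mu> * X s \<omega>)
        - \<mu> * X (grid T N j) \<omega> * (T / real (Suc N))))" for N \<omega>
  have \<gamma>W [measurable]: "(\<lambda>\<omega>. \<gamma> b0 b1 N (?dW N j \<omega>)) \<in> borel_measurable M" for b0 b1 N j
    using \<gamma>M W_M[OF gn] by measurable
  have T1M: "T1 N \<in> borel_measurable M" and T2M: "T2 N \<in> borel_measurable M" for N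
    unfolding T1_def[abs_def] T2_def[abs_def]
    by (intro borel_measurable_sum borel_measurable_times ZM XM gn DM \<gamma>W)+
  have T3M: "T3 N \<in> borel_measurable M" for N
    unfolding T3_def[abs_def]
    by (intro borel_measurable_sum borel_measurable_times borel_measurable_diff ZM XM gn measurable_time_integral[OF X] borel_measurable_const)
  have T1_null: "null_in_prob M T1"
    unfolding T1_def[abs_def]
  proof (rule array_null_in_prob[OF T, where Y=Pmax and m="\<lambda>N. mom a0 a1 (T / real (Suc N))" and v="\<lambda>N. var a0 a1 (T / real (Suc N))"])
    show "(\<lambda>\<omega>. Z (grid T N j) \<omega> * X (grid T N j) \<omega>) \<in> borel_measurable (F (grid T N j))" for N j
      by (intro borel_measurable_times ZF gn adapted_F[OF X] order_refl)
    show "null_in_prob M (\<lambda>N \<omega>. (real (Suc N) * \<bar>mom a0 a1 (T / real (Suc N))\<bar>) * Pmax N \<omega>)"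
    proof (rule null_in_prob_pointwise)
      fix \<omega> assume "\<omega> \<in> space M"
      have "Zfun (\<lambda>N. real (Suc N) * \<bar>mom a0 a1 (T / real (Suc N))\<bar>) sequentially"
        using tendsto_rabs[OF lim_m1] by (simp add: tendsto_Zfun_iff abs_mult)
      from bounded_bilinear.Zfun_prod_Bfun[OF bounded_bilinear_mult this, of "\<lambda>N. Pmax N \<omega>"]
      show "(\<lambda>N. (real (Suc N) * \<bar>mom a0 a1 (T / real (Suc N))\<bar>) * Pmax N \<omega>) \<longlonglongrightarrow> 0"
        using Pmax_B[OF \<open>\<omega> \<in> space M\<close>] by (simp add: tendsto_Zfun_iff)
    qed measurable
    show "null_in_prob M (\<lambda>N \<omega>. (real (Suc N) * (var a0 a1 (T / real (Suc N)) + 1 / (real (Suc N))\<^sup>2)) * (Pmax N \<omega>)\<^sup>2)"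
    proof (rule null_in_prob_pointwise)
      fix \<omega> assume "\<omega> \<in> space M"
      have "Zfun (\<lambda>N. real (Suc N) * (var a0 a1 (T / real (Suc N)) + 1 / (real (Suc N))\<^sup>2)) sequentially"
        using lim_v1 by (simp only: tendsto_Zfun_iff diff_0_right)
      from bounded_bilinear.Zfun_prod_Bfun[OF bounded_bilinear_mult this, of "\<lambda>N. (Pmax N \<omega>)\<^sup>2"]
      show "(\<lambda>N. (real (Suc N) * (var a0 a1 (T / real (Suc N)) + 1 / (real (Suc N))\<^sup>2)) * (Pmax N \<omega>)\<^sup>2) \<longlonglongrightarrow> 0"
        using Bseq_mult[OF Pmax_B[OF \<open>\<omega> \<in> space M\<close>] Pmax_B[OF \<open>\<omega> \<in> space M\<close>]]
        by (simp only: tendsto_Zfun_iff diff_0_right power2_eq_square)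
    qed measurable
  qed (use \<gamma>M mom1 mom2 Pmax in auto)
  have T2_null: "null_in_prob M T2"
    unfolding T2_def[abs_def]
  proof (rule array_null_in_prob[OF T, where Y="\<lambda>N \<omega>. Zmax N \<omega> * Dmax N \<omega>" and m="\<lambda>N. mom c0 c1 (T / real (Suc N))" and v="\<lambda>N. var c0 c1 (T / real (Suc N))"])
    show "(\<lambda>\<omega>. Z (grid T N j) \<omega> * D N j \<omega>) \<in> borel_measurable (F (grid T N j))" for N j
      by (intro borel_measurable_times ZF gn DF)
    show "\<bar>Z (grid T N j) \<omega> * D N j \<omega>\<bar> \<le> Zmax N \<omega> * Dmax N \<omega>" if "j < Suc N" for N j \<omega>
      unfolding abs_mult using that Zmax Dmax Zmax0 by (intro mult_mono) auto
    have "null_in_prob M (\<lambda>N \<omega>. (real (Suc N) * \<bar>mom c0 c1 (T / real (Suc N))\<bar> * Zmax N \<omega>) * Dmax N \<omega>)"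
    proof (rule null_in_prob_mult_bounded[OF Dmax_null])
      fix \<omega> assume "\<omega> \<in> space M"
      have "Bseq (\<lambda>N. real (Suc N) * \<bar>mom c0 c1 (T / real (Suc N))\<bar>)"
        using convergent_imp_Bseq[OF convergentI[OF tendsto_rabs[OF lim_m2]]] by (simp add: abs_mult)
      then show "Bseq (\<lambda>N. real (Suc N) * \<bar>mom c0 c1 (T / real (Suc N))\<bar> * Zmax N \<omega>)"
        by (rule Bseq_mult[OF _ Zmax_B[OF \<open>\<omega> \<in> space M\<close>]])
    qed measurable
    then show "null_in_prob M (\<lambda>N \<omega>. (real (Suc N) * \<bar>mom c0 c1 (T / real (Suc N))\<bar>) * (Zmax N \<omega> * Dmax N \<omega>))"
      by (simp only: mult.assoc)
    have "null_in_prob M (\<lambda>N \<omega>. (real (Suc N) * (var c0 c1 (T / real (Suc N)) + 1 / (real (Suc N))\<^sup>2) * (Zmax N \<omega> * Zmax N \<omega>)) * (Dmax N \<omega>)\<^sup>2)"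
    proof (rule null_in_prob_mult_bounded[OF null_in_prob_power2[OF Dmax_null]])
      fix \<omega> assume "\<omega> \<in> space M"
      have "Bseq (\<lambda>N. real (Suc N) * (var c0 c1 (T / real (Suc N)) + 1 / (real (Suc N))\<^sup>2))"
        by (rule convergent_imp_Bseq[OF convergentI[OF lim_v2]])
      then show "Bseq (\<lambda>N. real (Suc N) * (var c0 c1 (T / real (Suc N)) + 1 / (real (Suc N))\<^sup>2) * (Zmax N \<omega> * Zmax N \<omega>))"
        by (rule Bseq_mult[OF _ Bseq_mult[OF Zmax_B[OF \<open>\<omega> \<in> space M\<close>] Zmax_B[OF \<open>\<omega> \<in> space M\<close>]]])
    qed measurable
    then show "null_in_prob M (\<lambda>N \<omega>. (real (Suc N) * (var c0 c1 (T / real (Suc N)) + 1 / (real (Suc N))\<^sup>2)) * (Zmax N \<omega> * Dmax N \<omega>)\<^sup>2)"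
      by (simp only: mult.assoc power2_eq_square mult.left_commute[of "Dmax _ _" "Zmax _ _"])
  qed (use \<gamma>M mom1 mom2 in auto)
  have T3_null: "null_in_prob M T3"
  proof (rule null_in_prob_pointwise[OF _ T3M])
    fix \<omega> assume \<omega>: "\<omega> \<in> space M"
    have "continuous_on {0..T} (\<lambda>s. \<mu> * X s \<omega>)" by (intro continuous_intros contX \<omega>)
    from drift_remainder_tendsto[OF contZ[OF \<omega>] this T]
    show "(\<lambda>N. T3 N \<omega>) \<longlonglongrightarrow> 0" unfolding T3_def .
  qed
  have DN_null: "null_in_prob M (\<lambda>N \<omega>. (- Z T \<omega>) * D N (Suc N) \<omega>)"
  proof (rule null_in_prob_mult_bounded)
    show "null_in_prob M (\<lambda>N. D N (Suc N))"
    proof (rule null_in_prob_dominated[OF Dmax_null DmaxM])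
      show "\<forall>\<^sub>F N in sequentially. \<forall>\<omega>\<in>space M. \<bar>D N (Suc N) \<omega>\<bar> \<le> \<bar>Dmax N \<omega>\<bar>"
        using Dmax by (intro always_eventually allI ballI) (metis abs_ge_self order_trans order_refl)
    qed
  qed (use DM ZM[of T] T in auto)
  have U_null: "null_in_prob M (\<lambda>N \<omega>. T1 N \<omega> + T2 N \<omega> + T3 N \<omega> + (- Z T \<omega>) * D N (Suc N) \<omega>)"
    using T1M T2M T3M DM ZM[of T] T
    by (intro null_in_prob_add T1_null T2_null T3_null DN_null borel_measurable_add borel_measurable_times borel_measurable_uminus) auto
  have "null_in_prob M (\<lambda>N::nat. \<lambda>\<omega>. Z T \<omega> * X T \<omega> - Z 0 \<omega> * X 0 \<omega>)"
  proof (rule null_in_prob_cong_AE[OF U_null])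
    fix N
    have "AE \<omega> in M. \<forall>k\<in>{..Suc N}. X (grid T N k) \<omega> = X 0 \<omega> + (LBINT s:{0..grid T N k}. \<mu> * X s \<omega>) + I (grid T N k) \<omega>"
      by (intro AE_finite_allI sde gn) auto
    then show "AE \<omega> in M. Z T \<omega> * X T \<omega> - Z 0 \<omega> * X 0 \<omega> = T1 N \<omega> + T2 N \<omega> + T3 N \<omega> + (- Z T \<omega>) * D N (Suc N) \<omega>"
    proof eventually_elim
      case (elim \<omega>)
      let ?h = "T / real (Suc N)"
      have Dk: "D N k \<omega> = (\<Sum>j<k. \<sigma> * X (grid T N j) \<omega> * (W (grid T N (Suc j)) \<omega> - W (grid T N j) \<omega>)) - I (grid T N k) \<omega>" for k
        by (simp add: D_def riemann_error_def)
      have "(LBINT s:{0..0}. \<mu> * X s \<omega>) = (LBINT s. indicator {0::real} s * (\<mu> * X 0 \<omega>))"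
        unfolding set_lebesgue_integral_def
        by (intro arg_cong[where f="integral\<^sup>L lborel"] ext) (auto simp: indicator_def)
      then have "(LBINT s:{0..0}. \<mu> * X s \<omega>) = 0" by simp
      then have D0: "D N 0 \<omega> = 0"
        using elim[rule_format, of 0] Dk[of 0] by (auto simp: grid_0)
      have Zstep: "Z (grid T N (Suc k)) \<omega> = Z (grid T N k) \<omega> * exp (- r * ?h - \<sigma> * (W (grid T N (Suc k)) \<omega> - W (grid T N k) \<omega>))" for k
      proof -
        have "grid T N (Suc k) = grid T N k + ?h" using grid_step[of T N k] by simp
        then show ?thesis unfolding Z_def exp_add[symmetric] by (simp add: algebra_simps)
      qed
      have "Z (grid T N (Suc N)) \<omega> * (X (grid T N (Suc N)) \<omega> + D N (Suc N) \<omega>) - Z (grid T N 0) \<omega> * (X (grid T N 0) \<omega> + D N 0 \<omega>) =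
        (\<Sum>j<Suc N. Z (grid T N j) \<omega> * X (grid T N j) \<omega> * (exp (- r * ?h - \<sigma> * ?dW N j \<omega>) * (1 + \<mu> * ?h + \<sigma> * ?dW N j \<omega>) - 1))
        + (\<Sum>j<Suc N. Z (grid T N j) \<omega> * D N j \<omega> * (exp (- r * ?h - \<sigma> * ?dW N j \<omega>) - 1)) + T3 N \<omega>"
        unfolding T3_def Dk
        by (rule discrete_product_rule[where n="Suc N" and ?x0.0="X 0 \<omega>" and i="\<lambda>k. I (grid T N k) \<omega>"])
          (use elim Zstep in auto)
      moreover have "exp (- r * ?h - \<sigma> * w) * (1 + \<mu> * ?h + \<sigma> * w) - 1 = \<gamma> a0 a1 N w" for w
      proof -
        have "exp (- r * ?h - \<sigma> * w) = exp (- \<sigma> * w) * exp (- r * ?h)" by (simp flip: exp_add)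
        then show ?thesis unfolding \<gamma>_def a0_def a1_def by (simp only: ring_distribs mult.assoc)
      qed
      moreover have "exp (- r * ?h - \<sigma> * w) - 1 = \<gamma> c0 c1 N w" for w
        unfolding \<gamma>_def c0_def c1_def by (simp flip: exp_add)
      ultimately have "Z (grid T N (Suc N)) \<omega> * (X (grid T N (Suc N)) \<omega> + D N (Suc N) \<omega>) - Z (grid T N 0) \<omega> * (X (grid T N 0) \<omega> + D N 0 \<omega>)
        = T1 N \<omega> + T2 N \<omega> + T3 N \<omega>" unfolding T1_def T2_def by presburger
      then show ?case unfolding grid_Suc grid_0 D0 by (simp add: algebra_simps)
    qed
    show "(\<lambda>\<omega>. Z T \<omega> * X T \<omega> - Z 0 \<omega> * X 0 \<omega>) \<in> borel_measurable M"
      using ZM[of T] ZM[of 0] XM[of T] XM[of 0] T by auto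
    show "(\<lambda>\<omega>. T1 N \<omega> + T2 N \<omega> + T3 N \<omega> + (- Z T \<omega>) * D N (Suc N) \<omega>) \<in> borel_measurable M"
      using T1M T2M T3M DM ZM[of T] T by (intro borel_measurable_add borel_measurable_times borel_measurable_uminus) auto
  qed
  then have "AE \<omega> in M. Z T \<omega> * X T \<omega> - Z 0 \<omega> * X 0 \<omega> = 0"
    using ZM[of T] ZM[of 0] XM[of T] XM[of 0] T by (intro null_in_prob_const_AE) auto
  with X0 W_0 show ?thesis
  proof eventually_elim
    case (elim \<omega>)
    then have "exp (- (r * T + \<sigma> * W T \<omega>)) * X T \<omega> = x" by (simp add: Z_def)
    moreover have "X T \<omega> = exp (r * T + \<sigma> * W T \<omega>) * (exp (- (r * T + \<sigma> * W T \<omega>)) * X T \<omega>)"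
      by (simp only: mult.assoc[symmetric] exp_add[symmetric]) simp
    ultimately have "X T \<omega> = x * exp (r * T + \<sigma> * W T \<omega>)"
      by (simp only: mult.commute)
    then show ?case by (simp add: r_def)
  qed
qed

end

section \<open>The hitting probability of a drifted Brownian motion\<close>

text \<open>
  For a drifted Brownian motion started at the barrier 0, the density at \<open>- z\<close> is \<open>exp (- 2 r z / \<sigma>\<^sup>2)\<close> times the density
  at \<open>z\<close>. The second summand therefore adds, to the probability of being below the barrier, the probability
  of being above it, and the total is 1.
\<close>

definition payoff :: "real \<Rightarrow> real \<Rightarrow> real \<Rightarrow> real" where
  "payoff r \<sigma> z = (if z \<le> 0 then 1 + exp (- 2 * r * z / \<sigma>\<^sup>2) else 0)"

text \<open>
  The expected pay-off after time \<open>s\<close> for a start at \<open>z\<close>; see \<open>nn_integral_payoff\<close>.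
\<close>

definition expected_payoff :: "real \<Rightarrow> real \<Rightarrow> real \<Rightarrow> real \<Rightarrow> real" where
  "expected_payoff r \<sigma> s z = Phi ((- z - r * s) / (\<sigma> * sqrt s)) + exp (- 2 * r * z / \<sigma>\<^sup>2) * Phi ((- z + r * s) / (\<sigma> * sqrt s))"

lemma borel_measurable_payoff [measurable]: "payoff r \<sigma> \<in> borel_measurable borel"
  unfolding payoff_def[abs_def] by measurable

lemma borel_measurable_expected_payoff [measurable]: "expected_payoff r \<sigma> s \<in> borel_measurable borel"
  unfolding expected_payoff_def[abs_def] by measurable

lemma payoff_nonneg: "0 \<le> payoff r \<sigma> z" by (simp add: payoff_def add_nonneg_nonneg)

lemma expected_payoff_nonneg: "0 \<le> expected_payoff r \<sigma> s z"
  by (simp add: expected_payoff_def Phi_bounds)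

lemma expected_payoff_barrier: "expected_payoff r \<sigma> s 0 = 1"
  using Phi_minus[of "r * s / (\<sigma> * sqrt s)"] by (simp add: expected_payoff_def)

lemma expected_payoff_le:
  assumes "\<bar>z\<bar> \<le> 1"
  shows "expected_payoff r \<sigma> s z \<le> 1 + exp (2 * \<bar>r\<bar> / \<sigma>\<^sup>2)"
proof -
  have "- 2 * r * z \<le> 2 * \<bar>r\<bar>"
  proof -
    have "- 2 * r * z \<le> \<bar>- 2 * r * z\<bar>" by (rule abs_ge_self)
    also have "\<dots> = 2 * (\<bar>r\<bar> * \<bar>z\<bar>)" by (simp add: abs_mult)
    also have "\<dots> \<le> 2 * (\<bar>r\<bar> * 1)" using assms by (intro mult_left_mono) auto
    finally show ?thesis by simp
  qed
  then have "- 2 * r * z / \<sigma>\<^sup>2 \<le> 2 * \<bar>r\<bar> / \<sigma>\<^sup>2" by (rule divide_right_mono) simp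
  then have "exp (- 2 * r * z / \<sigma>\<^sup>2) \<le> exp (2 * \<bar>r\<bar> / \<sigma>\<^sup>2)" by (simp only: exp_le_cancel_iff)
  moreover have "exp (- 2 * r * z / \<sigma>\<^sup>2) * Phi ((- z + r * s) / (\<sigma> * sqrt s)) \<le> exp (- 2 * r * z / \<sigma>\<^sup>2) * 1"
    using Phi_bounds by (intro mult_left_mono) auto
  ultimately show ?thesis using Phi_bounds(2)[of "(- z - r * s) / (\<sigma> * sqrt s)"] unfolding expected_payoff_def by linarith
qed

lemma tendsto_expected_payoff_barrier:
  assumes "s \<longlonglongrightarrow> s0" "s0 > 0" "z \<longlonglongrightarrow> 0" "\<sigma> > 0"
  shows "(\<lambda>n. expected_payoff r \<sigma> (s n) (z n)) \<longlonglongrightarrow> 1"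
proof -
  have "(\<lambda>n. expected_payoff r \<sigma> (s n) (z n)) \<longlonglongrightarrow> expected_payoff r \<sigma> s0 0"
    unfolding expected_payoff_def using assms
    by (intro tendsto_intros isCont_tendsto_compose[OF isCont_Phi]) auto
  then show ?thesis by (simp add: expected_payoff_barrier)
qed

lemma nn_integral_payoff:
  assumes "\<sigma> > 0" "s > 0"
  shows "(\<integral>\<^sup>+w. ennreal (normal_density 0 (sqrt s) w) * ennreal (payoff r \<sigma> (z + r * s + \<sigma> * w)) \<partial>lborel) = ennreal (expected_payoff r \<sigma> s z)"
proof -
  define c where "c = - (z + r * s) / \<sigma>"
  define E where "E = exp (- 2 * r * z / \<sigma>\<^sup>2)"
  define m where "m = - 2 * r * s / \<sigma>"
  have tilt: "exp (- 2 * r * (z + r * s + \<sigma> * w) / \<sigma>\<^sup>2) * normal_density 0 (sqrt s) w = E * normal_density m (sqrt s) w" for w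
  proof -
    have "- 2 * r * (z + r * s + \<sigma> * w) / \<sigma>\<^sup>2 + - (w - 0)\<^sup>2 / (2 * (sqrt s)\<^sup>2) = - 2 * r * z / \<sigma>\<^sup>2 + - (w - m)\<^sup>2 / (2 * (sqrt s)\<^sup>2)"
      using assms by (simp add: m_def field_simps power2_eq_square)
    then have "exp (- 2 * r * (z + r * s + \<sigma> * w) / \<sigma>\<^sup>2) * exp (- (w - 0)\<^sup>2 / (2 * (sqrt s)\<^sup>2)) = E * exp (- (w - m)\<^sup>2 / (2 * (sqrt s)\<^sup>2))"
      unfolding E_def exp_add[symmetric] by simp
    then show ?thesis unfolding normal_density_def by (simp add: mult.left_commute)
  qed
  have ind: "z + r * s + \<sigma> * w \<le> 0 \<longleftrightarrow> w \<le> c" for w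
    using assms by (simp add: c_def pos_le_divide_eq mult.commute[of w]) linarith
  let ?f = "\<lambda>w. indicator {..c} w * normal_density 0 (sqrt s) w + E * (indicator {..c} w * normal_density m (sqrt s) w)"
  have eq: "normal_density 0 (sqrt s) w * payoff r \<sigma> (z + r * s + \<sigma> * w) = ?f w" for w
    using tilt[of w] unfolding payoff_def ind by (simp add: indicator_def algebra_simps)
  have pos: "sqrt s > 0" using assms by simp
  have int: "integrable lborel (\<lambda>w. indicator {..c} w * normal_density m' (sqrt s) w)" for m'
    using pos by (intro integrable_indicator_normal) auto
  have "(\<integral>\<^sup>+w. ennreal (normal_density 0 (sqrt s) w) * ennreal (payoff r \<sigma> (z + r * s + \<sigma> * w)) \<partial>lborel)
     = (\<integral>\<^sup>+w. ennreal (?f w) \<partial>lborel)"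
    by (simp add: ennreal_mult''[symmetric] payoff_nonneg eq)
  also have "\<dots> = ennreal (\<integral>w. ?f w \<partial>lborel)"
    by (intro nn_integral_eq_integral Bochner_Integration.integrable_add integrable_mult_right int) (simp add: E_def)
  also have "(\<integral>w. ?f w \<partial>lborel) = Phi ((c - 0) / sqrt s) + E * Phi ((c - m) / sqrt s)"
    using int pos by (simp add: integral_normal_density_atMost)
  also have "(c - 0) / sqrt s = (- z - r * s) / (\<sigma> * sqrt s)"
    using assms by (simp add: c_def field_simps)
  also have "(c - m) / sqrt s = (- z + r * s) / (\<sigma> * sqrt s)"
    using assms by (simp add: c_def m_def field_simps)
  finally show ?thesis by (simp add: expected_payoff_def E_def)
qed

lemma limit_from_left_nonneg:
  fixes h :: "real \<Rightarrow> real"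
  assumes "continuous_on {0..t} h" "0 < t" "\<And>u. 0 \<le> u \<Longrightarrow> u < t \<Longrightarrow> 0 \<le> h u"
  shows "0 \<le> h t"
proof -
  let ?u = "\<lambda>n. t * (1 - 1 / real (Suc n))"
  have "?u \<longlonglongrightarrow> t * (1 - 0)"
    by (intro tendsto_intros LIMSEQ_inverse_real_of_nat[unfolded inverse_eq_divide])
  moreover have u: "0 \<le> ?u n" "?u n < t" for n using assms by (auto simp: field_simps)
  moreover have "?u n \<in> {0..t}" for n using u[of n] by simp
  ultimately have "(\<lambda>n. h (?u n)) \<longlonglongrightarrow> h t"
    using assms by (intro continuous_on_tendsto_compose[OF assms(1)]) auto
  then show ?thesis by (rule LIMSEQ_le_const) (use u assms in auto)
qed

lemma first_passage:
  fixes h :: "real \<Rightarrow> real"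
  assumes "continuous_on {0..} h" "0 \<le> u" "h u \<le> c"
  obtains t where "0 \<le> t" "t \<le> u" "h t \<le> c" "\<And>v. 0 \<le> v \<Longrightarrow> h v \<le> c \<Longrightarrow> t \<le> v"
proof -
  let ?S = "{v \<in> {0..u}. h v \<le> c}"
  have "continuous_on {0..u} h" using continuous_on_subset[OF assms(1)] by auto
  then have "closed (h -` {..c} \<inter> {0..u})" by (intro closed_vimage_Int) auto
  then have "compact ({0..u} \<inter> (h -` {..c} \<inter> {0..u}))" by (intro compact_Int_closed) auto
  moreover have "{0..u} \<inter> (h -` {..c} \<inter> {0..u}) = ?S" by auto
  ultimately have "compact ?S" by (simp only:)
  then obtain t where t: "t \<in> ?S" "\<And>v. v \<in> ?S \<Longrightarrow> t \<le> v"
    using compact_attains_inf[of ?S] assms by auto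
  have "t \<le> v" if "0 \<le> v" "h v \<le> c" for v
    using t(2)[of v] t(1) that by (cases "v \<le> u") auto
  then show ?thesis using t that by auto
qed

context brownian
begin

text \<open>
  On the compact time interval the minimum of the path is attained, hence the event is decided by the values on a
  countable dense set of times.
\<close>

lemma hit_event:
  assumes H: "continuous_adapted M F H" and "0 \<le> s"
  shows "{\<omega>\<in>space M. \<exists>u\<in>{0..s}. H u \<omega> \<le> c} \<in> sets (F s)"
proof -
  obtain D where D: "countable D" "D \<subseteq> {0..s}" "{0..s} \<subseteq> closure D"
    using separable[of "{0..s}"] by blast
  have HF: "H q \<in> borel_measurable (F s)" if "q \<in> D" for q
    using adapted_F[OF H, of q s] D that by auto
  have "{\<omega>\<in>space M. \<exists>u\<in>{0..s}. H u \<omega> \<le> c} = {\<omega>\<in>space (F s). \<forall>n::nat. \<exists>q\<in>D. H q \<omega> < c + 1 / real (Suc n)}"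
    unfolding space_F[OF \<open>0 \<le> s\<close>]
  proof (intro Collect_cong conj_cong refl)
    fix \<omega> assume \<omega>: "\<omega> \<in> space M"
    have cont: "continuous_on {0..s} (\<lambda>u. H u \<omega>)"
      using continuous_on_subset[OF continuous_adaptedD[OF H \<omega>]] by auto
    show "(\<exists>u\<in>{0..s}. H u \<omega> \<le> c) \<longleftrightarrow> (\<forall>n::nat. \<exists>q\<in>D. H q \<omega> < c + 1 / real (Suc n))"
    proof
      assume "\<exists>u\<in>{0..s}. H u \<omega> \<le> c"
      then obtain u where u: "u \<in> {0..s}" "H u \<omega> \<le> c" by blast
      show "\<forall>n::nat. \<exists>q\<in>D. H q \<omega> < c + 1 / real (Suc n)"
      proof
        fix n :: nat
        obtain q where q: "\<And>i. q i \<in> D" "q \<longlonglongrightarrow> u"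
          using u D closure_sequential[of u D] by blast
        have "0 \<le> q i" "q i \<le> s" for i using q(1)[of i] D(2) by auto
        then have "(\<lambda>i. H (q i) \<omega>) \<longlonglongrightarrow> H u \<omega>"
          using q(2) u by (intro continuous_on_tendsto_compose[OF cont]) auto
        moreover have "H u \<omega> < c + 1 / real (Suc n)" using u(2) by (rule order.strict_trans1) simp
        ultimately have "\<forall>\<^sub>F i in sequentially. H (q i) \<omega> < c + 1 / real (Suc n)" by (rule order_tendstoD)
        then obtain i where "H (q i) \<omega> < c + 1 / real (Suc n)" by (auto simp: eventually_sequentially)
        then show "\<exists>q\<in>D. H q \<omega> < c + 1 / real (Suc n)" using q(1) by blast
      qed
    next
      assume *: "\<forall>n::nat. \<exists>q\<in>D. H q \<omega> < c + 1 / real (Suc n)"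
      obtain u where u: "u \<in> {0..s}" "\<And>v. v \<in> {0..s} \<Longrightarrow> H u \<omega> \<le> H v \<omega>"
        using continuous_attains_inf[OF _ _ cont] \<open>0 \<le> s\<close> by auto
      have "H u \<omega> \<le> c + 1 / real (Suc n)" for n
        using *[rule_format, of n] u(2) D(2) by (meson less_imp_le order_trans subsetD)
      moreover have "(\<lambda>n. c + 1 / real (Suc n)) \<longlonglongrightarrow> c + 0"
        by (intro tendsto_intros LIMSEQ_inverse_real_of_nat[unfolded inverse_eq_divide])
      ultimately have "H u \<omega> \<le> c + 0" by (intro LIMSEQ_le_const) auto
      then show "\<exists>u\<in>{0..s}. H u \<omega> \<le> c" using u by auto
    qed
  qed
  also have "\<dots> \<in> sets (F s)"
    using HF D(1) by (intro sets.sets_Collect_countable_All sets.sets_Collect_countable_Ex' borel_measurable_less borel_measurable_const)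
  finally show ?thesis .
qed

lemma markov_payoff:
  assumes "\<sigma> > 0" "0 \<le> u" "u < T" and C: "C \<in> sets (F u)"
  shows "(\<integral>\<^sup>+\<omega>. ennreal (payoff r \<sigma> (y + r * T + \<sigma> * W T \<omega>)) * indicator C \<omega> \<partial>M)
    = (\<integral>\<^sup>+\<omega>. ennreal (expected_payoff r \<sigma> (T - u) (y + r * u + \<sigma> * W u \<omega>)) * indicator C \<omega> \<partial>M)"
proof -
  \<comment> \<open>A single real variable carries both the position and the event; the value 0 means that \<open>C\<close> fails.\<close>
  define P where "P \<omega> = (if \<omega> \<in> C then exp (y + r * u + \<sigma> * W u \<omega>) else 0)" for \<omega>
  define D where "D \<omega> = W T \<omega> - W u \<omega>" for \<omega>
  let ?h = "\<lambda>p w. ennreal (payoff r \<sigma> (ln p + r * (T - u) + \<sigma> * w)) * (if 0 < p then 1 else 0)"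
  have PF: "P \<in> borel_measurable (F u)"
  proof -
    have [measurable]: "W u \<in> borel_measurable (F u)" "C \<in> sets (F u)"
      using W_F[OF \<open>0 \<le> u\<close> order_refl] C by auto
    show ?thesis unfolding P_def[abs_def] by measurable
  qed
  have PM [measurable]: "P \<in> borel_measurable M"
    by (rule measurable_F_M[OF PF \<open>0 \<le> u\<close>])
  have DM [measurable]: "D \<in> borel_measurable M"
    unfolding D_def[abs_def] using assms by (intro borel_measurable_diff W_M) auto
  have dist: "distributed M lborel D (normal_density 0 (sqrt (T - u)))"
    unfolding D_def[abs_def] using assms by (intro W_increment_distributed)
  have indep: "distr M borel P \<Otimes>\<^sub>M distr M borel D = distr M (borel \<Otimes>\<^sub>M borel) (\<lambda>\<omega>. (P \<omega>, D \<omega>))"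
    using W_increment_indep[OF assms(2,3) PF] unfolding indep_var_distribution_eq D_def[abs_def] by blast
  interpret DP: prob_space "distr M borel D" by (rule prob_space_distr) measurable
  have hm [measurable]: "(\<lambda>x. ?h (fst x) (snd x)) \<in> borel_measurable (borel \<Otimes>\<^sub>M borel)" by measurable
  have inner: "(\<integral>\<^sup>+w. ?h p w \<partial>distr M borel D) = ennreal (expected_payoff r \<sigma> (T - u) (ln p)) * (if 0 < p then 1 else 0)" for p
  proof -
    have dd: "distr M borel D = density lborel (normal_density 0 (sqrt (T - u)))"
      using distributed_distr_eq_density[OF dist] by (metis distr_cong sets_lborel)
    have "(\<integral>\<^sup>+w. ?h p w \<partial>distr M borel D) = (\<integral>\<^sup>+w. ennreal (payoff r \<sigma> (ln p + r * (T - u) + \<sigma> * w)) \<partial>distr M borel D) * (if 0 < p then 1 else 0)"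
      by (rule nn_integral_multc) measurable
    also have "(\<integral>\<^sup>+w. ennreal (payoff r \<sigma> (ln p + r * (T - u) + \<sigma> * w)) \<partial>distr M borel D) = ennreal (expected_payoff r \<sigma> (T - u) (ln p))"
      unfolding dd using assms by (subst nn_integral_density) (auto simp: nn_integral_payoff)
    finally show ?thesis .
  qed
  have "(\<integral>\<^sup>+\<omega>. ennreal (payoff r \<sigma> (y + r * T + \<sigma> * W T \<omega>)) * indicator C \<omega> \<partial>M) = (\<integral>\<^sup>+\<omega>. ?h (P \<omega>) (D \<omega>) \<partial>M)"
    by (intro nn_integral_cong) (simp add: P_def D_def algebra_simps)
  also have "\<dots> = (\<integral>\<^sup>+x. ?h (fst x) (snd x) \<partial>(distr M borel P \<Otimes>\<^sub>M distr M borel D))"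
    unfolding indep by (subst nn_integral_distr) (use hm in auto)
  also have "\<dots> = (\<integral>\<^sup>+p. \<integral>\<^sup>+w. ?h p w \<partial>distr M borel D \<partial>distr M borel P)"
  proof (subst DP.nn_integral_fst[symmetric])
    show "(\<lambda>x. ?h (fst x) (snd x)) \<in> borel_measurable (distr M borel P \<Otimes>\<^sub>M distr M borel D)"
      using hm by (simp cong: measurable_cong_sets)
  qed simp
  also have "\<dots> = (\<integral>\<^sup>+\<omega>. ennreal (expected_payoff r \<sigma> (T - u) (ln (P \<omega>))) * (if 0 < P \<omega> then 1 else 0) \<partial>M)"
    unfolding inner by (rule nn_integral_distr) measurable
  also have "\<dots> = (\<integral>\<^sup>+\<omega>. ennreal (expected_payoff r \<sigma> (T - u) (y + r * u + \<sigma> * W u \<omega>)) * indicator C \<omega> \<partial>M)"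
    by (intro nn_integral_cong) (simp add: P_def)
  finally show ?thesis .
qed

end
lemma grid_first_index:
  assumes "0 < T" "0 \<le> \<tau>" "\<tau> < T"
  obtains \<kappa> :: "nat \<Rightarrow> nat" where "\<And>N. \<kappa> N \<le> Suc N" "\<And>N. \<tau> \<le> grid T N (\<kappa> N)" "\<And>N k. k < \<kappa> N \<Longrightarrow> grid T N k < \<tau>"
    "(\<lambda>N. grid T N (\<kappa> N)) \<longlonglongrightarrow> \<tau>"
proof -
  define \<kappa> where "\<kappa> N = (LEAST k. \<tau> \<le> grid T N k)" for N
  have k: "\<tau> \<le> grid T N (\<kappa> N)" "\<kappa> N \<le> Suc N" "\<And>i. i < \<kappa> N \<Longrightarrow> grid T N i < \<tau>" for N
    unfolding \<kappa>_def using assms grid_Suc[of T N] LeastI[of "\<lambda>k. \<tau> \<le> grid T N k" "Suc N"]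
    by (auto intro: Least_le dest: not_less_Least)
  have near: "grid T N (\<kappa> N) \<le> \<tau> + T / real (Suc N)" for N
  proof (cases "\<kappa> N")
    case 0 then show ?thesis using assms by (simp add: grid_0)
  next
    case (Suc j)
    then show ?thesis using k(3)[of j N] grid_step[of T N j] by simp
  qed
  have lim: "(\<lambda>N. \<tau> + T / real (Suc N)) \<longlonglongrightarrow> \<tau> + 0"
    using tendsto_mult[OF tendsto_const[of T] LIMSEQ_inverse_real_of_nat]
    by (intro tendsto_add tendsto_const) (simp add: divide_inverse)
  have "(\<lambda>N. grid T N (\<kappa> N)) \<longlonglongrightarrow> \<tau>"
    by (rule tendsto_sandwich[OF _ _ tendsto_const lim[unfolded add_0_right]]) (use k near in auto)
  then show ?thesis using that k by blast
qed

context brownian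
begin

lemma drifted_continuous_adapted:
  "continuous_adapted M F (\<lambda>t \<omega>. y + r * t + \<sigma> * W t \<omega>)"
  unfolding continuous_adapted_def
proof (intro conjI allI impI ballI)
  fix t :: real assume "0 \<le> t"
  then show "(\<lambda>\<omega>. y + r * t + \<sigma> * W t \<omega>) \<in> borel_measurable (F t)"
    using W_F[of t t] by simp
next
  fix \<omega> assume "\<omega> \<in> space M"
  then show "continuous_on {0..} (\<lambda>t. y + r * t + \<sigma> * W t \<omega>)"
    by (intro continuous_intros continuous_adaptedD[OF W_continuous_adapted])
qed

lemma W_no_atom:
  assumes "0 < T"
  shows "AE \<omega> in M. W T \<omega> \<noteq> c"
proof -
  note dist = W_increment_distributed[OF order_refl assms]
  have [measurable]: "W T \<in> borel_measurable M" "W 0 \<in> borel_measurable M" using assms by (auto intro: W_M)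
  have "emeasure M ((\<lambda>\<omega>. W T \<omega> - W 0 \<omega>) -` {c} \<inter> space M) = (\<integral>\<^sup>+x. ennreal (normal_density 0 (sqrt (T - 0)) x) * indicator {c} x \<partial>lborel)"
    using dist by (intro distributed_emeasure) auto
  also have "\<dots> = 0" by (subst nn_integral_0_iff_AE) (use AE_lborel_singleton[of c] in \<open>auto elim!: eventually_mono\<close>)
  finally have "AE \<omega> in M. W T \<omega> - W 0 \<omega> \<noteq> c"
    by (intro AE_I[where N="(\<lambda>\<omega>. W T \<omega> - W 0 \<omega>) -` {c} \<inter> space M"]) auto
  with W_0 show ?thesis by eventually_elim simp
qed

text \<open>
  The hitting time \<open>\<tau>\<close> is rounded up to the next grid point; \<open>C N k\<close> is the event that this is grid
  point \<open>k\<close> and that the process is then still in \<open>[-1, 1]\<close>. The Markov property holds exactly on each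
  \<open>C N k\<close>. As the mesh tends to 0, the position at the rounded time tends to the
  barrier, where the expected pay-off is 1. The restriction to \<open>[-1, 1]\<close> provides a constant
  majorant and is satisfied for all sufficiently fine grids. A path that does not reach the barrier before \<open>T\<close> yields no
  pay-off, except on the null event that it is exactly 0 at time \<open>T\<close>.
\<close>

lemma drifted_hitting_probability:
  assumes "\<sigma> > 0" "T > 0" "y \<ge> 0"
  shows "prob {\<omega>\<in>space M. \<exists>u\<in>{0..T}. y + r * u + \<sigma> * W u \<omega> \<le> 0} = expected_payoff r \<sigma> T y"
proof -
  define Y where "Y t \<omega> = y + r * t + \<sigma> * W t \<omega>" for t \<omega>
  have Y: "continuous_adapted M F Y"
    unfolding Y_def[abs_def] by (rule drifted_continuous_adapted)
  have contY: "continuous_on {0..} (\<lambda>t. Y t \<omega>)" if "\<omega> \<in> space M" for \<omega>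
    by (rule continuous_adaptedD[OF Y that])
  have gn: "0 \<le> grid T N k" for N k using \<open>T > 0\<close> by (simp add: grid_nonneg)
  define B where "B s = {\<omega>\<in>space M. \<exists>u\<in>{0..s}. Y u \<omega> \<le> 0}" for s
  have BF: "B s \<in> sets (F s)" if "0 \<le> s" for s
    unfolding B_def by (rule hit_event[OF Y that])
  define prev where "prev N k = (if k = 0 then {} else B (grid T N (k - 1)))" for N k
  define C where "C N k = (B (grid T N k) - prev N k) \<inter> {\<omega>\<in>space M. \<bar>Y (grid T N k) \<omega>\<bar> \<le> 1}" for N k
  have CF: "C N k \<in> sets (F (grid T N k))" for N k
  proof -
    have "prev N k \<in> sets (F (grid T N k))"
      unfolding prev_def using BF[OF gn[of N "k - 1"]] sets_F_mono[OF gn[of N "k - 1"] grid_mono[of T "k - 1" k N]] \<open>T > 0\<close> by auto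
    moreover have "{\<omega>\<in>space M. \<bar>Y (grid T N k) \<omega>\<bar> \<le> 1} \<in> sets (F (grid T N k))"
    proof -
      have [measurable]: "Y (grid T N k) \<in> borel_measurable (F (grid T N k))"
        by (rule adapted_F[OF Y gn order_refl])
      have "{\<omega>\<in>space (F (grid T N k)). \<bar>Y (grid T N k) \<omega>\<bar> \<le> 1} \<in> sets (F (grid T N k))" by measurable
      then show ?thesis using space_F[OF gn] by simp
    qed
    ultimately show ?thesis unfolding C_def using BF[OF gn] by (intro sets.Int sets.Diff) auto
  qed
  have CM [measurable]: "C N k \<in> sets M" for N k using CF sets_F[OF gn] by blast
  have YM [measurable]: "Y t \<in> borel_measurable M" if "0 \<le> t" for t by (rule adapted_M[OF Y that])
  define L where "L N \<omega> = (\<Sum>k<Suc N. ennreal (payoff r \<sigma> (Y T \<omega>)) * indicator (C N k) \<omega>)" for N \<omega>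
  define R where "R N \<omega> = (\<Sum>k<Suc N. ennreal (expected_payoff r \<sigma> (T - grid T N k) (Y (grid T N k) \<omega>)) * indicator (C N k) \<omega>)" for N \<omega>
  have YT [measurable]: "Y T \<in> borel_measurable M" using \<open>T > 0\<close> by (intro YM) simp
  have Yg [measurable]: "Y (grid T N k) \<in> borel_measurable M" for N k by (rule YM[OF gn])
  have LM [measurable]: "L N \<in> borel_measurable M" and RM [measurable]: "R N \<in> borel_measurable M" for N
    unfolding L_def[abs_def] R_def[abs_def] by (intro borel_measurable_sum; measurable)+
  have LR: "(\<integral>\<^sup>+\<omega>. L N \<omega> \<partial>M) = (\<integral>\<^sup>+\<omega>. R N \<omega> \<partial>M)" for N
  proof -
    have "(\<integral>\<^sup>+\<omega>. L N \<omega> \<partial>M) = (\<Sum>k<Suc N. \<integral>\<^sup>+\<omega>. ennreal (payoff r \<sigma> (Y T \<omega>)) * indicator (C N k) \<omega> \<partial>M)"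
      unfolding L_def by (intro nn_integral_sum) measurable
    also have "\<dots> = (\<Sum>k<Suc N. \<integral>\<^sup>+\<omega>. ennreal (expected_payoff r \<sigma> (T - grid T N k) (Y (grid T N k) \<omega>)) * indicator (C N k) \<omega> \<partial>M)"
    proof (intro sum.cong refl)
      fix k assume "k \<in> {..<Suc N}"
      then have "grid T N k < T" using grid_less[of T k "Suc N" N] \<open>T > 0\<close> by (simp add: grid_Suc)
      then show "(\<integral>\<^sup>+\<omega>. ennreal (payoff r \<sigma> (Y T \<omega>)) * indicator (C N k) \<omega> \<partial>M) =
         (\<integral>\<^sup>+\<omega>. ennreal (expected_payoff r \<sigma> (T - grid T N k) (Y (grid T N k) \<omega>)) * indicator (C N k) \<omega> \<partial>M)"
        unfolding Y_def by (intro markov_payoff \<open>\<sigma> > 0\<close> gn CF)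
    qed
    also have "\<dots> = (\<integral>\<^sup>+\<omega>. R N \<omega> \<partial>M)"
      unfolding R_def by (intro nn_integral_sum[symmetric]) measurable
    finally show ?thesis .
  qed
  define A where "A = {\<omega>\<in>space M. \<exists>u. 0 \<le> u \<and> u < T \<and> Y u \<omega> \<le> 0}"
  have AM [measurable]: "A \<in> sets M"
  proof -
    have "A = (\<Union>n. B (T * (1 - 1 / real (Suc n))))"
    proof (intro equalityI subsetI)
      fix \<omega> assume "\<omega> \<in> A"
      then obtain u where u: "\<omega> \<in> space M" "0 \<le> u" "u < T" "Y u \<omega> \<le> 0" by (auto simp: A_def)
      have "(\<lambda>n. T * (1 - 1 / real (Suc n))) \<longlonglongrightarrow> T * (1 - 0)"
        by (intro tendsto_intros LIMSEQ_inverse_real_of_nat[unfolded inverse_eq_divide])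
      from order_tendstoD(1)[OF this, of u] u obtain n where "u < T * (1 - 1 / real (Suc n))"
        by (auto simp: eventually_sequentially)
      then show "\<omega> \<in> (\<Union>n. B (T * (1 - 1 / real (Suc n))))" using u by (auto simp: B_def intro!: exI[of _ n] bexI[of _ u])
    next
      fix \<omega> assume "\<omega> \<in> (\<Union>n. B (T * (1 - 1 / real (Suc n))))"
      then obtain n u where u: "\<omega> \<in> space M" "0 \<le> u" "u \<le> T * (1 - 1 / real (Suc n))" "Y u \<omega> \<le> 0"
        by (auto simp: B_def)
      have "T * (1 - 1 / real (Suc n)) < T * 1" using \<open>T > 0\<close> by (intro mult_strict_left_mono) auto
      with u show "\<omega> \<in> A" by (auto simp: A_def)
    qed
    moreover have "B (T * (1 - 1 / real (Suc n))) \<in> sets M" for n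
    proof -
      have "0 \<le> T * (1 - 1 / real (Suc n))" using \<open>T > 0\<close> by (intro mult_nonneg_nonneg) (auto simp: field_simps)
      then show ?thesis using BF sets_F by blast
    qed
    ultimately show ?thesis by auto
  qed
  have start: "AE \<omega> in M. Y 0 \<omega> = y" using W_0 by eventually_elim (simp add: Y_def)
  have noatom: "AE \<omega> in M. Y T \<omega> \<noteq> 0"
    using W_no_atom[OF \<open>T > 0\<close>, of "- (y + r * T) / \<sigma>"]
    by eventually_elim (use \<open>\<sigma> > 0\<close> in \<open>auto simp: Y_def field_simps\<close>)
  have lims_AE: "AE \<omega> in M. (\<lambda>N. L N \<omega>) \<longlonglongrightarrow> ennreal (payoff r \<sigma> (Y T \<omega>)) * indicator A \<omega> \<and> (\<lambda>N. R N \<omega>) \<longlonglongrightarrow> indicator A \<omega>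
     \<and> (\<forall>N. L N \<omega> \<le> ennreal (payoff r \<sigma> (Y T \<omega>))) \<and> (\<forall>N. R N \<omega> \<le> ennreal (1 + exp (2 * \<bar>r\<bar> / \<sigma>\<^sup>2)))"
    using start AE_space
  proof eventually_elim
    case (elim \<omega>)
    note \<omega> = \<open>\<omega> \<in> space M\<close>
    show ?case
    proof (cases "\<omega> \<in> A")
      case False
      have "\<omega> \<notin> C N k" if "k < Suc N" for N k
      proof
        assume "\<omega> \<in> C N k"
        then obtain u where "0 \<le> u" "u \<le> grid T N k" "Y u \<omega> \<le> 0" by (auto simp: C_def B_def)
        moreover have "grid T N k < T" using grid_less[of T k "Suc N" N] \<open>T > 0\<close> that by (simp add: grid_Suc)
        ultimately show False using False \<omega> by (auto simp: A_def)
      qed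
      then have "L N \<omega> = 0" "R N \<omega> = 0" for N by (auto simp: L_def R_def simp del: sum.lessThan_Suc)
      then show ?thesis using False by simp
    next
      case True
      then obtain u where u: "0 \<le> u" "u < T" "Y u \<omega> \<le> 0" by (auto simp: A_def)
      obtain \<tau> where \<tau>: "0 \<le> \<tau>" "\<tau> \<le> u" "Y \<tau> \<omega> \<le> 0" "\<And>v. 0 \<le> v \<Longrightarrow> Y v \<omega> \<le> 0 \<Longrightarrow> \<tau> \<le> v"
        using first_passage[OF contY[OF \<omega>] u(1,3)] by metis
      have "0 \<le> Y \<tau> \<omega>"
      proof (cases "\<tau> = 0")
        case True then show ?thesis using elim \<open>y \<ge> 0\<close> by simp
      next
        case False
        have "continuous_on {0..\<tau>} (\<lambda>t. Y t \<omega>)" using continuous_on_subset[OF contY[OF \<omega>]] by auto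
        then show ?thesis
        proof (rule limit_from_left_nonneg)
          show "0 < \<tau>" using False \<tau>(1) by simp
          show "0 \<le> Y v \<omega>" if "0 \<le> v" "v < \<tau>" for v
            using \<tau>(4)[of v] that by linarith
        qed
      qed
      then have Y\<tau>: "Y \<tau> \<omega> = 0" using \<tau> by simp
      have \<tau>T: "\<tau> < T" using \<tau>(2) u(2) by linarith
      obtain \<kappa> where \<kappa>: "\<And>N. \<kappa> N \<le> Suc N" "\<And>N. \<tau> \<le> grid T N (\<kappa> N)" "\<And>N k. k < \<kappa> N \<Longrightarrow> grid T N k < \<tau>"
        "(\<lambda>N. grid T N (\<kappa> N)) \<longlonglongrightarrow> \<tau>"
        using grid_first_index[OF \<open>T > 0\<close> \<tau>(1) \<tau>T] by metis
      have inB: "\<omega> \<in> B s \<longleftrightarrow> \<tau> \<le> s" for s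
      proof
        assume "\<omega> \<in> B s"
        then obtain v where "0 \<le> v" "v \<le> s" "Y v \<omega> \<le> 0" by (auto simp: B_def)
        with \<tau>(4)[of v] show "\<tau> \<le> s" by linarith
      next
        assume "\<tau> \<le> s"
        then show "\<omega> \<in> B s" using \<tau>(1,3) \<omega> by (auto simp: B_def)
      qed
      have inC: "\<omega> \<in> C N k \<longleftrightarrow> k = \<kappa> N \<and> \<bar>Y (grid T N (\<kappa> N)) \<omega>\<bar> \<le> 1" for N k
      proof -
        have "\<omega> \<in> B (grid T N k) - prev N k \<longleftrightarrow> k = \<kappa> N"
        proof
          assume *: "\<omega> \<in> B (grid T N k) - prev N k"
          then have "\<not> k < \<kappa> N" using \<kappa>(3)[of k N] inB by force
          moreover have "\<not> \<kappa> N < k"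
          proof
            assume "\<kappa> N < k"
            then have "grid T N (\<kappa> N) \<le> grid T N (k - 1)" using \<open>T > 0\<close> by (intro grid_mono) auto
            then have "\<omega> \<in> prev N k" using \<kappa>(2)[of N] \<open>\<kappa> N < k\<close> inB by (auto simp: prev_def)
            with * show False by simp
          qed
          ultimately show "k = \<kappa> N" by simp
        next
          assume "k = \<kappa> N"
          then show "\<omega> \<in> B (grid T N k) - prev N k"
            using \<kappa>(2)[of N] \<kappa>(3)[of "k - 1" N] inB by (auto simp: prev_def not_le)
        qed
        then show ?thesis using \<omega> by (auto simp: C_def)
      qed
      have pick: "(\<Sum>k<Suc N. g k * indicator (C N k) \<omega>) = (if \<kappa> N < Suc N \<and> \<bar>Y (grid T N (\<kappa> N)) \<omega>\<bar> \<le> 1 then g (\<kappa> N) else 0)"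
        for g :: "nat \<Rightarrow> ennreal" and N
      proof -
        have "(\<Sum>k<Suc N. g k * indicator (C N k) \<omega>) = (\<Sum>k<Suc N. if k = \<kappa> N then (if \<bar>Y (grid T N (\<kappa> N)) \<omega>\<bar> \<le> 1 then g (\<kappa> N) else 0) else 0)"
          by (intro sum.cong refl) (simp add: indicator_def inC)
        then show ?thesis by (simp del: sum.lessThan_Suc)
      qed
      have "(\<lambda>N. Y (grid T N (\<kappa> N)) \<omega>) \<longlonglongrightarrow> Y \<tau> \<omega>"
        using \<kappa>(4) \<tau>(1) gn by (intro continuous_on_tendsto_compose[OF contY[OF \<omega>]]) auto
      then have Ylim: "(\<lambda>N. Y (grid T N (\<kappa> N)) \<omega>) \<longlonglongrightarrow> 0" by (simp add: Y\<tau>)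
      from tendstoD[OF this, of 1] have ev1: "\<forall>\<^sub>F N in sequentially. \<bar>Y (grid T N (\<kappa> N)) \<omega>\<bar> \<le> 1"
        by (auto elim!: eventually_mono)
      have ev2: "\<forall>\<^sub>F N in sequentially. \<kappa> N < Suc N"
        using order_tendstoD(2)[OF \<kappa>(4) \<tau>T]
      proof eventually_elim
        case (elim N)
        then have "\<kappa> N \<noteq> Suc N" using grid_Suc[of T N] by auto
        then show ?case using \<kappa>(1)[of N] by simp
      qed
      have "(\<lambda>N. expected_payoff r \<sigma> (T - grid T N (\<kappa> N)) (Y (grid T N (\<kappa> N)) \<omega>)) \<longlonglongrightarrow> 1"
        using \<tau>T \<open>\<sigma> > 0\<close> by (intro tendsto_expected_payoff_barrier[where ?s0.0="T - \<tau>"] tendsto_diff tendsto_const \<kappa>(4) Ylim) auto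
      then have "(\<lambda>N. ennreal (expected_payoff r \<sigma> (T - grid T N (\<kappa> N)) (Y (grid T N (\<kappa> N)) \<omega>))) \<longlonglongrightarrow> ennreal 1"
        by (intro tendsto_ennrealI)
      moreover have "\<forall>\<^sub>F N in sequentially. ennreal (expected_payoff r \<sigma> (T - grid T N (\<kappa> N)) (Y (grid T N (\<kappa> N)) \<omega>)) = R N \<omega>"
        using ev1 ev2 by eventually_elim (simp only: R_def pick simp_thms if_True)
      ultimately have "(\<lambda>N. R N \<omega>) \<longlonglongrightarrow> 1" by (auto dest: Lim_transform_eventually)
      moreover have "\<forall>\<^sub>F N in sequentially. L N \<omega> = ennreal (payoff r \<sigma> (Y T \<omega>))"
        using ev1 ev2 by eventually_elim (simp only: L_def pick simp_thms if_True)
      then have "(\<lambda>N. L N \<omega>) \<longlonglongrightarrow> ennreal (payoff r \<sigma> (Y T \<omega>))" by (rule tendsto_eventually)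
      moreover have "L N \<omega> \<le> ennreal (payoff r \<sigma> (Y T \<omega>))" for N
        unfolding L_def pick by simp
      moreover have "R N \<omega> \<le> ennreal (1 + exp (2 * \<bar>r\<bar> / \<sigma>\<^sup>2))" for N
        unfolding R_def pick using expected_payoff_le[of "Y (grid T N (\<kappa> N)) \<omega>" r \<sigma>, THEN ennreal_leI]
        by (simp del: ennreal_plus)
      ultimately show ?thesis using True by simp
    qed
  qed
  have lims: "AE \<omega> in M. (\<lambda>N. L N \<omega>) \<longlonglongrightarrow> ennreal (payoff r \<sigma> (Y T \<omega>)) * indicator A \<omega>"
    "AE \<omega> in M. (\<lambda>N. R N \<omega>) \<longlonglongrightarrow> indicator A \<omega>"
    "\<And>N. AE \<omega> in M. L N \<omega> \<le> ennreal (payoff r \<sigma> (Y T \<omega>))"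
    "\<And>N. AE \<omega> in M. R N \<omega> \<le> ennreal (1 + exp (2 * \<bar>r\<bar> / \<sigma>\<^sup>2))"
    by (rule eventually_mono[OF lims_AE]; blast)+
  have total: "(\<integral>\<^sup>+\<omega>. ennreal (payoff r \<sigma> (Y T \<omega>)) \<partial>M) = ennreal (expected_payoff r \<sigma> T y)"
  proof -
    have "(\<integral>\<^sup>+\<omega>. ennreal (payoff r \<sigma> (Y T \<omega>)) \<partial>M) = (\<integral>\<^sup>+\<omega>. ennreal (payoff r \<sigma> (y + r * T + \<sigma> * W T \<omega>)) * indicator (space M) \<omega> \<partial>M)"
      unfolding Y_def by (intro nn_integral_cong) simp
    also have "\<dots> = (\<integral>\<^sup>+\<omega>. ennreal (expected_payoff r \<sigma> (T - 0) (y + r * 0 + \<sigma> * W 0 \<omega>)) * indicator (space M) \<omega> \<partial>M)"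
      using sets.top[of "F 0"] space_F[of 0] assms by (intro markov_payoff) auto
    also have "\<dots> = (\<integral>\<^sup>+\<omega>. ennreal (expected_payoff r \<sigma> T y) \<partial>M)"
      using W_0 by (intro nn_integral_cong_AE) (auto elim!: eventually_mono)
    finally show ?thesis by (simp add: emeasure_space_1)
  qed
  have limL: "(\<lambda>N. \<integral>\<^sup>+\<omega>. L N \<omega> \<partial>M) \<longlonglongrightarrow> (\<integral>\<^sup>+\<omega>. ennreal (payoff r \<sigma> (Y T \<omega>)) * indicator A \<omega> \<partial>M)"
    by (rule nn_integral_dominated_convergence[where w="\<lambda>\<omega>. ennreal (payoff r \<sigma> (Y T \<omega>))"])
      (use lims total in \<open>auto simp: less_top[symmetric]\<close>)
  have limR: "(\<lambda>N. \<integral>\<^sup>+\<omega>. R N \<omega> \<partial>M) \<longlonglongrightarrow> (\<integral>\<^sup>+\<omega>. indicator A \<omega> \<partial>M)"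
    by (rule nn_integral_dominated_convergence[where w="\<lambda>\<omega>. ennreal (1 + exp (2 * \<bar>r\<bar> / \<sigma>\<^sup>2))"])
      (use lims in \<open>auto simp: emeasure_space_1 less_top[symmetric]\<close>)
  have before: "\<omega> \<in> A \<or> 0 \<le> Y T \<omega>" if "\<omega> \<in> space M" for \<omega>
  proof (rule disjCI)
    assume "\<not> 0 \<le> Y T \<omega>"
    show "\<omega> \<in> A"
    proof (rule ccontr)
      assume "\<omega> \<notin> A"
      then have "0 \<le> Y u \<omega>" if "0 \<le> u" "u < T" for u using that \<open>\<omega> \<in> space M\<close> by (force simp: A_def)
      moreover have "continuous_on {0..T} (\<lambda>t. Y t \<omega>)" using continuous_on_subset[OF contY[OF that]] by auto
      ultimately have "0 \<le> Y T \<omega>" using limit_from_left_nonneg[of T "\<lambda>t. Y t \<omega>"] \<open>T > 0\<close> by blast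
      then show False using \<open>\<not> 0 \<le> Y T \<omega>\<close> by simp
    qed
  qed
  have "ennreal (expected_payoff r \<sigma> T y) = (\<integral>\<^sup>+\<omega>. ennreal (payoff r \<sigma> (Y T \<omega>)) * indicator A \<omega> \<partial>M)"
    unfolding total[symmetric]
  proof (rule nn_integral_cong_AE)
    show "AE \<omega> in M. ennreal (payoff r \<sigma> (Y T \<omega>)) = ennreal (payoff r \<sigma> (Y T \<omega>)) * indicator A \<omega>"
      using noatom AE_space
      by eventually_elim (use before in \<open>force simp: payoff_def indicator_def\<close>)
  qed
  also have "\<dots> = (\<integral>\<^sup>+\<omega>. indicator A \<omega> \<partial>M)"
    using LIMSEQ_unique[OF limL[unfolded LR] limR] .
  also have "\<dots> = emeasure M A" by simp
  also have "\<dots> = emeasure M (B T)"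
  proof (rule emeasure_eq_AE)
    show "AE \<omega> in M. \<omega> \<in> A \<longleftrightarrow> \<omega> \<in> B T"
      using noatom AE_space
    proof eventually_elim
      case (elim \<omega>)
      have "\<omega> \<in> B T \<longleftrightarrow> \<omega> \<in> A \<or> Y T \<omega> \<le> 0"
        using elim \<open>T > 0\<close> by (auto simp: A_def B_def order_le_less)
      then show ?case using before[of \<omega>] elim by auto
    qed
    show "B T \<in> sets M" using BF sets_F \<open>T > 0\<close> by (meson less_imp_le subsetD)
  qed measurable
  finally have "ennreal (expected_payoff r \<sigma> T y) = ennreal (prob (B T))" by (simp add: emeasure_eq_measure)
  then have "prob (B T) = expected_payoff r \<sigma> T y" using expected_payoff_nonneg by (simp add: ennreal_inj)
  then show ?thesis by (simp add: B_def Y_def)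
qed

lemma hitting_time_le_iff:
  assumes "continuous_on {0..} (\<lambda>t. X t \<omega>)"
  shows "hitting_time X b \<omega> \<le> ereal t \<longleftrightarrow> (\<exists>u\<in>{0..t}. X u \<omega> \<le> b)"
proof
  assume le: "hitting_time X b \<omega> \<le> ereal t"
  show "\<exists>u\<in>{0..t}. X u \<omega> \<le> b"
  proof (cases "\<exists>u\<ge>0. X u \<omega> \<le> b")
    case False
    then have e: "{t. 0 \<le> t \<and> X t \<omega> \<le> b} = {}" by auto
    have "hitting_time X b \<omega> = \<infinity>" unfolding hitting_time_def e by (simp add: top_ereal_def)
    with le show ?thesis by simp
  next
    case True
    then obtain u where u: "0 \<le> u" "X u \<omega> \<le> b" by blast
    obtain s where s: "0 \<le> s" "s \<le> u" "X s \<omega> \<le> b" "\<And>v. 0 \<le> v \<Longrightarrow> X v \<omega> \<le> b \<Longrightarrow> s \<le> v"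
      using first_passage[OF assms u] by metis
    have "ereal s \<le> hitting_time X b \<omega>"
      unfolding hitting_time_def by (rule Inf_greatest) (use s in auto)
    with le have "s \<le> t" using order_trans by fastforce
    then show ?thesis using s by auto
  qed
next
  assume "\<exists>u\<in>{0..t}. X u \<omega> \<le> b"
  then obtain u where u: "0 \<le> u" "u \<le> t" "X u \<omega> \<le> b" by auto
  have "hitting_time X b \<omega> \<le> ereal u"
    unfolding hitting_time_def by (rule Inf_lower) (use u in auto)
  also have "\<dots> \<le> ereal t" using u by simp
  finally show "hitting_time X b \<omega> \<le> ereal t" .
qed

lemma indistinguishable:
  fixes X Y :: "real \<Rightarrow> 'a \<Rightarrow> real"
  assumes X: "\<And>\<omega>. \<omega> \<in> space M \<Longrightarrow> continuous_on {0..} (\<lambda>t. X t \<omega>)"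
    and Y: "\<And>\<omega>. \<omega> \<in> space M \<Longrightarrow> continuous_on {0..} (\<lambda>t. Y t \<omega>)"
    and eq: "\<And>t. 0 \<le> t \<Longrightarrow> AE \<omega> in M. X t \<omega> = Y t \<omega>"
  shows "AE \<omega> in M. \<forall>t\<ge>0. X t \<omega> = Y t \<omega>"
proof -
  obtain D :: "real set" where D: "countable D" "D \<subseteq> {0..}" "{0..} \<subseteq> closure D"
    using separable[of "{0..} :: real set"] by blast
  have "AE \<omega> in M. \<forall>q\<in>D. X q \<omega> = Y q \<omega>"
    using D eq by (subst AE_ball_countable) auto
  then show ?thesis using AE_space
  proof eventually_elim
    case (elim \<omega>)
    show ?case
    proof (intro allI impI)
      fix t :: real assume "0 \<le> t"
      then obtain q where q: "\<And>i. q i \<in> D" "q \<longlonglongrightarrow> t"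
        using D closure_sequential[of t D] by auto
      have qn: "0 \<le> q i" for i using q(1)[of i] D(2) by auto
      have "(\<lambda>i. X (q i) \<omega>) \<longlonglongrightarrow> X t \<omega>" "(\<lambda>i. Y (q i) \<omega>) \<longlonglongrightarrow> Y t \<omega>"
        using q(2) \<open>0 \<le> t\<close> qn
        by (auto intro!: continuous_on_tendsto_compose[OF X[OF \<open>\<omega> \<in> space M\<close>]] continuous_on_tendsto_compose[OF Y[OF \<open>\<omega> \<in> space M\<close>]])
      moreover have "X (q i) \<omega> = Y (q i) \<omega>" for i using elim q(1) by blast
      ultimately show "X t \<omega> = Y t \<omega>" using LIMSEQ_unique by auto
    qed
  qed
qed

lemma gbm_hitting_prob:
  assumes gbm: "geometric_brownian_motion M F W \<mu> \<sigma> x X" and "\<sigma> > 0" "0 < b" "b \<le> x" "0 < t"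
  shows "hitting_prob M X b t = expected_payoff (\<mu> - \<sigma>\<^sup>2 / 2) \<sigma> t (ln (x / b))"
proof -
  define r where "r = \<mu> - \<sigma>\<^sup>2 / 2"
  define y where "y = ln (x / b)"
  have X: "continuous_adapted M F X" using gbm by (simp add: geometric_brownian_motion_def)
  have "AE \<omega> in M. \<forall>s\<ge>0. X s \<omega> = x * exp (r * s + \<sigma> * W s \<omega>)"
  proof (rule indistinguishable)
    show "continuous_on {0..} (\<lambda>s. X s \<omega>)" if "\<omega> \<in> space M" for \<omega> by (rule continuous_adaptedD[OF X that])
    show "continuous_on {0..} (\<lambda>s. x * exp (r * s + \<sigma> * W s \<omega>))" if "\<omega> \<in> space M" for \<omega>
      by (intro continuous_intros continuous_adaptedD[OF W_continuous_adapted that])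
    show "AE \<omega> in M. X s \<omega> = x * exp (r * s + \<sigma> * W s \<omega>)" if "0 \<le> s" for s
      unfolding r_def by (rule gbm_explicit[OF gbm that])
  qed
  then have "AE \<omega> in M. (\<exists>u\<in>{0..t}. X u \<omega> \<le> b) \<longleftrightarrow> (\<exists>u\<in>{0..t}. y + r * u + \<sigma> * W u \<omega> \<le> 0)"
  proof eventually_elim
    case (elim \<omega>)
    have "X u \<omega> \<le> b \<longleftrightarrow> y + r * u + \<sigma> * W u \<omega> \<le> 0" if "u \<in> {0..t}" for u
    proof -
      have "X u \<omega> = b * exp (y + r * u + \<sigma> * W u \<omega>)"
        using elim that assms by (simp add: y_def exp_add)
      then show ?thesis using \<open>0 < b\<close> by simp
    qed
    then show ?case by blast
  qed
  then have "prob {\<omega>\<in>space M. \<exists>u\<in>{0..t}. X u \<omega> \<le> b} = prob {\<omega>\<in>space M. \<exists>u\<in>{0..t}. y + r * u + \<sigma> * W u \<omega> \<le> 0}"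
  proof (intro finite_measure_eq_AE)
    show "{\<omega>\<in>space M. \<exists>u\<in>{0..t}. X u \<omega> \<le> b} \<in> events"
      using hit_event[OF X, of t b] sets_F[of t] \<open>0 < t\<close> by auto
    show "{\<omega>\<in>space M. \<exists>u\<in>{0..t}. y + r * u + \<sigma> * W u \<omega> \<le> 0} \<in> events"
      using hit_event[OF drifted_continuous_adapted, of t y r \<sigma> 0] sets_F[of t] \<open>0 < t\<close> by auto
  qed (auto elim!: eventually_mono)
  also have "\<dots> = expected_payoff r \<sigma> t y"
    using assms by (intro drifted_hitting_probability) (auto simp: y_def)
  also have "{\<omega>\<in>space M. \<exists>u\<in>{0..t}. X u \<omega> \<le> b} = {\<omega>\<in>space M. hitting_time X b \<omega> \<le> ereal t}"
    using hitting_time_le_iff[of X _ b t] continuous_adaptedD[OF X] by auto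
  finally show ?thesis by (simp add: hitting_prob_def r_def y_def)
qed

end

section \<open>The derivative at the barrier\<close>

text \<open>
  The two Gaussian terms coincide at the barrier and add up to the kernel; the exponential prefactor
  contributes the term with \<open>Phi\<close>.
\<close>

lemma expected_payoff_barrier_derivative:
  assumes "\<sigma> > 0" "t > 0" "b > 0"
  shows "((\<lambda>x. expected_payoff r \<sigma> t (ln (x / b))) has_real_derivative
    - (2 / (b * \<sigma>)) * (gauss_kernel (r / \<sigma>) t + r / \<sigma> * Phi (r / \<sigma> * sqrt t))) (at b)"
proof -
  have q: "r * t / (\<sigma> * sqrt t) = r / \<sigma> * sqrt t"
    using assms by (simp add: field_simps)
  have even: "std_normal_density (- u) = std_normal_density u" for u
    by (simp add: std_normal_density_def)
  have g: "std_normal_density (r / \<sigma> * sqrt t) = gauss_kernel (r / \<sigma>) t * sqrt t"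
    using assms by (simp add: gauss_kernel_def std_normal_density_def real_sqrt_mult power_mult_distrib power_divide)
  have lnd: "((\<lambda>x. ln (x / b)) has_real_derivative 1 / b) (at b)"
    using assms by (auto intro!: derivative_eq_intros)
  have "((\<lambda>z. expected_payoff r \<sigma> t z) has_real_derivative
     - (std_normal_density (- (r / \<sigma> * sqrt t)) / (\<sigma> * sqrt t)) - 2 * r / \<sigma>\<^sup>2 * Phi (r / \<sigma> * sqrt t)
     - std_normal_density (r / \<sigma> * sqrt t) / (\<sigma> * sqrt t)) (at 0)"
    unfolding expected_payoff_def q[symmetric] using assms
    by (auto intro!: derivative_eq_intros simp: divide_simps)
      (simp add: power2_eq_square power4_eq_xxxx algebra_simps)
  also have "- (std_normal_density (- (r / \<sigma> * sqrt t)) / (\<sigma> * sqrt t)) - 2 * r / \<sigma>\<^sup>2 * Phi (r / \<sigma> * sqrt t)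
     - std_normal_density (r / \<sigma> * sqrt t) / (\<sigma> * sqrt t)
     = - (2 / \<sigma>) * (gauss_kernel (r / \<sigma>) t + r / \<sigma> * Phi (r / \<sigma> * sqrt t))" (is "_ = ?d")
    unfolding even g using assms by (simp add: field_simps power2_eq_square)
  finally have "(expected_payoff r \<sigma> t has_real_derivative ?d) (at (ln (b / b)))" using assms by simp
  from DERIV_chain2[OF this lnd] show ?thesis by (simp add: field_simps)
qed

theorem mainTheorem6:
  fixes M :: "'a measure" and F :: "real \<Rightarrow> 'a measure"
    and W :: "real \<Rightarrow> 'a \<Rightarrow> real" and X :: "real \<Rightarrow> real \<Rightarrow> 'a \<Rightarrow> real"
    and \<mu> \<sigma> b r :: real and G :: "real \<Rightarrow> real \<Rightarrow> real" and Gx :: "real \<Rightarrow> real"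
  assumes "usual_conditions M F"
    and "standard_brownian_motion M F W"
    and "\<sigma> > 0" and "b > 0"
    and "\<And>x. x \<ge> b \<Longrightarrow> geometric_brownian_motion M F W \<mu> \<sigma> x (X x)"
  defines "G \<equiv> \<lambda>t x. hitting_prob M (X x) b t"
    and "Gx \<equiv> \<lambda>t. right_derivative (G t) b"
    and "r \<equiv> \<mu> - \<sigma>\<^sup>2 / 2"
  shows "\<forall>t>0. G t differentiable (at_right b) \<and>
    set_integrable lborel {0<..<t}
      (\<lambda>u. Gx u / sqrt (t - u) * exp (- (r\<^sup>2 * (t - u) / (2 * \<sigma>\<^sup>2)))) \<and>
    Gx t = - (2 / (b * \<sigma> * sqrt (2 * pi * t))) * exp (- (r\<^sup>2 * t / (2 * \<sigma>\<^sup>2)))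
      + r / (\<sigma> * sqrt (2 * pi)) *
        (LBINT u:{0<..<t}. Gx u / sqrt (t - u) * exp (- (r\<^sup>2 * (t - u) / (2 * \<sigma>\<^sup>2))))"
proof (intro allI impI)
  fix t :: real assume t: "t > 0"
  interpret brownian M F W by (unfold_locales) (rule assms)+
  define a where "a = r / \<sigma>"
  define h where "h u = gauss_kernel a u + a * Phi (a * sqrt u)" for u
  have deriv: "(G u has_vector_derivative - (2 / (b * \<sigma>)) * h u) (at_right b)" if "u > 0" for u
  proof -
    have "((\<lambda>x. expected_payoff r \<sigma> u (ln (x / b))) has_vector_derivative - (2 / (b * \<sigma>)) * h u) (at b within {b..})"
      using expected_payoff_barrier_derivative[OF assms(3) that assms(4), of r]
      unfolding h_def a_def has_real_derivative_iff_has_vector_derivative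
      by (rule has_vector_derivative_at_within)
    then have "(G u has_vector_derivative - (2 / (b * \<sigma>)) * h u) (at b within {b..})"
      by (rule has_vector_derivative_transform[rotated 2])
        (use gbm_hitting_prob[OF assms(5) assms(3,4) _ that] in \<open>auto simp: G_def r_def\<close>)
    then show ?thesis by (rule has_vector_derivative_within_subset) auto
  qed
  have Gx: "Gx u = - (2 / (b * \<sigma>)) * h u" if "u > 0" for u
    unfolding Gx_def using deriv[OF that] by (intro vector_derivative_within trivial_limit_at_right_real)
  have diff: "G t differentiable (at_right b)"
    using deriv[OF t] by (auto simp: has_vector_derivative_def differentiable_def)
  have kernel: "Gx u / sqrt (t - u) * exp (- (r\<^sup>2 * (t - u) / (2 * \<sigma>\<^sup>2))) = - (2 * sqrt (2 * pi) / (b * \<sigma>)) * (h u * gauss_kernel a (t - u))"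
    if "u \<in> {0<..<t}" for u
  proof -
    have s: "sqrt (2 * pi * (t - u)) = sqrt (2 * pi) * sqrt (t - u)" by (simp only: real_sqrt_mult)
    have e: "r\<^sup>2 * (t - u) / (2 * \<sigma>\<^sup>2) = a\<^sup>2 * (t - u) / 2" by (simp add: a_def power_divide)
    have "u > 0" using that by simp
    have "c * v / q * E = c * S * (v * (E / (S * q)))" if "S \<noteq> 0" for c v q E S :: real
      using that by simp
    from this[of "sqrt (2 * pi)" "- (2 / (b * \<sigma>))" "h u" "sqrt (t - u)" "exp (- (a\<^sup>2 * (t - u) / 2))"]
    show ?thesis unfolding Gx[OF \<open>u > 0\<close>] gauss_kernel_def s e by simp
  qed
  note V = volterra_gauss_kernel[OF t, of a, folded h_def]
  have "set_integrable lborel {0<..<t} (\<lambda>u. - (2 * sqrt (2 * pi) / (b * \<sigma>)) * (h u * gauss_kernel a (t - u)))"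
    by (intro set_integrable_mult_right V(1))
  then have int: "set_integrable lborel {0<..<t} (\<lambda>u. Gx u / sqrt (t - u) * exp (- (r\<^sup>2 * (t - u) / (2 * \<sigma>\<^sup>2))))"
    by (subst set_integrable_cong[OF refl refl kernel]) auto
  have "(LBINT u:{0<..<t}. Gx u / sqrt (t - u) * exp (- (r\<^sup>2 * (t - u) / (2 * \<sigma>\<^sup>2))))
     = (LBINT u:{0<..<t}. - (2 * sqrt (2 * pi) / (b * \<sigma>)) * (h u * gauss_kernel a (t - u)))"
    by (rule set_lebesgue_integral_cong) (simp, use kernel in blast)
  then have I: "(LBINT u:{0<..<t}. Gx u / sqrt (t - u) * exp (- (r\<^sup>2 * (t - u) / (2 * \<sigma>\<^sup>2))))
     = - (2 * sqrt (2 * pi) / (b * \<sigma>)) * (LBINT u:{0<..<t}. h u * gauss_kernel a (t - u))"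
    by (simp only: set_integral_mult_right)
  have "Gx t = - (2 / (b * \<sigma>)) * gauss_kernel a t - (2 / (b * \<sigma>)) * (a * (LBINT u:{0<..<t}. h u * gauss_kernel a (t - u)))"
    unfolding Gx[OF t] V(2) by (simp add: algebra_simps)
  also have "- (2 / (b * \<sigma>)) * gauss_kernel a t = - (2 / (b * \<sigma> * sqrt (2 * pi * t))) * exp (- (r\<^sup>2 * t / (2 * \<sigma>\<^sup>2)))"
    using assms(3,4) t by (simp add: gauss_kernel_def a_def power_divide)
  also have "(2 / (b * \<sigma>)) * (a * (LBINT u:{0<..<t}. h u * gauss_kernel a (t - u))) = - (r / (\<sigma> * sqrt (2 * pi)) *
        (LBINT u:{0<..<t}. Gx u / sqrt (t - u) * exp (- (r\<^sup>2 * (t - u) / (2 * \<sigma>\<^sup>2)))))"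
    unfolding I using assms(3,4) by (simp add: a_def mult_ac)
  finally have "Gx t = - (2 / (b * \<sigma> * sqrt (2 * pi * t))) * exp (- (r\<^sup>2 * t / (2 * \<sigma>\<^sup>2)))
      + r / (\<sigma> * sqrt (2 * pi)) *
        (LBINT u:{0<..<t}. Gx u / sqrt (t - u) * exp (- (r\<^sup>2 * (t - u) / (2 * \<sigma>\<^sup>2))))"
    by simp
  with diff int show "G t differentiable (at_right b) \<and>
    set_integrable lborel {0<..<t}
      (\<lambda>u. Gx u / sqrt (t - u) * exp (- (r\<^sup>2 * (t - u) / (2 * \<sigma>\<^sup>2)))) \<and>
    Gx t = - (2 / (b * \<sigma> * sqrt (2 * pi * t))) * exp (- (r\<^sup>2 * t / (2 * \<sigma>\<^sup>2)))
      + r / (\<sigma> * sqrt (2 * pi)) *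
        (LBINT u:{0<..<t}. Gx u / sqrt (t - u) * exp (- (r\<^sup>2 * (t - u) / (2 * \<sigma>\<^sup>2))))"
    by blast
qed

end
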